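(* For any integer $n\ge 3$, \begin{align*} e_0(n)&=n-3,\\ e_1(n)&=\tfrac32(n-3)+\delta_1(n),\\ e_2(n)&=2(n-3)+\delta_2(n),\\ e_3(n)&=\tfrac94(n-3)+\delta_3(n),\\ e_4(n)&=\tfrac52(n-3)+\delta_4(n), \end{align*} with the exception of $e_4(3)=0$ and $e_4(4)=2$ (so the formula for $e_4(n)$ holds for all $n\ge 5$). Here - $\delta_1(n)=\tfrac12$ if $n\equiv 0 \pmod 2$, and $\delta_1(n)=0$ otherwise; - $\delta_2(n)=1$ if $n\equiv 2\pmod 3$, and $\delta_2(n)=0$ otherwise; - $\delta_3(n)=-\tfrac14,\ \tfrac12,\ \tfrac54,\ 0$ if $n\equiv 0,1,2,3\pmod 4$, respectively; - $\delta_4(n)=\tfrac12,\ 0,\ \tfrac32,\ 1$ if $n\equiv 0,1,2,3\pmod 4$, respectively.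
   Context: $D_n$ denotes the complete convex graph on $n$ vertices minus the sides of the polygon: its vertices are the vertices of a convex $n$-gon and its edges are all the diagonals (straight segments) of the polygon. Two edges cross if they intersect at a point interior to both. For an integer $\ell\ge 0$, $e_\ell(n)$ is the maximum number of edges over all subgraphs of $D_n$ in which each edge is crossed at most $\ell$ times by other edges of the subgraph. *)

theory Defs
  imports "HOL-Analysis.Analysis"
begin

text \<open>
  A convex polygon is given as the filled planar region: a polytope in the plane. Its vertices
  are its extreme points (so no three of them are collinear) and its sides are its
  one-dimensional faces. For \<open>n \<ge> 3\<close> the polytope is automatically two-dimensional.
\<close>

definition polygon_vertices :: "(real^2) set \<Rightarrow> (real^2) set" where
  "polygon_vertices P = {v. v extreme_point_of P}"

definition convex_ngon :: "nat \<Rightarrow> (real^2) set \<Rightarrow> bool" where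
  "convex_ngon n P \<longleftrightarrow> polytope P \<and> card (polygon_vertices P) = n"

text \<open>
  Edges of the graph are the straight segments themselves; a nondegenerate segment determines
  its two endpoints, so this is the same as working with unordered pairs of vertices.
\<close>

definition diagonals :: "(real^2) set \<Rightarrow> (real^2) set set" where
  "diagonals P = {closed_segment u v | u v.
     u \<in> polygon_vertices P \<and> v \<in> polygon_vertices P \<and> u \<noteq> v \<and>
     \<not> (closed_segment u v) edge_of P}"

text \<open>The relative interior of a segment is the segment without its endpoints.\<close>

definition crosses :: "(real^2) set \<Rightarrow> (real^2) set \<Rightarrow> bool" where
  "crosses s t \<longleftrightarrow> (\<exists>x. x \<in> rel_interior s \<and> x \<in> rel_interior t)"

text \<open>
  A subgraph is represented by its edge set, since isolated vertices affect neither the number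
  of edges nor the crossings.
\<close>

definition crossed_at_most :: "nat \<Rightarrow> (real^2) set set \<Rightarrow> bool" where
  "crossed_at_most l F \<longleftrightarrow> (\<forall>s\<in>F. card {t \<in> F - {s}. crosses s t} \<le> l)"

definition max_edges :: "nat \<Rightarrow> (real^2) set \<Rightarrow> nat" where
  "max_edges l P = Max {card F | F. F \<subseteq> diagonals P \<and> crossed_at_most l F}"

definition delta1 :: "nat \<Rightarrow> real" where
  "delta1 n = (if n mod 2 = 0 then 1/2 else 0)"

definition delta2 :: "nat \<Rightarrow> real" where
  "delta2 n = (if n mod 3 = 2 then 1 else 0)"

definition delta3 :: "nat \<Rightarrow> real" where
  "delta3 n = (if n mod 4 = 0 then - 1/4
               else if n mod 4 = 1 then 1/2
               else if n mod 4 = 2 then 5/4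
               else 0)"

definition delta4 :: "nat \<Rightarrow> real" where
  "delta4 n = (if n mod 4 = 0 then 1/2
               else if n mod 4 = 1 then 0
               else if n mod 4 = 2 then 3/2
               else 1)"

end

theory Submission
  imports Defs
begin

text \<open>
  Write \<open>s = n - 2\<close>. An edge \<open>f\<close> together with some of the edges crossing it cuts the polygon into
  smaller ones, to which induction applies; what is lost is the number of edges crossing these
  cutting edges. For \<open>l \<le> 3\<close> it suffices to cut along an edge with \<open>l\<close> crossings and two of its
  crossing edges, or along a fan when all edges crossing a common edge pairwise share an endpoint.

  For \<open>l = 4\<close> three mutually crossing edges give a good cut. If there are none, a stronger bound holds:
  at most \<open>(5 s - 4) / 2\<close> edges (one half more if \<open>s = 5\<close>). Here one cuts along an edge \<open>f\<close> and two disjoint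
  edges \<open>e\<close>, \<open>g\<close> crossing it, taken as close together as possible. The six remaining arcs have some
  slack against \<open>5 / 2\<close> edges per inner vertex whenever they are nonempty, because every edge
  entering an arc also crosses \<open>e\<close>, \<open>f\<close> or \<open>g\<close>; a case analysis on the nonempty arcs shows that the slack
  always makes up for the loss.

  The extremal examples are chains of small dense pieces glued along sides.
\<close>

section \<open>Linear and periodic models\<close>

text \<open>A cut trades inner vertices for the crossings on the cutting edges: at most 3 edges for
  2 vertices when \<open>l = 1\<close>, 6 for 3 when \<open>l = 2\<close>, 9 for 4 when
  \<open>l = 3\<close>. These ratios are the slopes 3/2, 2 and 9/4. For \<open>l = 4\<close> the
  same computation gives 12 for 4, where the slope 5/2, attained by gluing hexagons with all nine
  diagonals, allows only 10. Three mutually crossing edges save the missing 2 because their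
  crossings with each other need not be paid twice. A pair of disjoint edges crossing a third saves
  nothing, and the difficulty of the proof is to find these 2 edges in the arcs. Hence the
  triple-free case is proved with a surplus, \<open>2 * card F <= 5 * (n - 2) - 4\<close>, so that
  every nonempty arc gives some of it back. The exception at \<open>n = 7\<close> is genuine: a
  heptagon carries 11 edges without three mutually crossing ones. It weakens the bound for arcs with
  five inner vertices; this is repaired through the edges entering such an arc and through
  parity.\<close>

definition crs :: "int \<times> int \<Rightarrow> int \<times> int \<Rightarrow> bool" where
  "crs e f \<longleftrightarrow> fst e < fst f \<and> fst f < snd e \<and> snd e < snd f \<or>
               fst f < fst e \<and> fst e < snd f \<and> snd f < snd e"

definition dgs :: "int \<Rightarrow> (int \<times> int) set" where
  "dgs n = {(u, v). 0 \<le> u \<and> u + 2 \<le> v \<and> v < n \<and> \<not> (u = 0 \<and> v = n - 1)}"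

text \<open>\<open>crs e e\<close> is false, so an edge does not count itself.\<close>

definition lcr :: "nat \<Rightarrow> (int \<times> int) set \<Rightarrow> bool" where
  "lcr l F \<longleftrightarrow> (\<forall>e\<in>F. card {f \<in> F. crs e f} \<le> l)"

lemma finite_dgs: "finite (dgs n)"
  by (rule finite_subset[of _ "{0..n} \<times> {0..n}"]) (auto simp: dgs_def)

definition arcset :: "(int \<Rightarrow> int \<Rightarrow> bool) \<Rightarrow> int \<Rightarrow> int \<Rightarrow> (int \<times> int) set" where
  "arcset E L R = {(u, v). L \<le> u \<and> u < v \<and> v \<le> R \<and> E u v}"

definition wt :: "(int \<Rightarrow> int \<Rightarrow> bool) \<Rightarrow> int \<Rightarrow> int \<Rightarrow> nat" where
  "wt E L R = card (arcset E L R)"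

text \<open>The edges destroyed when the arc is cut at the vertex \<open>z\<close>; edges ending at
  \<open>z\<close> survive in one of the halves.\<close>

definition overset :: "(int \<Rightarrow> int \<Rightarrow> bool) \<Rightarrow> int \<Rightarrow> int \<Rightarrow> int \<Rightarrow> (int \<times> int) set" where
  "overset E L z R = {(u, v). L \<le> u \<and> u < z \<and> z < v \<and> v \<le> R \<and> E u v}"

text \<open>
  Vertices are also treated as integers modulo \<open>n\<close>, an edge being represented by all its lifts. An edge
  crossing \<open>uv\<close> then has exactly one lift in \<open>crset n E u v\<close>.
\<close>

definition crset :: "int \<Rightarrow> (int \<Rightarrow> int \<Rightarrow> bool) \<Rightarrow> int \<Rightarrow> int \<Rightarrow> (int \<times> int) set" where
  "crset n E u v = {(x, y). u < x \<and> x < v \<and> v < y \<and> y < u + n \<and> E x y}"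

lemma finite_arcset: "finite (arcset E L R)"
  by (rule finite_subset[of _ "{L..R} \<times> {L..R}"]) (auto simp: arcset_def)

lemma finite_overset: "finite (overset E L z R)"
  by (rule finite_subset[of _ "{L..R} \<times> {L..R}"]) (auto simp: overset_def)

lemma finite_crset: "finite (crset n E u v)"
  by (rule finite_subset[of _ "{u..v} \<times> {v..u+n}"]) (auto simp: crset_def)

lemma wt_split:
  assumes "L \<le> z" "z \<le> R"
  shows "wt E L R = wt E L z + wt E z R + card (overset E L z R)"
proof -
  have eq: "arcset E L R = (arcset E L z \<union> arcset E z R) \<union> overset E L z R"
    using assms by (auto simp: arcset_def overset_def)
  have "card (arcset E L R) = card (arcset E L z \<union> arcset E z R) + card (overset E L z R)"
    unfolding eq
    by (rule card_Un_disjoint) (auto simp: finite_arcset finite_overset, auto simp: arcset_def overset_def)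
  also have "card (arcset E L z \<union> arcset E z R) = card (arcset E L z) + card (arcset E z R)"
    by (rule card_Un_disjoint) (auto simp: finite_arcset, auto simp: arcset_def)
  finally show ?thesis by (simp add: wt_def)
qed

locale cyc =
  fixes n :: int and E :: "int \<Rightarrow> int \<Rightarrow> bool"
  assumes n3: "3 \<le> n"
    and sym: "E u v \<Longrightarrow> E v u"
    and per: "E (u + n) v = E u v"
    and irrefl: "\<not> E u u"
    and no_side: "\<not> E u (u + 1)"
begin

lemma per2: "E u (v + n) = E u v"
  using sym per by blast

lemma edge_gap: "E u v \<Longrightarrow> u < v \<Longrightarrow> u + 2 \<le> v"
  using no_side[of u] by (cases "v = u + 1") auto

lemma wt_0: "R \<le> L + 1 \<Longrightarrow> wt E L R = 0"
proof -
  assume "R \<le> L + 1"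
  hence "arcset E L R = {}" using edge_gap by (fastforce simp: arcset_def)
  thus ?thesis by (simp add: wt_def)
qed

lemma crset_swap: "card (crset n E v (u + n)) = card (crset n E u v)"
proof -
  have "bij_betw (\<lambda>(x, y). (y, x + n)) (crset n E u v) (crset n E v (u + n))"
  proof (rule bij_betw_byWitness[where f' = "\<lambda>(x, y). (y - n, x)"])
    show "(\<lambda>(x, y). (y, x + n)) ` crset n E u v \<subseteq> crset n E v (u + n)"
      by (auto simp: crset_def per2 intro: sym)
    show "(\<lambda>(x, y). (y - n, x)) ` crset n E v (u + n) \<subseteq> crset n E u v"
      using per2 sym by (auto simp: crset_def) (metis diff_add_cancel)
  qed auto
  thus ?thesis by (simp add: bij_betw_same_card)
qed

lemma wt_shift: "wt E (L + n) (R + n) = wt E L R"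
proof -
  have "bij_betw (\<lambda>(x, y). (x + n, y + n)) (arcset E L R) (arcset E (L + n) (R + n))"
  proof (rule bij_betw_byWitness[where f' = "\<lambda>(x, y). (x - n, y - n)"])
    show "(\<lambda>(x, y). (x + n, y + n)) ` arcset E L R \<subseteq> arcset E (L + n) (R + n)"
      by (auto simp: arcset_def per2 per)
    show "(\<lambda>(x, y). (x - n, y - n)) ` arcset E (L + n) (R + n) \<subseteq> arcset E L R"
      by (auto simp: arcset_def) (metis diff_add_cancel per2 per)
  qed auto
  thus ?thesis by (simp add: bij_betw_same_card wt_def)
qed

text \<open>The window from \<open>a\<close> to \<open>a + n\<close> is half open. An edge from
  \<open>a\<close> to a vertex beyond \<open>b\<close> is seen there as \<open>(a, y)\<close>, but
  inside the arc from \<open>b\<close> to \<open>a + n\<close> as \<open>(y, a + n)\<close>; trading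
  \<open>?A\<close> for \<open>?B\<close> accounts for this. The edge \<open>ab\<close> lies in both
  arcs, which allows the extra summand on the left.\<close>

lemma total_split:
  assumes ab: "a < b" "b < a + n"
  shows "card {(x, y). a \<le> x \<and> x < y \<and> y < a + n \<and> E x y} + of_bool (E a b)
    \<le> wt E a b + wt E b (a + n) + card (crset n E a b)"
proof -
  let ?T = "{(x, y). a \<le> x \<and> x < y \<and> y < a + n \<and> E x y}"
  let ?W = "{(x, y). b \<le> x \<and> x < y \<and> y < a + n \<and> E x y}"
  let ?A = "{(x, y). x = a \<and> b < y \<and> y < a + n \<and> E x y}"
  let ?B = "{(x, y). y = a + n \<and> b < x \<and> x < a + n \<and> E x y}"
  let ?C = "{(x, y). x = b \<and> y = a + n \<and> E x y}"
  have fin: "finite ?W" "finite ?A" "finite ?B" "finite ?C"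
    by (rule finite_subset[of _ "{a..a+n} \<times> {a..a+n}"], use ab in auto)+
  have T: "?T \<subseteq> (arcset E a b \<union> ?W) \<union> (?A \<union> crset n E a b)"
    using ab by (auto simp: arcset_def crset_def)
  have "card ?T \<le> card ((arcset E a b \<union> ?W) \<union> (?A \<union> crset n E a b))"
    by (rule card_mono[OF _ T]) (auto simp: fin finite_arcset finite_crset)
  also have "\<dots> \<le> (card (arcset E a b) + card ?W) + (card ?A + card (crset n E a b))"
    by (meson add_mono card_Un_le order_trans)
  finally have 1: "card ?T \<le> card (arcset E a b) + card ?W + card ?A + card (crset n E a b)" by simp
  have "bij_betw (\<lambda>(x, y). (y, x + n)) ?A ?B"
  proof (rule bij_betw_byWitness[where f' = "\<lambda>(x, y). (y - n, x)"])
    show "(\<lambda>(x, y). (y, x + n)) ` ?A \<subseteq> ?B" by (auto simp: per2 intro: sym)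
    show "(\<lambda>(x, y). (y - n, x)) ` ?B \<subseteq> ?A" by (auto simp: per2 intro: sym)
  qed auto
  hence AB: "card ?A = card ?B" by (simp add: bij_betw_same_card)
  have eq: "arcset E b (a + n) = (?W \<union> ?B) \<union> ?C" using ab by (auto simp: arcset_def)
  have "card (arcset E b (a + n)) = card (?W \<union> ?B) + card ?C"
    unfolding eq by (rule card_Un_disjoint) (use fin in auto)
  also have "card (?W \<union> ?B) = card ?W + card ?B"
    by (rule card_Un_disjoint) (use fin in auto)
  finally have 2: "card (arcset E b (a + n)) = card ?W + card ?B + card ?C" .
  have "card ?C = of_bool (E a b)"
  proof (cases "E a b")
    case True
    hence "?C = {(b, a + n)}" using per2 sym by auto
    thus ?thesis using True by simp
  next
    case False
    hence "\<not> E b (a + n)" using per2 sym by blast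
    hence "?C = {}" by auto
    thus ?thesis using False by (simp only: card.empty of_bool_def if_False)
  qed
  with 1 2 AB show ?thesis by (simp add: wt_def)
qed

end

section \<open>Lifting diagonals to a periodic relation and restricting it to arcs\<close>

definition srt :: "int \<Rightarrow> int \<Rightarrow> int \<times> int" where
  "srt p q = (min p q, max p q)"

definition lift :: "int \<Rightarrow> (int \<times> int) set \<Rightarrow> int \<Rightarrow> int \<Rightarrow> bool" where
  "lift n F u v \<longleftrightarrow> srt (u mod n) (v mod n) \<in> F"

lemma mod_window:
  assumes "0 \<le> u" "u < n" "u \<le> x" "x < u + (n::int)"
  shows "x mod n = (if x < n then x else x - n)"
proof (cases "x < n")
  case False
  have "x mod n = (x - n) mod n" by simp
  also have "\<dots> = x - n" using False assms by (intro mod_pos_pos_trivial) auto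
  finally show ?thesis using False by simp
qed (use assms in auto)

lemma lift_cyc:
  assumes "3 \<le> n" "F \<subseteq> dgs n"
  shows "cyc n (lift n F)"
proof
  fix u v :: int
  show "3 \<le> n" by fact
  show "lift n F u v \<Longrightarrow> lift n F v u" by (simp add: lift_def srt_def min.commute max.commute)
  show "lift n F (u + n) v = lift n F u v" by (simp add: lift_def)
  show "\<not> lift n F u u" using assms by (auto simp: lift_def srt_def dgs_def)
  have b: "0 \<le> u mod n" "u mod n < n" using assms(1) by simp_all
  have *: "(u + 1) mod n = (if u mod n + 1 < n then u mod n + 1 else 0)"
  proof (cases "u mod n + 1 < n")
    case True
    thus ?thesis using b mod_add_left_eq[of u n 1] by (simp add: mod_pos_pos_trivial)
  next
    case False
    hence "u mod n + 1 = n" using b by linarith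
    thus ?thesis using mod_add_left_eq[of u n 1] by simp
  qed
  show "\<not> lift n F u (u + 1)" using assms * pos_mod_sign[of n u] pos_mod_bound[of n u]
    by (auto simp: lift_def srt_def dgs_def min_def max_def split: if_splits)
qed

lemma lift_total:
  assumes "3 \<le> n" "F \<subseteq> dgs n"
  shows "card F \<le> card {(x, y). a \<le> x \<and> x < y \<and> y < a + n \<and> lift n F x y}" (is "_ \<le> card ?T")
proof -
  have fin: "finite ?T" by (rule finite_subset[of _ "{a..a+n} \<times> {a..a+n}"]) auto
  have "F \<subseteq> (\<lambda>(x, y). srt (x mod n) (y mod n)) ` ?T"
  proof
    fix e assume e: "e \<in> F"
    obtain p q where pq: "e = (p, q)" by (cases e)
    have b: "0 \<le> p" "p < q" "q < n" using e pq assms by (auto simp: dgs_def)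
    define x where "x = a + (p - a) mod n"
    define y where "y = a + (q - a) mod n"
    have m: "x mod n = p" "y mod n = q" using b by (simp_all add: x_def y_def mod_add_right_eq)
    have r: "a \<le> x" "x < a + n" "a \<le> y" "y < a + n" using assms(1) by (auto simp: x_def y_def)
    have ne: "x \<noteq> y" using m b by auto
    have s: "srt p q = e" "srt q p = e" using b pq by (auto simp: srt_def)
    show "e \<in> (\<lambda>(x, y). srt (x mod n) (y mod n)) ` ?T"
    proof (cases "x < y")
      case True
      hence "(x, y) \<in> ?T" using r m s e by (auto simp: lift_def)
      thus ?thesis using m s by (intro image_eqI[of _ _ "(x, y)"]) auto
    next
      case False
      hence "(y, x) \<in> ?T" using r m s e ne by (auto simp: lift_def)
      thus ?thesis using m s by (intro image_eqI[of _ _ "(y, x)"]) auto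
    qed
  qed
  thus ?thesis using fin by (meson surj_card_le)
qed

lemma lift_crs:
  assumes n: "3 \<le> n" and xy: "u < x" "x < v" "v < y" "y < u + (n::int)"
  shows "crs (srt (u mod n) (v mod n)) (srt (x mod n) (y mod n))"
proof -
  define e where "e = srt (u mod n) (v mod n)"
  define f where "f = srt (x mod n) (y mod n)"
  \<comment> \<open>Subtracting this multiple of \<open>n\<close> moves \<open>u\<close> into the
    range of residues. The four cases below tell how many of \<open>y\<close>, \<open>v\<close>,
    \<open>x\<close> then lie at or beyond \<open>n\<close>.\<close>
  define s where "s = u - u mod n"
  have sn: "x mod n = (x - s) mod n" for x
    by (simp add: mod_eq_dvd_iff s_def dvd_minus_mod)
  have u0: "0 \<le> u - s" "u - s < n" using n by (auto simp: s_def)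
  have md: "x mod n = (if x - s < n then x - s else x - s - n)" if "u \<le> x" "x < u + n" for x
    using mod_window[of "u - s" n "x - s"] sn[of x] u0 that by auto
  have mu: "u mod n = u - s" using md[of u] u0 n by simp
  consider "y - s < n" | "v - s < n" "n \<le> y - s" | "x - s < n" "n \<le> v - s" | "n \<le> x - s" using xy by linarith
  hence "crs e f"
  proof cases
    case 1
    hence m: "v mod n = v - s" "x mod n = x - s" "y mod n = y - s" using md[of v] md[of x] md[of y] xy by auto
    have "e = (u - s, v - s)" "f = (x - s, y - s)" unfolding e_def f_def m mu srt_def using xy by (auto simp: min_def max_def)
    thus ?thesis using xy by (simp add: crs_def)
  next
    case 2
    hence m: "v mod n = v - s" "x mod n = x - s" "y mod n = y - s - n" using md[of v] md[of x] md[of y] xy by auto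
    have "e = (u - s, v - s)" "f = (y - s - n, x - s)" unfolding e_def f_def m mu srt_def using xy by (auto simp: min_def max_def)
    thus ?thesis using xy by (simp add: crs_def)
  next
    case 3
    hence m: "v mod n = v - s - n" "x mod n = x - s" "y mod n = y - s - n" using md[of v] md[of x] md[of y] xy by auto
    have "e = (v - s - n, u - s)" "f = (y - s - n, x - s)" unfolding e_def f_def m mu srt_def using xy by (auto simp: min_def max_def)
    thus ?thesis using xy by (simp add: crs_def)
  next
    case 4
    hence m: "v mod n = v - s - n" "x mod n = x - s - n" "y mod n = y - s - n" using md[of v] md[of x] md[of y] xy by auto
    have "e = (v - s - n, u - s)" "f = (x - s - n, y - s - n)" unfolding e_def f_def m mu srt_def using xy by (auto simp: min_def max_def)
    thus ?thesis using xy by (simp add: crs_def)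
  qed
  thus ?thesis by (simp add: e_def f_def)
qed

text \<open>All lifts in \<open>crset\<close> lie in a window shorter than \<open>n\<close>, so
  equal residues mean equal lifts, and \<open>v\<close> separates first from second endpoints. Hence
  no edge is counted by two lifts.\<close>

lemma lift_cr:
  assumes n: "3 \<le> n" and F: "F \<subseteq> dgs n" and l: "lcr l F"
    and uv: "u < v" "v < u + n" "lift n F u v"
  shows "card (crset n (lift n F) u v) \<le> l"
proof -
  define e where "e = srt (u mod n) (v mod n)"
  have e: "e \<in> F" using uv(3) by (simp add: e_def lift_def)
  let ?h = "\<lambda>(x, y). srt (x mod n) (y mod n)"
  have "?h ` crset n (lift n F) u v \<subseteq> {f \<in> F. crs e f}"
    using lift_crs[OF n] by (auto simp: crset_def e_def lift_def)
  moreover have "inj_on ?h (crset n (lift n F) u v)"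
  proof (rule inj_onI, clarify)
    fix x y x' y'
    assume "(x, y) \<in> crset n (lift n F) u v" "(x', y') \<in> crset n (lift n F) u v"
      and eq: "srt (x mod n) (y mod n) = srt (x' mod n) (y' mod n)"
    hence *: "u < x" "x < v" "v < y" "y < u + n" "u < x'" "x' < v" "v < y'" "y' < u + n"
      by (auto simp: crset_def)
    have eqmod: "p = q" if "p mod n = q mod n" "u < p" "p < u + n" "u < q" "q < u + n" for p q
    proof -
      have "n dvd p - q" using that(1) by (simp add: mod_eq_dvd_iff)
      moreover have "\<bar>p - q\<bar> < n" using that by linarith
      ultimately show ?thesis using dvd_imp_le_int[of "p - q" n] n by fastforce
    qed
    have "(x mod n = x' mod n \<and> y mod n = y' mod n) \<or> (x mod n = y' mod n \<and> y mod n = x' mod n)"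
      using eq by (auto simp: srt_def min_def max_def split: if_splits)
    thus "x = x' \<and> y = y'" using eqmod * uv(2)
      by (smt (verit))
  qed
  moreover have "finite {f \<in> F. crs e f}" using F finite_dgs finite_subset by fastforce
  ultimately have "card (crset n (lift n F) u v) \<le> card {f \<in> F. crs e f}"
    by (meson card_inj_on_le)
  thus ?thesis using l e unfolding lcr_def by fastforce
qed

text \<open>The arc closed by its chord is a polygon with \<open>R - L + 1\<close> vertices, and
  restricting to it creates no crossings. The chord is a side of this polygon, not a diagonal, hence
  the separate summand for \<open>E L R\<close>.\<close>

lemma arc_sub:
  assumes c: "cyc n E" and cr: "\<And>u v. u < v \<Longrightarrow> v < u + n \<Longrightarrow> E u v \<Longrightarrow> card (crset n E u v) \<le> l"
    and LR: "L + 2 \<le> R" "R < L + n"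
  defines "F \<equiv> {(u, v). (L + u, L + v) \<in> arcset E L R \<and> \<not> (u = 0 \<and> v = R - L)}"
  shows "F \<subseteq> dgs (R - L + 1)" "lcr l F" "wt E L R = card F + of_bool (E L R)"
proof -
  interpret cyc n E by fact
  show "F \<subseteq> dgs (R - L + 1)" using edge_gap by (fastforce simp: F_def dgs_def arcset_def)
  have finF: "finite F" by (rule finite_subset[of _ "{0..R-L} \<times> {0..R-L}"]) (auto simp: F_def arcset_def)
  show "lcr l F" unfolding lcr_def
  proof
    fix e assume "e \<in> F"
    then obtain u v where e: "e = (u, v)" and uv: "0 \<le> u" "u < v" "v \<le> R - L" "E (L + u) (L + v)"
      by (auto simp: F_def arcset_def)
    \<comment> \<open>An edge reaching \<open>(u, v)\<close> from the left begins inside it with its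
      larger endpoint, so the lift in \<open>crset\<close> is the swapped one.\<close>
    let ?h = "\<lambda>(x, y). if x < u then (L + y, L + x + n) else (L + x, L + y)"
    have "?h ` {f \<in> F. crs e f} \<subseteq> crset n E (L + u) (L + v)"
    proof
      fix g assume "g \<in> ?h ` {f \<in> F. crs e f}"
      then obtain x y where xy: "(x, y) \<in> F" "crs e (x, y)" "g = ?h (x, y)" by auto
      have E: "E (L + x) (L + y)" "E (L + y) (L + x + n)" "0 \<le> x" "y \<le> R - L"
        using xy(1) sym per2 by (auto simp: F_def arcset_def)
      show "g \<in> crset n E (L + u) (L + v)"
        using xy(2,3) E uv LR by (auto simp: crs_def e crset_def)
    qed
    moreover have "inj_on ?h {f \<in> F. crs e f}"
      by (rule inj_onI) (use LR in \<open>auto simp: F_def arcset_def split: if_splits\<close>)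
    ultimately have "card {f \<in> F. crs e f} \<le> card (crset n E (L + u) (L + v))"
      by (meson card_inj_on_le finite_crset)
    also have "\<dots> \<le> l" using cr[of "L + u" "L + v"] uv LR by auto
    finally show "card {f \<in> F. crs e f} \<le> l" .
  qed
  let ?g = "\<lambda>(u, v). (L + u, L + v)"
  have "arcset E L R = ?g ` F \<union> {(x, y). x = L \<and> y = R \<and> E x y}"
  proof (intro equalityI subsetI)
    fix f assume f: "f \<in> arcset E L R"
    obtain x y where xy: "f = (x, y)" by (cases f)
    show "f \<in> ?g ` F \<union> {(x, y). x = L \<and> y = R \<and> E x y}"
    proof (cases "x = L \<and> y = R")
      case True thus ?thesis using f xy by (auto simp: arcset_def)
    next
      case False
      hence "(x - L, y - L) \<in> F" using f xy by (auto simp: F_def)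
      hence "?g (x - L, y - L) \<in> ?g ` F" by (rule imageI)
      thus ?thesis using xy by simp
    qed
  qed (use LR in \<open>auto simp: F_def arcset_def\<close>)
  moreover have "?g ` F \<inter> {(x, y). x = L \<and> y = R \<and> E x y} = {}" by (auto simp: F_def)
  moreover have "finite {(x, y). x = L \<and> y = R \<and> E x y}"
    by (rule finite_subset[of _ "{(L, R)}"]) auto
  ultimately have "wt E L R = card (?g ` F) + card {(x, y). x = L \<and> y = R \<and> E x y}"
    using finF by (simp add: wt_def card_Un_disjoint)
  also have "card (?g ` F) = card F" by (rule card_image) (auto simp: inj_on_def)
  also have "card {(x, y). x = L \<and> y = R \<and> E x y} = of_bool (E L R)"
  proof (cases "E L R")
    case True
    hence "{(x, y). x = L \<and> y = R \<and> E x y} = {(L, R)}" by auto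
    thus ?thesis using True by simp
  next
    case False
    hence "{(x, y). x = L \<and> y = R \<and> E x y} = {}" by auto
    thus ?thesis using False by (simp only: card.empty of_bool_def if_False)
  qed
  finally show "wt E L R = card F + of_bool (E L R)" .
qed

section \<open>Triples of mutually crossing edges\<close>

definition no3 :: "int \<Rightarrow> (int \<Rightarrow> int \<Rightarrow> bool) \<Rightarrow> bool" where
  "no3 n E \<longleftrightarrow> \<not> (\<exists>p1 p2 p3 q1 q2 q3. p1 < p2 \<and> p2 < p3 \<and> p3 < q1 \<and> q1 < q2 \<and> q2 < q3 \<and> q3 < p1 + n \<and>
     E p1 q1 \<and> E p2 q2 \<and> E p3 q3)"

definition no3F :: "(int \<times> int) set \<Rightarrow> bool" where
  "no3F F \<longleftrightarrow> \<not> (\<exists>p1 p2 p3 q1 q2 q3. p1 < p2 \<and> p2 < p3 \<and> p3 < q1 \<and> q1 < q2 \<and> q2 < q3 \<and>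
     (p1, q1) \<in> F \<and> (p2, q2) \<in> F \<and> (p3, q3) \<in> F)"

lemma no3F_crs:
  assumes "no3F F" "(a, a') \<in> F" "(b, b') \<in> F" "(c, c') \<in> F"
  shows "\<not> (crs (a, a') (b, b') \<and> crs (a, a') (c, c') \<and> crs (b, b') (c, c'))"
proof
  assume "crs (a, a') (b, b') \<and> crs (a, a') (c, c') \<and> crs (b, b') (c, c')"
  hence "a < b \<and> b < c \<and> c < a' \<and> a' < b' \<and> b' < c' \<or> a < c \<and> c < b \<and> b < a' \<and> a' < c' \<and> c' < b' \<or>
    b < a \<and> a < c \<and> c < b' \<and> b' < a' \<and> a' < c' \<or> b < c \<and> c < a \<and> a < b' \<and> b' < c' \<and> c' < a' \<or>
    c < a \<and> a < b \<and> b < c' \<and> c' < a' \<and> a' < b' \<or> c < b \<and> b < a \<and> a < c' \<and> c' < b' \<and> b' < a'"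
    unfolding crs_def fst_conv snd_conv by linarith
  thus False using assms unfolding no3F_def by (elim disjE) blast+
qed

lemma lift_no3:
  assumes n: "3 \<le> n" and F: "no3F F"
  shows "no3 n (lift n F)"
  unfolding no3_def
proof (intro notI, elim exE conjE)
  fix p1 p2 p3 q1 q2 q3 :: int
  assume o: "p1 < p2" "p2 < p3" "p3 < q1" "q1 < q2" "q2 < q3" "q3 < p1 + n"
    and E: "lift n F p1 q1" "lift n F p2 q2" "lift n F p3 q3"
  define s where "s = (\<lambda>p q. srt (p mod n) (q mod n))"
  have "crs (s p1 q1) (s p2 q2)" "crs (s p1 q1) (s p3 q3)" "crs (s p2 q2) (s p3 q3)"
    unfolding s_def by (rule lift_crs[OF n]; use o in linarith)+
  moreover have "s p1 q1 \<in> F" "s p2 q2 \<in> F" "s p3 q3 \<in> F" using E by (auto simp: s_def lift_def)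
  ultimately show False using no3F_crs[OF F] by (metis prod.collapse)
qed

lemma arc_no3:
  assumes "no3 n E" "R < L + n"
  shows "no3F {(u, v). (L + u, L + v) \<in> arcset E L R \<and> \<not> (u = 0 \<and> v = R - L)}"
  unfolding no3F_def
proof (intro notI, elim exE conjE)
  fix p1 p2 p3 q1 q2 q3 :: int
  let ?F = "{(u, v). (L + u, L + v) \<in> arcset E L R \<and> \<not> (u = 0 \<and> v = R - L)}"
  assume o: "p1 < p2" "p2 < p3" "p3 < q1" "q1 < q2" "q2 < q3"
    and E: "(p1, q1) \<in> ?F" "(p2, q2) \<in> ?F" "(p3, q3) \<in> ?F"
  have "L + p1 < L + p2" "L + p2 < L + p3" "L + p3 < L + q1" "L + q1 < L + q2" "L + q2 < L + q3"
    "L + q3 < L + p1 + n" "E (L + p1) (L + q1)" "E (L + p2) (L + q2)" "E (L + p3) (L + q3)"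
    using o E assms(2) by (auto simp: arcset_def)
  thus False using assms(1) unfolding no3_def by blast
qed

section \<open>Cutting along crossing edges\<close>

context cyc begin

text \<open>An edge \<open>ab\<close> is counted in both arcs, so \<open>tot a b\<close> bounds the
  number of edges plus 1. This is the same 1 as in the upper bounds proved by induction.\<close>

definition tot :: "int \<Rightarrow> int \<Rightarrow> nat" where
  "tot a b = wt E a b + wt E b (a + n) + card (crset n E a b)"

text \<open>An edge over \<open>x\<close> inside an arc straddles \<open>x\<close>, whereas the
  lifts in \<open>crset n E x y\<close> must begin after \<open>x\<close>. Passing to the other end
  of the edge reconciles the two.\<close>

definition flip :: "(int \<times> int) set \<Rightarrow> (int \<times> int) set" where
  "flip A = (\<lambda>(u, v). (v, u + n)) ` A"

lemma card_flip: "card (flip A) = card A"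
  unfolding flip_def by (rule card_image) (auto simp: inj_on_def)

lemma flip_E: "E u v \<Longrightarrow> E v (u + n)" using per2 sym by blast

lemma flip_over_cr:
  assumes "a \<le> L" "L < x" "x < R" "R \<le> b" "b < y" "y < a + n"
  shows "flip (overset E L x R) \<subseteq> crset n E x y"
  using assms flip_E by (auto simp: flip_def overset_def crset_def)

lemma over_cr_bot:
  assumes "x < L" "L < y" "y < R" "R < x + n"
  shows "overset E L y R \<subseteq> crset n E x y"
  using assms by (auto simp: overset_def crset_def)

text \<open>Edges over \<open>x\<close> in one arc and over \<open>y\<close> in the other all cross
  \<open>xy\<close>. Only \<open>ab\<close> belongs to both arcs and can be counted twice; this is
  the 1 on the right.\<close>

lemma two_over:
  assumes o: "a < x" "x < b" "b < y" "y < a + n" "E a b"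
  shows "card (overset E a x b) + card (overset E b y (a + n)) \<le> card (crset n E x y) + 1"
proof -
  let ?A = "flip (overset E a x b)" and ?B = "overset E b y (a + n)"
  have sub: "?A \<union> ?B \<subseteq> crset n E x y"
    using flip_over_cr[of a a x b b y] over_cr_bot[of x b y "a + n"] o by auto
  have int: "?A \<inter> ?B \<subseteq> {(b, a + n)}" using o by (auto simp: flip_def overset_def)
  have fin: "finite ?A" "finite ?B" by (simp_all add: flip_def finite_overset)
  have "card ?A + card ?B = card (?A \<union> ?B) + card (?A \<inter> ?B)" using fin by (rule card_Un_Int)
  moreover have "card (?A \<union> ?B) \<le> card (crset n E x y)" by (rule card_mono[OF finite_crset sub])
  moreover have "card (?A \<inter> ?B) \<le> 1" using card_mono[OF _ int] by simp
  ultimately show ?thesis by (simp add: card_flip)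
qed

lemma quad_cut:
  assumes o: "a < x" "x < b" "b < y" "y < a + n" "E a b"
  shows "tot a b \<le> wt E a x + wt E x b + wt E b y + wt E y (a + n)
    + card (crset n E a b) + card (crset n E x y) + 1"
  using two_over[OF o] wt_split[of a x b E] wt_split[of b y "a + n" E] o by (simp add: tot_def)

text \<open>The cut at \<open>y'\<close> is charged to \<open>xy'\<close>. This edge is also crossed
  by \<open>ab\<close>, which does not lie over \<open>y'\<close> in the arc starting at
  \<open>y\<close>; the inclusion is therefore strict and absorbs the surplus 1 of
  \<open>two_over\<close>.\<close>

lemma pent_cut:
  assumes o: "a < x" "x < b" "b < y" "y < y'" "y' < a + n" "E a b"
  shows "tot a b \<le> wt E a x + wt E x b + wt E b y + wt E y y' + wt E y' (a + n)
    + card (crset n E a b) + card (crset n E x y) + card (crset n E x y')"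
proof -
  have s1: "overset E y y' (a + n) \<subseteq> crset n E x y'" using over_cr_bot[of x y y' "a + n"] o by auto
  have "overset E y y' (a + n) \<subset> crset n E x y'"
  proof
    have "(b, a + n) \<in> crset n E x y'" using o flip_E by (auto simp: crset_def)
    moreover have "(b, a + n) \<notin> overset E y y' (a + n)" using o by (auto simp: overset_def)
    ultimately show "overset E y y' (a + n) \<noteq> crset n E x y'" by blast
  qed (rule s1)
  hence "card (overset E y y' (a + n)) < card (crset n E x y')" by (rule psubset_card_mono[OF finite_crset])
  thus ?thesis using two_over[of a x b y] wt_split[of a x b E] wt_split[of b y "a + n" E]
      wt_split[of y y' "a + n" E] o by (simp add: tot_def)
qed

text \<open>The cuts at \<open>x1\<close> and \<open>y1\<close> are charged to \<open>x1y1\<close>,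
  those at \<open>x2\<close> and \<open>y2\<close> to \<open>x2y2\<close>. Cutting first at
  \<open>x1\<close> on one side and first at \<open>y2\<close> on the other charges
  \<open>ab\<close> at most once to each of them, so no surplus arises.\<close>

lemma hex_cut:
  assumes o: "a < x1" "x1 < x2" "x2 < b" "b < y2" "y2 < y1" "y1 < a + n"
  shows "tot a b \<le> wt E a x1 + wt E x1 x2 + wt E x2 b + wt E b y2 + wt E y2 y1 + wt E y1 (a + n)
    + card (crset n E a b) + card (crset n E x1 y1) + card (crset n E x2 y2)"
proof -
  have "flip (overset E a x1 b) \<union> overset E y2 y1 (a + n) \<subseteq> crset n E x1 y1"
    using flip_over_cr[of a a x1 b b y1] over_cr_bot[of x1 y2 y1 "a + n"] o by auto
  hence "card (flip (overset E a x1 b) \<union> overset E y2 y1 (a + n)) \<le> card (crset n E x1 y1)"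
    by (rule card_mono[OF finite_crset])
  moreover have "card (flip (overset E a x1 b) \<union> overset E y2 y1 (a + n)) =
      card (flip (overset E a x1 b)) + card (overset E y2 y1 (a + n))"
    by (rule card_Un_disjoint) (use o in \<open>auto simp: flip_def finite_overset, auto simp: overset_def\<close>)
  moreover have "flip (overset E x1 x2 b) \<union> overset E b y2 (a + n) \<subseteq> crset n E x2 y2"
    using flip_over_cr[of x1 x1 x2 b b y2] over_cr_bot[of x2 b y2 "a + n"] o by auto
  hence "card (flip (overset E x1 x2 b) \<union> overset E b y2 (a + n)) \<le> card (crset n E x2 y2)"
    by (rule card_mono[OF finite_crset])
  moreover have "card (flip (overset E x1 x2 b) \<union> overset E b y2 (a + n)) =
      card (flip (overset E x1 x2 b)) + card (overset E b y2 (a + n))"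
    by (rule card_Un_disjoint) (use o in \<open>auto simp: flip_def finite_overset, auto simp: overset_def\<close>)
  ultimately show ?thesis using wt_split[of a x1 b E] wt_split[of x1 x2 b E]
      wt_split[of b y2 "a + n" E] wt_split[of y2 y1 "a + n" E] o by (simp add: tot_def card_flip)
qed

text \<open>Now \<open>y1\<close> is cut off first, so \<open>ab\<close> may be charged twice to
  \<open>x1y1\<close>; this is balanced by the crossing of \<open>x1y1\<close> with
  \<open>x2y2\<close>, which is not charged to it. The edge \<open>x2y2\<close> is crossed by
  \<open>ab\<close> and by \<open>x1y1\<close>, and neither is charged to it: this is the gain of
  2.\<close>

lemma hex_cut_crossing:
  assumes o: "a < x1" "x1 < x2" "x2 < b" "b < y1" "y1 < y2" "y2 < a + n"
    and E: "E a b" "E x1 y1" "E x2 y2"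
  shows "tot a b + 2 \<le> wt E a x1 + wt E x1 x2 + wt E x2 b + wt E b y1 + wt E y1 y2 + wt E y2 (a + n)
    + card (crset n E a b) + card (crset n E x1 y1) + card (crset n E x2 y2)"
proof -
  let ?A = "flip (overset E a x1 b)" and ?B = "overset E b y1 (a + n)"
  have fin: "finite ?A" "finite ?B" by (simp_all add: flip_def finite_overset)
  have "insert (x2, y2) (?A \<union> ?B) \<subseteq> crset n E x1 y1"
    using flip_over_cr[of a a x1 b b y1] over_cr_bot[of x1 b y1 "a + n"] o E by (auto simp: crset_def)
  hence "card (insert (x2, y2) (?A \<union> ?B)) \<le> card (crset n E x1 y1)"
    by (rule card_mono[OF finite_crset])
  moreover have "(x2, y2) \<notin> ?A \<union> ?B" using o by (auto simp: flip_def overset_def)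
  hence "card (insert (x2, y2) (?A \<union> ?B)) = card (?A \<union> ?B) + 1" using fin by simp
  moreover have "card ?A + card ?B = card (?A \<union> ?B) + card (?A \<inter> ?B)" using fin by (rule card_Un_Int)
  moreover have "card (?A \<inter> ?B) \<le> card {(b, a + n)}"
    by (rule card_mono) (use o in \<open>auto simp: flip_def overset_def\<close>)
  ultimately have 1: "card (overset E a x1 b) + card ?B \<le> card (crset n E x1 y1)" by (simp add: card_flip)
  let ?C = "flip (overset E x1 x2 b)" and ?D = "overset E y1 y2 (a + n)"
  have fin: "finite ?C" "finite ?D" by (simp_all add: flip_def finite_overset)
  have "insert (b, a + n) (insert (y1, x1 + n) (?C \<union> ?D)) \<subseteq> crset n E x2 y2"
    using flip_over_cr[of x1 x1 x2 b b y2] over_cr_bot[of x2 y1 y2 "a + n"] o E flip_E by (auto simp: crset_def)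
  hence "card (insert (b, a + n) (insert (y1, x1 + n) (?C \<union> ?D))) \<le> card (crset n E x2 y2)"
    by (rule card_mono[OF finite_crset])
  moreover have "(b, a + n) \<notin> insert (y1, x1 + n) (?C \<union> ?D)" "(y1, x1 + n) \<notin> ?C \<union> ?D"
    using o by (auto simp: flip_def overset_def)
  hence "card (insert (b, a + n) (insert (y1, x1 + n) (?C \<union> ?D))) = card (?C \<union> ?D) + 2" using fin by simp
  moreover have "card (?C \<union> ?D) = card ?C + card ?D"
    by (rule card_Un_disjoint[OF fin]) (use o in \<open>auto simp: flip_def overset_def\<close>)
  ultimately have 2: "card (overset E x1 x2 b) + card ?D + 2 \<le> card (crset n E x2 y2)" by (simp add: card_flip)
  show ?thesis using 1 2 wt_split[of a x1 b E] wt_split[of x1 x2 b E]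
      wt_split[of b y1 "a + n" E] wt_split[of y1 y2 "a + n" E] o by (simp add: tot_def)
qed

section \<open>Cutting along a fan\<close>

definition fan :: "int \<Rightarrow> int \<Rightarrow> int \<Rightarrow> int \<Rightarrow> bool" where
  "fan a b v w \<longleftrightarrow> (\<forall>x y. (x, y) \<in> crset n E v w \<longrightarrow> x = b \<or> y = a + n)"

definition cnt :: "int set \<Rightarrow> int \<Rightarrow> int \<Rightarrow> nat" where
  "cnt A lo hi = card (A \<inter> {lo..<hi})"

lemma cnt_add: "lo \<le> mid \<Longrightarrow> mid \<le> hi \<Longrightarrow> cnt A lo mid + cnt A mid hi = cnt A lo hi"
proof -
  assume "lo \<le> mid" "mid \<le> hi"
  hence "A \<inter> {lo..<hi} = (A \<inter> {lo..<mid}) \<union> (A \<inter> {mid..<hi})" by auto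
  thus ?thesis unfolding cnt_def by (simp add: card_Un_disjoint ivl_disj_int Int_assoc disjoint_iff)
qed

definition fanA :: "int \<Rightarrow> int \<Rightarrow> int set" where "fanA a b = {c. c \<noteq> b \<and> E c (a + n)}"
definition fanB :: "int \<Rightarrow> int \<Rightarrow> int set" where "fanB a b = {c. c \<noteq> a + n \<and> E b c}"

lemma fanA_le:
  assumes o: "a < v" "v < b" "b < w" "w < a + n" "E a b"
  shows "cnt (fanA a b) (v + 1) w + 1 \<le> card (crset n E v w)"
proof -
  let ?f = "\<lambda>c. (c, a + n)"
  have "insert (b, a + n) (?f ` (fanA a b \<inter> {v + 1..<w})) \<subseteq> crset n E v w"
    using o flip_E by (auto simp: fanA_def crset_def)
  hence "card (insert (b, a + n) (?f ` (fanA a b \<inter> {v + 1..<w}))) \<le> card (crset n E v w)"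
    by (rule card_mono[OF finite_crset])
  moreover have "(b, a + n) \<notin> ?f ` (fanA a b \<inter> {v + 1..<w})" by (auto simp: fanA_def)
  ultimately show ?thesis by (simp add: cnt_def card_image inj_on_def)
qed

lemma fanB_le:
  assumes o: "a < v" "v < b" "b < w" "w < a + n" "E a b"
  shows "cnt (fanB a b) (w + 1) (v + n) + 1 \<le> card (crset n E v w)"
proof -
  let ?f = "\<lambda>c. (b, c)"
  have "insert (b, a + n) (?f ` (fanB a b \<inter> {w + 1..<v + n})) \<subseteq> crset n E v w"
    using o flip_E by (auto simp: fanB_def crset_def)
  hence "card (insert (b, a + n) (?f ` (fanB a b \<inter> {w + 1..<v + n}))) \<le> card (crset n E v w)"
    by (rule card_mono[OF finite_crset])
  moreover have "(b, a + n) \<notin> ?f ` (fanB a b \<inter> {w + 1..<v + n})" by (auto simp: fanB_def)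
  ultimately show ?thesis by (simp add: cnt_def card_image inj_on_def)
qed

lemma fan_tail:
  assumes "b < w'" "w' < w" "w < a + n" "v < b" "a < v" "fan a b v w"
  shows "card (overset E w' w (a + n)) \<le> cnt (fanA a b) w' w"
proof -
  have "overset E w' w (a + n) \<subseteq> (\<lambda>c. (c, a + n)) ` (fanA a b \<inter> {w'..<w})"
  proof
    fix e assume "e \<in> overset E w' w (a + n)"
    then obtain u c where e: "e = (u, c)" and u: "w' \<le> u" "u < w" "w < c" "c \<le> a + n" "E u c"
      by (auto simp: overset_def)
    hence "u = b \<or> c = a + n"
      using assms(1-5) assms(6)[unfolded fan_def, rule_format, of u c] by (auto simp: crset_def)
    hence "c = a + n" using u assms(1) by auto
    thus "e \<in> (\<lambda>c. (c, a + n)) ` (fanA a b \<inter> {w'..<w})" using e u assms(1) by (auto simp: fanA_def)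
  qed
  thus ?thesis unfolding cnt_def by (rule surj_card_le[rotated]) simp
qed

lemma fan_head:
  assumes o: "a < v" "v < b" "b < w" "w < a + n" and f: "fan a b v w"
  shows "card (overset E b w (a + n)) \<le> cnt (fanA a b) b w + cnt (fanB a b) (w + 1) (a + n) + 1"
proof -
  let ?A = "(\<lambda>c. (c, a + n)) ` (fanA a b \<inter> {b..<w})" and ?B = "(\<lambda>c. (b, c)) ` (fanB a b \<inter> {w + 1..<a + n})"
  have "overset E b w (a + n) \<subseteq> (?A \<union> ?B) \<union> {(b, a + n)}"
  proof
    fix e assume "e \<in> overset E b w (a + n)"
    then obtain u c where e: "e = (u, c)" and u: "b \<le> u" "u < w" "w < c" "c \<le> a + n" "E u c"
      by (auto simp: overset_def)
    hence "u = b \<or> c = a + n" using f o by (auto simp: fan_def crset_def)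
    thus "e \<in> (?A \<union> ?B) \<union> {(b, a + n)}" using e u by (auto simp: fanA_def fanB_def)
  qed
  hence "card (overset E b w (a + n)) \<le> card ((?A \<union> ?B) \<union> {(b, a + n)})" by (rule card_mono[rotated]) simp
  also have "\<dots> \<le> (card ?A + card ?B) + 1" using card_Un_le[of "?A \<union> ?B" "{(b, a + n)}"] card_Un_le[of ?A ?B] by simp
  also have "card ?A = cnt (fanA a b) b w" by (simp add: cnt_def card_image inj_on_def)
  also have "card ?B = cnt (fanB a b) (w + 1) (a + n)" by (simp add: cnt_def card_image inj_on_def)
  finally show ?thesis .
qed

lemma fan_top:
  assumes o: "a < v" "v < b" "b < w" "w < a + n" and f: "fan a b v w"
  shows "card (overset E a v b) \<le> cnt (fanA a b) (v + 1) b + cnt (fanB a b) (a + n) (v + n) + 1"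
proof -
  let ?A = "(\<lambda>c. (c, a + n)) ` (fanA a b \<inter> {v + 1..<b})" and ?B = "(\<lambda>c. (b, c)) ` (fanB a b \<inter> {a + n..<v + n})"
  have "flip (overset E a v b) \<subseteq> (?A \<union> ?B) \<union> {(b, a + n)}"
  proof
    fix e assume e: "e \<in> flip (overset E a v b)"
    have "e \<in> crset n E v w" using e flip_over_cr[of a a v b b w] o by auto
    moreover obtain u c where uc: "e = (c, u + n)" "a \<le> u" "u < v" "v < c" "c \<le> b" "E c (u + n)"
      using e flip_E by (auto simp: flip_def overset_def)
    ultimately have "c = b \<or> u = a" using f[unfolded fan_def, rule_format, of c "u + n"] by simp
    thus "e \<in> (?A \<union> ?B) \<union> {(b, a + n)}" using uc by (auto simp: fanA_def fanB_def)
  qed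
  hence "card (flip (overset E a v b)) \<le> card ((?A \<union> ?B) \<union> {(b, a + n)})" by (rule card_mono[rotated]) simp
  also have "\<dots> \<le> (card ?A + card ?B) + 1" using card_Un_le[of "?A \<union> ?B" "{(b, a + n)}"] card_Un_le[of ?A ?B] by simp
  also have "card ?A = cnt (fanA a b) (v + 1) b" by (simp add: cnt_def card_image inj_on_def)
  also have "card ?B = cnt (fanB a b) (a + n) (v + n)" by (simp add: cnt_def card_image inj_on_def)
  finally show ?thesis by (simp add: card_flip)
qed

text \<open>Every edge destroyed by the four cuts ends at \<open>a\<close> or at \<open>b\<close>.
  Those at \<open>a\<close> cross the last edge \<open>vw3\<close>, those at \<open>b\<close> cross
  the first edge \<open>vw1\<close>, so these two pay for all cuts, no matter how many edges lie
  between them. The two copies of \<open>ab\<close> are paid by the summands 1 in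
  \<open>fanA_le\<close> and \<open>fanB_le\<close>.\<close>

lemma star_cut3:
  assumes o: "a < v" "v < b" "b < w1" "w1 < w2" "w2 < w3" "w3 < a + n" "E a b"
    and f: "fan a b v w1" "fan a b v w2" "fan a b v w3"
  shows "tot a b \<le> wt E a v + wt E v b + wt E b w1 + wt E w1 w2 + wt E w2 w3 + wt E w3 (a + n)
    + card (crset n E a b) + card (crset n E v w1) + card (crset n E v w3)"
  using fan_top[of a v b w1] fan_head[of a v b w1] fan_tail[of b w1 w2 a v] fan_tail[of b w2 w3 a v]
    fanA_le[of a v b w3] fanB_le[of a v b w1] o f
    cnt_add[of "v + 1" b w1 "fanA a b"] cnt_add[of "v + 1" w1 w2 "fanA a b"] cnt_add[of "v + 1" w2 w3 "fanA a b"]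
    cnt_add[of "w1 + 1" "a + n" "v + n" "fanB a b"]
    wt_split[of a v b E] wt_split[of b w1 "a + n" E] wt_split[of w1 w2 "a + n" E] wt_split[of w2 w3 "a + n" E]
  by (simp add: tot_def)

lemma star_cut4:
  assumes o: "a < v" "v < b" "b < w1" "w1 < w2" "w2 < w3" "w3 < w4" "w4 < a + n" "E a b"
    and f: "fan a b v w1" "fan a b v w2" "fan a b v w3" "fan a b v w4"
  shows "tot a b \<le> wt E a v + wt E v b + wt E b w1 + wt E w1 w2 + wt E w2 w3 + wt E w3 w4 + wt E w4 (a + n)
    + card (crset n E a b) + card (crset n E v w1) + card (crset n E v w4)"
  using fan_top[of a v b w1] fan_head[of a v b w1] fan_tail[of b w1 w2 a v] fan_tail[of b w2 w3 a v] fan_tail[of b w3 w4 a v]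
    fanA_le[of a v b w4] fanB_le[of a v b w1] o f
    cnt_add[of "v + 1" b w1 "fanA a b"] cnt_add[of "v + 1" w1 w2 "fanA a b"] cnt_add[of "v + 1" w2 w3 "fanA a b"]
    cnt_add[of "v + 1" w3 w4 "fanA a b"]
    cnt_add[of "w1 + 1" "a + n" "v + n" "fanB a b"]
    wt_split[of a v b E] wt_split[of b w1 "a + n" E] wt_split[of w1 w2 "a + n" E] wt_split[of w2 w3 "a + n" E]
    wt_split[of w3 w4 "a + n" E]
  by (simp add: tot_def)

end

section \<open>Few crossings\<close>

text \<open>The summand \<open>1\<close> accounts for the side along which a smaller polygon is cut off, which makes the bounds \<open>g\<close> superadditive.\<close>

definition ub :: "nat \<Rightarrow> (nat \<Rightarrow> nat) \<Rightarrow> bool" where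
  "ub l g \<longleftrightarrow> (\<forall>n F. 3 \<le> n \<longrightarrow> F \<subseteq> dgs n \<longrightarrow> lcr l F \<longrightarrow> card F + 1 \<le> g (nat (n - 2)))"

lemma lift_in: "F \<subseteq> dgs n \<Longrightarrow> (u, v) \<in> F \<Longrightarrow> lift n F u v"
proof -
  assume F: "F \<subseteq> dgs n" and uv: "(u, v) \<in> F"
  hence "0 \<le> u" "u < v" "v < n" by (auto simp: dgs_def)
  thus "lift n F u v" using uv by (simp add: lift_def srt_def)
qed

lemma cr_lin:
  assumes n: "3 \<le> n" and F: "F \<subseteq> dgs n" and e: "(u, v) \<in> F"
  shows "card {f \<in> F. crs (u, v) f} \<le> card (crset n (lift n F) u v)"
proof -
  interpret cyc n "lift n F" by (rule lift_cyc[OF n F])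
  let ?h = "\<lambda>(x, y). if x < u then (y, x + n) else (x, y)"
  have "?h ` {f \<in> F. crs (u, v) f} \<subseteq> crset n (lift n F) u v"
  proof
    fix g assume "g \<in> ?h ` {f \<in> F. crs (u, v) f}"
    then obtain x y where xy: "(x, y) \<in> F" "crs (u, v) (x, y)" "g = ?h (x, y)" by auto
    have b: "0 \<le> x" "y < n" "0 \<le> u" "v < n" using xy(1) e F by (auto simp: dgs_def)
    have E: "lift n F x y" "lift n F y (x + n)" using lift_in[OF F xy(1)] flip_E by auto
    show "g \<in> crset n (lift n F) u v"
    proof (cases "x < u")
      case True
      hence "u < y" "y < v" using xy(2) by (auto simp: crs_def)
      thus ?thesis using xy(3) E b True by (simp add: crset_def)
    next
      case False
      hence "u < x" "x < v" "v < y" using xy(2) by (auto simp: crs_def)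
      thus ?thesis using xy(3) E b by (simp add: crset_def)
    qed
  qed
  moreover have "inj_on ?h {f \<in> F. crs (u, v) f}"
  proof (rule inj_onI)
    have bd: "0 \<le> fst f \<and> fst f < snd f \<and> snd f < n" if "f \<in> F" for f
      using F that by (fastforce simp: dgs_def)
    fix f g assume "f \<in> {f \<in> F. crs (u, v) f}" "g \<in> {f \<in> F. crs (u, v) f}" "?h f = ?h g"
    thus "f = g" using bd[of f] bd[of g] by (cases f; cases g) (auto split: if_splits)
  qed
  ultimately show ?thesis by (meson card_inj_on_le finite_crset)
qed

lemma arc_bound:
  assumes "cyc n E" and "\<And>u v. u < v \<Longrightarrow> v < u + n \<Longrightarrow> E u v \<Longrightarrow> card (crset n E u v) \<le> l"
    and IH: "\<And>m F. 3 \<le> m \<Longrightarrow> m < n \<Longrightarrow> F \<subseteq> dgs m \<Longrightarrow> lcr l F \<Longrightarrow> card F + 1 \<le> g (nat (m - 2))"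
    and LR: "L < R" "R - L + 1 < n" and g0: "g 0 = 0"
  shows "wt E L R \<le> g (nat (R - L - 1))"
proof (cases "R = L + 1")
  case True
  thus ?thesis using cyc.wt_0[OF assms(1)] by simp
next
  case False
  hence LR2: "L + 2 \<le> R" "R < L + n" using LR by auto
  from arc_sub[OF assms(1,2) LR2] obtain F where
    F: "F \<subseteq> dgs (R - L + 1)" "lcr l F" "wt E L R = card F + of_bool (E L R)" by blast
  have "card F + 1 \<le> g (nat (R - L + 1 - 2))"
    by (rule IH) (use F LR LR2 in auto)
  hence "card F + 1 \<le> g (nat (R - L - 1))" by (simp add: algebra_simps)
  moreover have "of_bool (E L R) \<le> (1::nat)" by simp
  ultimately show ?thesis using F(3) by linarith
qed

lemma ub_step:
  assumes g0: "g 0 = 0"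
    and step: "\<And>n F. 3 \<le> n \<Longrightarrow> F \<subseteq> dgs n \<Longrightarrow> lcr l F \<Longrightarrow>
      (\<And>L R. L < R \<Longrightarrow> R - L + 1 < n \<Longrightarrow> wt (lift n F) L R \<le> g (nat (R - L - 1))) \<Longrightarrow>
      card F + 1 \<le> g (nat (n - 2))"
  shows "ub l g"
proof -
  have "3 \<le> int k \<longrightarrow> F \<subseteq> dgs (int k) \<longrightarrow> lcr l F \<longrightarrow> card F + 1 \<le> g (nat (int k - 2))" for k F
  proof (induction k arbitrary: F rule: less_induct)
    case (less k)
    show ?case
    proof (intro impI)
      assume k: "3 \<le> int k" and F: "F \<subseteq> dgs (int k)" "lcr l F"
      show "card F + 1 \<le> g (nat (int k - 2))"
      proof (rule step[OF k F])
        fix L R :: int assume LR: "L < R" "R - L + 1 < int k"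
        show "wt (lift (int k) F) L R \<le> g (nat (R - L - 1))"
        proof (rule arc_bound[where l = l and n = "int k" and g = g])
          show "cyc (int k) (lift (int k) F)" by (rule lift_cyc[OF k F(1)])
          show "\<And>u v. u < v \<Longrightarrow> v < u + int k \<Longrightarrow> lift (int k) F u v \<Longrightarrow>
            card (crset (int k) (lift (int k) F) u v) \<le> l" by (rule lift_cr[OF k F])
          show "L < R" "R - L + 1 < int k" "g 0 = 0" by fact+
          fix m F' assume "3 \<le> m" "m < int k" "F' \<subseteq> dgs m" "lcr l F'"
          thus "card F' + 1 \<le> g (nat (m - 2))" using less.IH[of "nat m" F'] by simp
        qed
      qed
    qed
  qed
  note * = this
  have "card F + 1 \<le> g (nat (n - 2))" if "3 \<le> n" "F \<subseteq> dgs n" "lcr l F" for n F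
    using that *[of "nat n" F] by simp
  thus ?thesis by (auto simp: ub_def)
qed

lemma edge_tot:
  assumes "3 \<le> n" "F \<subseteq> dgs n" "a < b" "b < a + n" "lift n F a b"
  shows "card F + 1 \<le> cyc.tot n (lift n F) a b"
proof -
  interpret cyc n "lift n F" by (rule lift_cyc) fact+
  show ?thesis using lift_total[OF assms(1,2), of a] total_split[OF assms(3,4)] assms(5) by (simp add: tot_def)
qed

text \<open>Either the bound for fewer crossings applies, or some edge has exactly
  \<open>Suc l\<close> crossings. The cut may be made along an edge other than the given one, since
  the configuration found need not be based at it.\<close>

lemma ub_Suc:
  assumes g0: "g 0 = 0" and prev: "ub l g'" and le: "\<And>s. 1 \<le> s \<Longrightarrow> g' s \<le> g s"
    and step: "\<And>n E a b. cyc n E \<Longrightarrow> (\<And>u v. u < v \<Longrightarrow> v < u + n \<Longrightarrow> E u v \<Longrightarrow> card (crset n E u v) \<le> Suc l) \<Longrightarrow>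
      (\<And>L R. L < R \<Longrightarrow> R - L + 1 < n \<Longrightarrow> wt E L R \<le> g (nat (R - L - 1))) \<Longrightarrow>
      a < b \<Longrightarrow> b < a + n \<Longrightarrow> E a b \<Longrightarrow> card (crset n E a b) = Suc l \<Longrightarrow>
      \<exists>a b. a < b \<and> b < a + n \<and> E a b \<and> cyc.tot n E a b \<le> g (nat (n - 2))"
  shows "ub (Suc l) g"
proof (rule ub_step[where g = g])
  show "g 0 = 0" by fact
next
  fix n F
  assume n: "3 \<le> n" and F: "F \<subseteq> dgs n" "lcr (Suc l) F"
    and IH: "\<And>L R. L < R \<Longrightarrow> R - L + 1 < n \<Longrightarrow> wt (lift n F) L R \<le> g (nat (R - L - 1))"
  show "card F + 1 \<le> g (nat (n - 2))"
  proof (cases "lcr l F")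
    case True
    hence "card F + 1 \<le> g' (nat (n - 2))" using prev n F by (auto simp: ub_def)
    also have "\<dots> \<le> g (nat (n - 2))" by (rule le) (use n in auto)
    finally show ?thesis .
  next
    case False
    then obtain a b where e: "(a, b) \<in> F" "\<not> card {f \<in> F. crs (a, b) f} \<le> l" unfolding lcr_def by auto
    have ab: "a < b" "b < a + n" using e(1) F(1) by (auto simp: dgs_def)
    have E: "lift n F a b" using lift_in F(1) e(1) by blast
    have "card (crset n (lift n F) a b) = Suc l"
      using cr_lin[OF n F(1) e(1)] e(2) lift_cr[OF n F ab E] by linarith
    from step[OF lift_cyc[OF n F(1)] lift_cr[OF n F] IH ab E this]
    obtain a b where "a < b" "b < a + n" "lift n F a b" "cyc.tot n (lift n F) a b \<le> g (nat (n - 2))" by blast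
    thus ?thesis using edge_tot[OF n F(1)] by fastforce
  qed
qed

section \<open>The bounds as superadditive functions of the number of inner vertices\<close>

definition g1 :: "nat \<Rightarrow> nat" where "g1 s = s + s div 2"
definition g2 :: "nat \<Rightarrow> nat" where "g2 s = 2 * s - (if s mod 3 = 0 then 0 else 1)"
definition g3 :: "nat \<Rightarrow> nat" where "g3 s = 2 * s + s div 4 - (if s mod 4 = 1 \<or> s mod 4 = 2 then 1 else 0)"
text \<open>The general term would allow one diagonal in a triangle and three in a quadrilateral;
  the two exceptional values correct this and are the source of the exceptions for
  \<open>n = 3\<close> and \<open>n = 4\<close>.\<close>

definition g4 :: "nat \<Rightarrow> nat" where "g4 s = (if s = 1 then 1 else if s = 2 then 3 else 2 * s + 2 * (s div 4))"

lemma nat_mod4: "(s::nat) mod 4 = 0 \<or> s mod 4 = 1 \<or> s mod 4 = 2 \<or> s mod 4 = 3"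
proof -
  have "s mod 4 < 4" by simp
  thus ?thesis by linarith
qed

lemma g1_add: "g1 x + g1 y \<le> g1 (x + y)"
  using div_add1_eq[of x y 2] by (simp add: g1_def)

lemma g2_alt: "g2 s + (if s mod 3 = 0 then 0 else 1) = 2 * s"
  unfolding g2_def by (cases s) auto

lemma g2_add: "g2 x + g2 y \<le> g2 (x + y)"
proof -
  have "x mod 3 = 0 \<Longrightarrow> y mod 3 = 0 \<Longrightarrow> (x + y) mod 3 = 0" by (metis add_0 mod_0 mod_add_eq)
  thus ?thesis using g2_alt[of x] g2_alt[of y] g2_alt[of "x + y"] by (auto split: if_splits)
qed

lemma g3_alt: "g3 s + (if s mod 4 = 1 \<or> s mod 4 = 2 then 1 else 0) = 2 * s + s div 4"
  unfolding g3_def by (cases s) auto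

lemma g3_add: "g3 x + g3 y \<le> g3 (x + y)"
proof -
  have d: "(x + y) div 4 = x div 4 + y div 4 + (x mod 4 + y mod 4) div 4" by (rule div_add1_eq)
  have m: "(x + y) mod 4 = (x mod 4 + y mod 4) mod 4" by (simp add: mod_add_eq)
  show ?thesis using nat_mod4[of x] nat_mod4[of y] g3_alt[of x] g3_alt[of y] g3_alt[of "x + y"] unfolding d m
    by (elim disjE) simp_all
qed

lemma g4_add: "g4 x + g4 y \<le> g4 (x + y)"
proof -
  have d: "(x + y) div 4 = x div 4 + y div 4 + (x mod 4 + y mod 4) div 4" by (rule div_add1_eq)
  show ?thesis unfolding g4_def d by (auto simp: not_le)
qed

lemma g1_step: "2 \<le> s \<Longrightarrow> g1 (s - 2) + 3 = g1 s"
  using div_add_self2[of 2 "s - 2"] by (simp add: g1_def)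

lemma sum4:
  assumes "\<And>x y. g x + g y \<le> (g (x + y) :: nat)"
  shows "g a + g b + g c + g d \<le> g (a + b + c + d)"
  using assms[of a b] assms[of "a + b" c] assms[of "a + b + c" d] by linarith

lemma sum5:
  assumes "\<And>x y. g x + g y \<le> (g (x + y) :: nat)"
  shows "g a + g b + g c + g d + g e \<le> g (a + b + c + d + e)"
  using sum4[of g a b c d, OF assms] assms[of "a + b + c + d" e] by linarith

lemma sum6:
  assumes "\<And>x y. g x + g y \<le> (g (x + y) :: nat)"
  shows "g a + g b + g c + g d + g e + g f \<le> g (a + b + c + d + e + f)"
  using sum5[of g a b c d e, OF assms] assms[of "a + b + c + d + e" f] by linarith

lemma obtain_card:
  assumes "2 \<le> card A" obtains x y where "x \<in> A" "y \<in> A" "x \<noteq> y"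
proof -
  have "finite A" using assms by (metis card.infinite not_numeral_le_zero)
  hence "\<not> (\<forall>x\<in>A. \<forall>y\<in>A. x = y)" using assms card_le_Suc0_iff_eq[of A] by auto
  thus ?thesis using that by blast
qed

lemma ub0: "ub 0 (\<lambda>s. s)"
proof (rule ub_step[where g = "\<lambda>s. s"])
  fix n F
  assume n: "3 \<le> n" and F: "F \<subseteq> dgs n" "lcr 0 F"
    and IH: "\<And>L R. L < R \<Longrightarrow> R - L + 1 < n \<Longrightarrow> wt (lift n F) L R \<le> nat (R - L - 1)"
  show "card F + 1 \<le> nat (n - 2)"
  proof (cases "F = {}")
    case True thus ?thesis using n by simp
  next
    case False
    then obtain a b where e: "(a, b) \<in> F" by auto
    interpret cyc n "lift n F" by (rule lift_cyc[OF n F(1)])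
    have ab: "0 \<le> a" "a + 2 \<le> b" "b < n" "b - a + 1 < n" using e F(1) by (auto simp: dgs_def)
    have E: "lift n F a b" using lift_in F(1) e by blast
    have "card F + 1 \<le> tot a b" by (rule edge_tot[OF n F(1) _ _ E]) (use ab in auto)
    moreover have "card (crset n (lift n F) a b) = 0" using lift_cr[OF n F _ _ E] ab by simp
    ultimately have "card F + 1 \<le> nat (b - a - 1) + nat (a + n - b - 1)"
      using IH[of a b] IH[of b "a + n"] ab by (simp add: tot_def)
    thus ?thesis using ab by auto
  qed
qed simp

lemma ub1: "ub 1 g1"
  unfolding One_nat_def
proof (rule ub_Suc[OF _ ub0])
  fix n E a b
  assume c: "cyc n E" and cr: "\<And>u v. u < v \<Longrightarrow> v < u + n \<Longrightarrow> E u v \<Longrightarrow> card (crset n E u v) \<le> Suc 0"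
    and IH: "\<And>L R. L < R \<Longrightarrow> R - L + 1 < n \<Longrightarrow> wt E L R \<le> g1 (nat (R - L - 1))"
    and ab: "a < b" "b < a + n" "E a b" "card (crset n E a b) = Suc 0"
  interpret cyc n E by fact
  have "crset n E a b \<noteq> {}" using ab(4) by (metis card.empty nat.distinct(1))
  then obtain x y where "(x, y) \<in> crset n E a b" by auto
  hence xy: "a < x" "x < b" "b < y" "y < a + n" "E x y" by (auto simp: crset_def)
  \<comment> \<open>The 3 consists of one crossing on each of \<open>ab\<close> and
    \<open>xy\<close> and the surplus 1 of \<open>quad_cut\<close>.\<close>
  have "tot a b \<le> g1 (nat (x - a - 1)) + g1 (nat (b - x - 1)) + g1 (nat (y - b - 1)) + g1 (nat (a + n - y - 1)) + 3"
    using quad_cut[OF xy(1-4) ab(3)] ab(4) cr[of x y] xy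
      IH[of a x] IH[of x b] IH[of b y] IH[of y "a + n"] by simp
  also have "\<dots> \<le> g1 (nat (x - a - 1) + nat (b - x - 1) + nat (y - b - 1) + nat (a + n - y - 1)) + 3"
    by (intro add_mono order_refl sum4 g1_add)
  also have "nat (x - a - 1) + nat (b - x - 1) + nat (y - b - 1) + nat (a + n - y - 1) = nat (n - 2) - 2"
    using xy by auto
  also have "g1 (nat (n - 2) - 2) + 3 = g1 (nat (n - 2))"
    by (rule g1_step) (use xy in auto)
  finally show "\<exists>a b. a < b \<and> b < a + n \<and> E a b \<and> tot a b \<le> g1 (nat (n - 2))" using ab by blast
qed (auto simp: g1_def)

section \<open>Edges crossing a common edge: stars and disjoint pairs\<close>

context cyc begin

text \<open>The lifts in \<open>crset n E u v\<close> have their first endpoint on one side of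
  \<open>uv\<close> and their second on the other, so sharing an endpoint means agreeing in a
  coordinate.\<close>

definition meet_all :: bool where
  "meet_all \<longleftrightarrow> (\<forall>u v x y x' y'. u < v \<longrightarrow> v < u + n \<longrightarrow> E u v \<longrightarrow> (x, y) \<in> crset n E u v \<longrightarrow>
     (x', y') \<in> crset n E u v \<longrightarrow> x = x' \<or> y = y')"

lemma crset_flip: "(x, y) \<in> crset n E u v \<Longrightarrow> (y, x + n) \<in> crset n E v (u + n)"
  using flip_E by (auto simp: crset_def)

lemma swap_edge: "a < b \<Longrightarrow> b < a + n \<Longrightarrow> E a b \<Longrightarrow> b < a + n \<and> a + n < b + n \<and> E b (a + n)"
  using flip_E by auto

text \<open>The edge \<open>ab\<close> itself crosses \<open>vw\<close>, and every edge crossing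
  \<open>vw\<close> must share an endpoint with it.\<close>

lemma meet_all_fan:
  assumes "meet_all" "a < v" "v < b" "b < w" "w < a + n" "E a b" "E v w"
  shows "fan a b v w"
proof -
  have ba: "(b, a + n) \<in> crset n E v w" using assms flip_E by (auto simp: crset_def)
  show ?thesis unfolding fan_def
  proof (intro allI impI)
    fix x y assume "(x, y) \<in> crset n E v w"
    from assms(1)[unfolded meet_all_def, rule_format, of v w x y b "a + n", OF _ _ assms(7) this ba]
    show "x = b \<or> y = a + n" using assms by auto
  qed
qed

text \<open>The edges crossing \<open>ab\<close> form a bipartite graph between its two sides, so
  edges that meet pairwise have a common endpoint: a triangle is impossible. If that endpoint lies
  beyond \<open>b\<close>, the other lift of \<open>ab\<close> is taken.\<close>

lemma star_shape:
  assumes m: "meet_all" and ab: "a < b" "b < a + n" "E a b" and c: "card (crset n E a b) = k" "2 \<le> k"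
  obtains a b v W where "a < v" "v < b" "b < a + n" "E a b" "card (crset n E a b) = k" "card W = k"
    "\<And>w. w \<in> W \<Longrightarrow> b < w \<and> w < a + n \<and> E v w"
proof -
  obtain e e' where e: "e \<in> crset n E a b" "e' \<in> crset n E a b" "e \<noteq> e'"
    using obtain_card[of "crset n E a b"] c by (metis (no_types, lifting))
  obtain x y x' y' where xy: "e = (x, y)" "e' = (x', y')" by (cases e; cases e')
  have M: "p = p' \<or> q = q'" if "(p, q) \<in> crset n E a b" "(p', q') \<in> crset n E a b" for p q p' q'
    using m[unfolded meet_all_def, rule_format, OF ab that] .
  show ?thesis
  proof (cases "x = x'")
    case True
    have "p = x" if "(p, q) \<in> crset n E a b" for p q
      using M[OF that, of x y] M[OF that, of x' y'] e xy True by auto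
    hence eq: "crset n E a b = Pair x ` (snd ` crset n E a b)" by force
    have "card (snd ` crset n E a b) = k" using c(1) eq
      by (metis card_image inj_on_def prod.inject)
    moreover have "a < x" "x < b" using e xy by (auto simp: crset_def)
    moreover have "b < w \<and> w < a + n \<and> E x w" if "w \<in> snd ` crset n E a b" for w
      using that eq by (auto simp: crset_def)
    ultimately show ?thesis using that ab c by blast
  next
    case False
    hence yy: "y = y'" using M e xy by blast
    have "q = y" if "(p, q) \<in> crset n E a b" for p q
      using M[OF that, of x y] M[OF that, of x' y'] e xy False yy by auto
    hence eq: "crset n E a b = (\<lambda>p. (p, y)) ` (fst ` crset n E a b)" by force
    have 1: "card (fst ` crset n E a b) = k" using c(1) eq
      by (metis (mono_tags, lifting) card_image inj_on_def prod.inject)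
    have 2: "b < y" "y < a + n" using e xy by (auto simp: crset_def)
    have 3: "card ((\<lambda>x. x + n) ` (fst ` crset n E a b)) = k" using 1 by (simp add: card_image)
    have 4: "a + n < w \<and> w < b + n \<and> E y w" if w: "w \<in> (\<lambda>x. x + n) ` (fst ` crset n E a b)" for w
    proof -
      obtain p where p: "w = p + n" "p \<in> fst ` crset n E a b" using w by auto
      hence "(p, y) \<in> crset n E a b" using eq by blast
      thus ?thesis using p flip_E by (auto simp: crset_def)
    qed
    show ?thesis using that[of b y "a + n" "(\<lambda>x. x + n) ` (fst ` crset n E a b)"]
      swap_edge[OF ab] 2 3 4 c crset_swap[of b a] by auto
  qed
qed

lemma pop_min:
  assumes "card W = Suc k"
  obtains w where "w \<in> W" "\<And>u. u \<in> W - {w} \<Longrightarrow> (w::int) < u" "card (W - {w}) = k"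
proof -
  have f: "finite W" "W \<noteq> {}" using assms by (auto intro: card_ge_0_finite)
  have "Min W \<in> W" using f by simp
  moreover have "Min W < u" if "u \<in> W - {Min W}" for u using f that by (metis DiffE Min_le insertI1 order_le_imp_less_or_eq)
  moreover have "card (W - {Min W}) = k" using assms f by (simp add: card_Diff_singleton)
  ultimately show ?thesis using that[of "Min W"] by blast
qed

lemma sorted3:
  assumes "card W = 3"
  obtains w1 w2 w3 :: int where "w1 \<in> W" "w2 \<in> W" "w3 \<in> W" "w1 < w2" "w2 < w3"
proof -
  obtain w1 where 1: "w1 \<in> W" "\<And>u. u \<in> W - {w1} \<Longrightarrow> w1 < u" "card (W - {w1}) = 2"
    using pop_min[of W 2] assms by auto
  obtain w2 where 2: "w2 \<in> W - {w1}" "\<And>u. u \<in> W - {w1} - {w2} \<Longrightarrow> w2 < u" "card (W - {w1} - {w2}) = 1"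
    using pop_min[of "W - {w1}" 1] 1 by auto
  obtain w3 where 3: "w3 \<in> W - {w1} - {w2}" using 2(3) by (metis card.empty ex_in_conv zero_neq_one)
  show ?thesis using that[of w1 w2 w3] 1 2 3 by auto
qed

lemma sorted4:
  assumes "card W = 4"
  obtains w1 w2 w3 w4 :: int where "w1 \<in> W" "w2 \<in> W" "w3 \<in> W" "w4 \<in> W" "w1 < w2" "w2 < w3" "w3 < w4"
proof -
  obtain w1 where 1: "w1 \<in> W" "\<And>u. u \<in> W - {w1} \<Longrightarrow> w1 < u" "card (W - {w1}) = 3"
    using pop_min[of W 3] assms by auto
  obtain w2 w3 w4 where 2: "w2 \<in> W - {w1}" "w3 \<in> W - {w1}" "w4 \<in> W - {w1}" "w2 < w3" "w3 < w4"
    using sorted3[OF 1(3)] by metis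
  show ?thesis using that[of w1 w2 w3 w4] 1 2 by auto
qed

end

locale cycg = cyc +
  fixes l :: nat and g :: "nat \<Rightarrow> nat"
  assumes cr: "\<And>u v. u < v \<Longrightarrow> v < u + n \<Longrightarrow> E u v \<Longrightarrow> card (crset n E u v) \<le> l"
    and IH: "\<And>L R. L < R \<Longrightarrow> R - L + 1 < n \<Longrightarrow> wt E L R \<le> g (nat (R - L - 1))"
    and add: "\<And>x y. g x + g y \<le> g (x + y)"
begin

lemma cut_share1:
  assumes o: "a < x" "x < b" "b < y" "y < y'" "y' < a + n" "E a b" "E x y" "E x y'"
  shows "tot a b \<le> g (nat (n - 2) - 3) + 3 * l"
proof -
  have "tot a b \<le> (g (nat (x - a - 1)) + g (nat (b - x - 1)) + g (nat (y - b - 1)) + g (nat (y' - y - 1))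
      + g (nat (a + n - y' - 1))) + 3 * l"
    using pent_cut[OF o(1-6)] cr[of a b] cr[of x y] cr[of x y'] o
      IH[of a x] IH[of x b] IH[of b y] IH[of y y'] IH[of y' "a + n"] by simp
  also have "\<dots> \<le> g (nat (x - a - 1) + nat (b - x - 1) + nat (y - b - 1) + nat (y' - y - 1) + nat (a + n - y' - 1)) + 3 * l"
    by (intro add_mono order_refl sum5 add)
  also have "nat (x - a - 1) + nat (b - x - 1) + nat (y - b - 1) + nat (y' - y - 1) + nat (a + n - y' - 1) = nat (n - 2) - 3"
    using o by auto
  finally show ?thesis .
qed

text \<open>Six arcs remain, with four inner vertices fewer than before. They do not depend on the
  order of \<open>y1\<close> and \<open>y2\<close>, but for \<open>y1 < y2\<close> the three edges
  cross mutually and the gain of \<open>hex_cut_crossing\<close> is kept.\<close>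

lemma cut_disj1:
  assumes o: "a < x1" "x1 < x2" "x2 < b" "b < y1" "b < y2" "y1 < a + n" "y2 < a + n" "y1 \<noteq> y2" "E a b" "E x1 y1" "E x2 y2"
  shows "tot a b \<le> g (nat (n - 2) - 4) + 3 * l"
    and "y1 < y2 \<Longrightarrow> tot a b + 2 \<le> g (nat (n - 2) - 4) + 3 * l"
proof -
  define p q where "p = min y1 y2" and "q = max y1 y2"
  have pq: "b < p" "p < q" "q < a + n" using o by (auto simp: p_def q_def)
  have G: "wt E a x1 + wt E x1 x2 + wt E x2 b + wt E b p + wt E p q + wt E q (a + n) \<le> g (nat (n - 2) - 4)"
  proof -
    have "wt E a x1 + wt E x1 x2 + wt E x2 b + wt E b p + wt E p q + wt E q (a + n) \<le>
      g (nat (x1 - a - 1)) + g (nat (x2 - x1 - 1)) + g (nat (b - x2 - 1)) + g (nat (p - b - 1)) + g (nat (q - p - 1))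
        + g (nat (a + n - q - 1))"
      using IH[of a x1] IH[of x1 x2] IH[of x2 b] IH[of b p] IH[of p q] IH[of q "a + n"] o pq by simp
    also have "\<dots> \<le> g (nat (x1 - a - 1) + nat (x2 - x1 - 1) + nat (b - x2 - 1) + nat (p - b - 1) + nat (q - p - 1)
        + nat (a + n - q - 1))"
      by (intro sum6 add)
    also have "nat (x1 - a - 1) + nat (x2 - x1 - 1) + nat (b - x2 - 1) + nat (p - b - 1) + nat (q - p - 1)
        + nat (a + n - q - 1) = nat (n - 2) - 4" using o pq by auto
    finally show ?thesis .
  qed
  have C: "card (crset n E a b) \<le> l" "card (crset n E x1 y1) \<le> l" "card (crset n E x2 y2) \<le> l"
    using cr[of a b] cr[of x1 y1] cr[of x2 y2] o by auto
  show 2: "tot a b + 2 \<le> g (nat (n - 2) - 4) + 3 * l" if "y1 < y2"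
    using hex_cut_crossing[of a x1 x2 b y1 y2] that o G C by (simp add: p_def q_def)
  show "tot a b \<le> g (nat (n - 2) - 4) + 3 * l"
  proof (cases "y1 < y2")
    case False
    thus ?thesis using hex_cut[of a x1 x2 b y2 y1] o G C by (simp add: p_def q_def)
  qed (use 2 in simp)
qed

lemma cut_disj:
  assumes ab: "a < b" "b < a + n" "E a b" and e: "(x, y) \<in> crset n E a b" "(x', y') \<in> crset n E a b" "x \<noteq> x'" "y \<noteq> y'"
  shows "tot a b \<le> g (nat (n - 2) - 4) + 3 * l"
proof (cases "x < x'")
  case True
  thus ?thesis using cut_disj1(1)[of a x x' b y y'] e ab by (auto simp: crset_def)
next
  case False
  thus ?thesis using cut_disj1(1)[of a x' x b y' y] e ab by (auto simp: crset_def)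
qed

lemma cut_share:
  assumes ab: "a < b" "b < a + n" "E a b" and e: "(x, y) \<in> crset n E a b" "(x', y') \<in> crset n E a b" "(x, y) \<noteq> (x', y')"
    "x = x' \<or> y = y'"
  shows "\<exists>a b. a < b \<and> b < a + n \<and> E a b \<and> tot a b \<le> g (nat (n - 2) - 3) + 3 * l"
proof -
  have *: "tot a b \<le> g (nat (n - 2) - 3) + 3 * l"
    if "a < b" "b < a + n" "E a b" "(x, y) \<in> crset n E a b" "(x, y') \<in> crset n E a b" "y \<noteq> y'" for a b x y y'
  proof (cases "y < y'")
    case True
    thus ?thesis using cut_share1[of a x b y y'] that by (auto simp: crset_def)
  next
    case False
    thus ?thesis using cut_share1[of a x b y' y] that by (auto simp: crset_def)
  qed
  show ?thesis
  proof (cases "x = x'")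
    case True
    thus ?thesis using *[of a b x y y'] ab e by auto
  next
    case False
    thus ?thesis using *[of b "a + n" y "x + n" "x' + n"] swap_edge[OF ab] e crset_flip by (metis add_right_cancel)
  qed
qed

end

lemma g2_step3: "3 \<le> s \<Longrightarrow> g2 (s - 3) + 6 = g2 s"
proof -
  assume "3 \<le> s"
  then obtain t where t: "s = t + 3" using le_Suc_ex by (metis add.commute)
  show ?thesis using g2_alt[of t] g2_alt[of s] by (simp add: t)
qed

lemma g2_step4: "4 \<le> s \<Longrightarrow> g2 (s - 4) + 6 \<le> g2 s"
  using g2_alt[of "s - 4"] g2_alt[of s] by (auto split: if_splits)

lemma g3_step: "4 \<le> s \<Longrightarrow> g3 (s - 4) + 9 = g3 s"
proof -
  assume "4 \<le> s"
  then obtain t where t: "s = t + 4" using le_Suc_ex by (metis add.commute)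
  show ?thesis using g3_alt[of t] g3_alt[of s] by (simp add: t)
qed

lemma g1_le_g2: "g1 s \<le> g2 s"
proof -
  have "s mod 3 \<noteq> 0 \<Longrightarrow> s = 1 \<or> 2 \<le> s" by (cases s) auto
  thus ?thesis using g2_alt[of s] by (auto simp: g1_def g2_def)
qed

lemma g2_le_g3: "g2 s \<le> g3 s"
proof (cases "s div 4 = 0")
  case True
  hence "s = 0 \<or> s = 1 \<or> s = 2 \<or> s = 3" by auto
  thus ?thesis by (elim disjE) (simp_all add: g2_def g3_def)
next
  case False
  thus ?thesis using g2_alt[of s] g3_alt[of s] by (simp split: if_splits)
qed

lemma ub2: "ub 2 g2"
  unfolding numeral_2_eq_2
proof (rule ub_Suc[OF _ ub1[unfolded One_nat_def]])
  fix n E a b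
  assume c: "cyc n E" and cr: "\<And>u v. u < v \<Longrightarrow> v < u + n \<Longrightarrow> E u v \<Longrightarrow> card (crset n E u v) \<le> Suc (Suc 0)"
    and IH: "\<And>L R. L < R \<Longrightarrow> R - L + 1 < n \<Longrightarrow> wt E L R \<le> g2 (nat (R - L - 1))"
    and ab: "a < b" "b < a + n" "E a b" "card (crset n E a b) = Suc (Suc 0)"
  interpret cyc n E by fact
  interpret cycg n E 2 g2 by standard (use cr IH g2_add in \<open>auto simp: numeral_2_eq_2\<close>)
  obtain e e' where e: "e \<in> crset n E a b" "e' \<in> crset n E a b" "e \<noteq> e'"
    using obtain_card[of "crset n E a b"] ab(4) by (metis numeral_2_eq_2 order_refl)
  obtain x y x' y' where xy: "e = (x, y)" "e' = (x', y')" by (cases e; cases e')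
  show "\<exists>a b. a < b \<and> b < a + n \<and> E a b \<and> tot a b \<le> g2 (nat (n - 2))"
  proof (cases "x = x' \<or> y = y'")
    case True
    have "3 \<le> nat (n - 2)" using e xy True by (auto simp: crset_def)
    thus ?thesis using cut_share[of a b x y x' y'] ab e xy True g2_step3[of "nat (n - 2)"] by auto
  next
    case False
    have "4 \<le> nat (n - 2)" using e xy False by (auto simp: crset_def)
    thus ?thesis using cut_disj[of a b x y x' y'] ab e xy False g2_step4[of "nat (n - 2)"] by (intro exI[of _ a] exI[of _ b]) auto
  qed
qed (simp add: g2_def, rule g1_le_g2)

text \<open>Two crossing edges that share an endpoint would cost 9 edges for only 3 vertices, too
  much for the slope 9/4. If no disjoint pair exists anywhere, the whole star is used instead: it
  removes 4 vertices for the same 9 edges.\<close>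

lemma ub3: "ub 3 g3"
  unfolding numeral_3_eq_3
proof (rule ub_Suc[OF _ ub2[unfolded numeral_2_eq_2]])
  fix n E a b
  assume c: "cyc n E" and cr: "\<And>u v. u < v \<Longrightarrow> v < u + n \<Longrightarrow> E u v \<Longrightarrow> card (crset n E u v) \<le> Suc (Suc (Suc 0))"
    and IH: "\<And>L R. L < R \<Longrightarrow> R - L + 1 < n \<Longrightarrow> wt E L R \<le> g3 (nat (R - L - 1))"
    and ab: "a < b" "b < a + n" "E a b" "card (crset n E a b) = Suc (Suc (Suc 0))"
  interpret cyc n E by fact
  interpret cycg n E 3 g3 by standard (use cr IH g3_add in \<open>auto simp: numeral_3_eq_3\<close>)
  show "\<exists>a b. a < b \<and> b < a + n \<and> E a b \<and> tot a b \<le> g3 (nat (n - 2))"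
  proof (cases meet_all)
    case True
    from star_shape[OF this ab(1-3), of 3] ab(4) obtain a b v W where
      s: "a < v" "v < b" "b < a + n" "E a b" "card (crset n E a b) = 3" "card W = 3"
      and W: "\<And>w. w \<in> W \<Longrightarrow> b < w \<and> w < a + n \<and> E v w" by (metis Suc_le_mono le_SucI numeral_2_eq_2 numeral_3_eq_3 order_refl)
    obtain w1 w2 w3 where w: "w1 \<in> W" "w2 \<in> W" "w3 \<in> W" "w1 < w2" "w2 < w3" using sorted3[OF s(6)] .
    have o: "a < v" "v < b" "b < w1" "w1 < w2" "w2 < w3" "w3 < a + n" "E a b" using s w W by auto
    have f: "fan a b v w1" "fan a b v w2" "fan a b v w3"
      using meet_all_fan[OF True, of a v b] s w W by auto
    have "card (crset n E v w1) \<le> 3" "card (crset n E v w3) \<le> 3" using cr[of v w1] cr[of v w3] o w W by auto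
    hence "tot a b \<le> wt E a v + wt E v b + wt E b w1 + wt E w1 w2 + wt E w2 w3 + wt E w3 (a + n) + 9"
      using star_cut3[OF o f] s(5) by simp
    also have "\<dots> \<le> (g3 (nat (v - a - 1)) + g3 (nat (b - v - 1)) + g3 (nat (w1 - b - 1)) + g3 (nat (w2 - w1 - 1))
       + g3 (nat (w3 - w2 - 1)) + g3 (nat (a + n - w3 - 1))) + 9"
      using IH[of a v] IH[of v b] IH[of b w1] IH[of w1 w2] IH[of w2 w3] IH[of w3 "a + n"] o by simp
    also have "\<dots> \<le> g3 (nat (v - a - 1) + nat (b - v - 1) + nat (w1 - b - 1) + nat (w2 - w1 - 1)
       + nat (w3 - w2 - 1) + nat (a + n - w3 - 1)) + 9"
      by (intro add_mono order_refl sum6 g3_add)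
    also have "nat (v - a - 1) + nat (b - v - 1) + nat (w1 - b - 1) + nat (w2 - w1 - 1)
       + nat (w3 - w2 - 1) + nat (a + n - w3 - 1) = nat (n - 2) - 4" using o by auto
    also have "g3 (nat (n - 2) - 4) + 9 = g3 (nat (n - 2))" by (rule g3_step) (use o in auto)
    finally have "tot a b \<le> g3 (nat (n - 2))" .
    moreover have "a < b" using o by simp
    ultimately show ?thesis using o s by blast
  next
    case False
    then obtain u v x y x' y' where e: "u < v" "v < u + n" "E u v" "(x, y) \<in> crset n E u v" "(x', y') \<in> crset n E u v"
      "x \<noteq> x'" "y \<noteq> y'" unfolding meet_all_def by blast
    have "4 \<le> nat (n - 2)" using e by (auto simp: crset_def)
    thus ?thesis using cut_disj[OF e] e g3_step[of "nat (n - 2)"] by (intro exI[of _ u] exI[of _ v]) auto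
  qed
qed (simp add: g3_def, rule g2_le_g3)

section \<open>Slack of arcs\<close>

text \<open>The inductive situation of \<open>no3_bound\<close>: \<open>arcs\<close> is the
  induction hypothesis for the polygons cut off by chords, the chord itself being counted
  separately, and \<open>conn\<close> leaves aside uncrossed chords, along which the polygon splits
  without loss.\<close>

locale kf = cyc +
  assumes cr: "\<And>u v. u < v \<Longrightarrow> v < u + n \<Longrightarrow> E u v \<Longrightarrow> card (crset n E u v) \<le> 4"
    and arcs: "\<And>L R. L + 2 \<le> R \<Longrightarrow> R - L + 1 < n \<Longrightarrow>
      2 * int (wt E L R) \<le> 5 * (R - L - 1) - 4 + of_bool (R - L - 1 = 5) + 2 * of_bool (E L R)"
    and conn: "\<And>L R. L + 2 \<le> R \<Longrightarrow> R + 2 \<le> L + n \<Longrightarrow> crset n E L R \<noteq> {}"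
begin

text \<open>The slack against 5/2 edges per inner vertex, doubled so as to stay integral.\<close>

definition gam :: "int \<Rightarrow> int \<Rightarrow> int" where
  "gam L R = 5 * (R - L - 1) - 2 * int (wt E L R)"

lemma gam_split:
  assumes "L < z" "z < R"
  shows "gam L R = 5 - 2 * int (card (overset E L z R)) + gam L z + gam z R"
  using wt_split[of L z R E] assms by (simp add: gam_def)

lemma gam_0: "gam L (L + 1) = 0" "R = L + 1 \<Longrightarrow> gam L R = 0"
  by (simp_all add: gam_def wt_0)

text \<open>For an odd number of inner vertices this improves a slack of 2 to 3 at no cost.\<close>

lemma gam_parity: "even (gam L R) \<longleftrightarrow> even (R - L - 1)"
  by (simp add: gam_def)

text \<open>
  The edges crossing \<open>xy\<close> that do not lie inside the arc from \<open>L\<close> to \<open>R\<close>; such an inner edge \<open>ab\<close> occurs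
  as the lift \<open>(b, a + n)\<close>, whence the shape of the excluded condition.
\<close>

definition outset :: "int \<Rightarrow> int \<Rightarrow> int \<Rightarrow> int \<Rightarrow> (int \<times> int) set" where
  "outset L R x y = {(p, q) \<in> crset n E x y. \<not> (p \<le> R \<and> L + n \<le> q)}"

lemma finite_outset: "finite (outset L R x y)"
  by (rule finite_subset[OF _ finite_crset]) (auto simp: outset_def)

text \<open>The four crossings allowed on an entering edge are shared: each edge outside the arc
  that crosses it leaves one edge less to be destroyed by cutting the arc at its foot
  \<open>x\<close>.\<close>

lemma over_out:
  assumes "(x, y) \<in> crset n E L R"
  shows "card (overset E L x R) + card (outset L R x y) \<le> 4"
proof -
  have o: "L < x" "x < R" "R < y" "y < L + n" "E x y" using assms by (auto simp: crset_def)
  have "flip (overset E L x R) \<union> outset L R x y \<subseteq> crset n E x y"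
    using flip_over_cr[of L L x R R y] o by (auto simp: outset_def)
  hence "card (flip (overset E L x R) \<union> outset L R x y) \<le> card (crset n E x y)"
    by (rule card_mono[OF finite_crset])
  moreover have "flip (overset E L x R) \<inter> outset L R x y = {}"
    by (auto simp: flip_def overset_def outset_def)
  moreover have "finite (flip (overset E L x R))" by (simp add: flip_def finite_overset)
  ultimately have "card (overset E L x R) + card (outset L R x y) \<le> card (crset n E x y)"
    by (simp add: card_Un_disjoint finite_outset card_flip)
  also have "\<dots> \<le> 4" by (rule cr) (use o in auto)
  finally show ?thesis .
qed

text \<open>Then a cut at the foot of any entering edge destroys at most 3 edges. The arcs left by
  the cutting edges have this property, and it passes to subarcs ending at such a foot.\<close>

definition good :: "int \<Rightarrow> int \<Rightarrow> bool" where
  "good L R \<longleftrightarrow> (\<forall>x y. (x, y) \<in> crset n E L R \<longrightarrow> outset L R x y \<noteq> {})"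

lemma good_over:
  assumes "good L R" "(x, y) \<in> crset n E L R"
  shows "card (overset E L x R) \<le> 3"
proof -
  have "card (outset L R x y) \<noteq> 0" using assms finite_outset by (auto simp: good_def)
  thus ?thesis using over_out[OF assms(2)] by linarith
qed

lemma outset_mono_right: "L \<le> z \<Longrightarrow> outset L R x y \<subseteq> outset z R x y"
  by (auto simp: outset_def)

lemma outset_mono_left: "z \<le> R \<Longrightarrow> outset L R x y \<subseteq> outset L z x y"
  by (auto simp: outset_def)

text \<open>An edge entering the right part either enters the whole arc, or comes from the left part
  and then crosses \<open>zw\<close>, which lies in neither part.\<close>

lemma good_right:
  assumes g: "good L R" and z: "(z, w) \<in> crset n E L R"
  shows "good z R"
  unfolding good_def
proof (intro allI impI)
  have zo: "L < z" "z < R" "R < w" "w < L + n" "E z w" using z by (auto simp: crset_def)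
  fix x y assume "(x, y) \<in> crset n E z R"
  hence o: "z < x" "x < R" "R < y" "y < z + n" "E x y" by (auto simp: crset_def)
  show "outset z R x y \<noteq> {}"
  proof (cases "y < L + n")
    case True
    hence "(x, y) \<in> crset n E L R" using o zo by (auto simp: crset_def)
    hence "outset L R x y \<noteq> {}" using g by (auto simp: good_def)
    thus ?thesis using outset_mono_right[of L z R x y] zo by auto
  next
    case False
    hence "(w, z + n) \<in> outset z R x y" using o zo flip_E[OF zo(5)] by (auto simp: outset_def crset_def)
    thus ?thesis by blast
  qed
qed

lemma good_left:
  assumes g: "good L R" and z: "(z, w) \<in> crset n E L R"
  shows "good L z"
  unfolding good_def
proof (intro allI impI)
  have zo: "L < z" "z < R" "R < w" "w < L + n" "E z w" using z by (auto simp: crset_def)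
  fix x y assume "(x, y) \<in> crset n E L z"
  hence o: "L < x" "x < z" "z < y" "y < L + n" "E x y" by (auto simp: crset_def)
  show "outset L z x y \<noteq> {}"
  proof (cases "R < y")
    case True
    hence "(x, y) \<in> crset n E L R" using o zo by (auto simp: crset_def)
    hence "outset L R x y \<noteq> {}" using g by (auto simp: good_def)
    thus ?thesis using outset_mono_left[of z R L x y] zo by auto
  next
    case False
    hence "(z, w) \<in> outset L z x y" using o zo by (auto simp: outset_def crset_def)
    thus ?thesis by blast
  qed
qed

lemma gam_raw:
  assumes "L + 2 \<le> R" "R - L + 1 < n"
  shows "4 - of_bool (R - L - 1 = 5) - 2 * of_bool (E L R) \<le> gam L R"
  using arcs[OF assms] by (simp add: gam_def)

lemma over_start:
  "overset E L (L + 1) R = (\<lambda>r. (L, r)) ` {r. L + 1 < r \<and> r \<le> R \<and> E L r}"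
  by (auto simp: overset_def)

lemma over_end:
  "overset E L (R - 1) R = (\<lambda>p. (p, R)) ` {p. L \<le> p \<and> p < R - 1 \<and> E p R}"
proof -
  have "b = R" if "R - 1 < b" "b \<le> R" for b using that by simp
  thus ?thesis by (fastforce simp: overset_def)
qed

lemma over3_start:
  assumes "3 \<le> card (overset E L (L + 1) R)"
  obtains r1 r2 where "L + 1 < r1" "r1 < r2" "r2 < R" "E L r1" "E L r2"
proof -
  let ?S = "{r. L + 1 < r \<and> r \<le> R \<and> E L r}"
  have "3 \<le> card ?S" using assms unfolding over_start by (simp add: card_image inj_on_def)
  then obtain T where T: "T \<subseteq> ?S" "card T = 3" "finite T" by (rule obtain_subset_with_card_n)
  obtain a b c where abc: "a \<in> T" "b \<in> T" "c \<in> T" "a < b" "b < c" using sorted3[OF T(2)] .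
  hence "a \<in> ?S" "b \<in> ?S" "c \<in> ?S" using T(1) by blast+
  thus ?thesis using abc(4,5) by (intro that[of a b]) simp_all
qed

lemma over3_end:
  assumes "3 \<le> card (overset E L (R - 1) R)"
  obtains p1 p2 where "L < p1" "p1 < p2" "p2 < R - 1" "E p1 R" "E p2 R"
proof -
  let ?S = "{p. L \<le> p \<and> p < R - 1 \<and> E p R}"
  have "3 \<le> card ?S" using assms unfolding over_end by (simp add: card_image inj_on_def)
  then obtain T where T: "T \<subseteq> ?S" "card T = 3" "finite T" by (rule obtain_subset_with_card_n)
  obtain a b c where abc: "a \<in> T" "b \<in> T" "c \<in> T" "a < b" "b < c" using sorted3[OF T(2)] .
  hence "a \<in> ?S" "b \<in> ?S" "c \<in> ?S" using T(1) by blast+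
  thus ?thesis using abc(4,5) by (intro that[of b c]) simp_all
qed

definition two_ent :: "int \<Rightarrow> int \<Rightarrow> bool" where
  "two_ent L R \<longleftrightarrow> (\<exists>x y x' y'. (x, y) \<in> crset n E L R \<and> (x', y') \<in> crset n E L R \<and> x < x')"

text \<open>The invariant for the induction over subarcs that \<open>gam_main\<close> carries out.\<close>

definition gb :: "int \<Rightarrow> int \<Rightarrow> bool" where
  "gb L R \<longleftrightarrow> 0 \<le> gam L R \<and> (L + 2 \<le> R \<longrightarrow> 2 \<le> gam L R) \<and> (odd (R - L - 1) \<longrightarrow> 3 \<le> gam L R) \<and>
     (even (R - L - 1) \<longrightarrow> two_ent L R \<longrightarrow> 4 \<le> gam L R)"

lemma gbD:
  assumes "gb L R"
  shows "0 \<le> gam L R" "L + 2 \<le> R \<Longrightarrow> 2 \<le> gam L R" "odd (R - L - 1) \<Longrightarrow> 3 \<le> gam L R"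
    "even (R - L - 1) \<Longrightarrow> two_ent L R \<Longrightarrow> 4 \<le> gam L R"
  using assms unfolding gb_def by blast+

text \<open>Removing the vertex \<open>z\<close> from an even number of inner vertices leaves an odd
  number, so one of the two parts is odd and has slack 3 by itself.\<close>

lemma gb_split_even:
  assumes l: "gb L z" and r: "gb z R" and o: "L < z" "z < R" and ev: "even (R - L - 1)"
  shows "3 \<le> gam L z + gam z R" "z \<noteq> L + 1 \<Longrightarrow> z \<noteq> R - 1 \<Longrightarrow> 5 \<le> gam L z + gam z R"
proof -
  have o2: "odd (z - L - 1) \<or> odd (R - z - 1)" using ev by presburger
  show "3 \<le> gam L z + gam z R" using o2 gbD(1,3)[OF l] gbD(1,3)[OF r] by linarith
  assume "z \<noteq> L + 1" "z \<noteq> R - 1"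
  hence "L + 2 \<le> z" "z + 2 \<le> R" using o by simp_all
  thus "5 \<le> gam L z + gam z R" using o2 gbD(2,3)[OF l] gbD(2,3)[OF r] by linarith
qed

lemma gb_1: "R = L + 1 \<Longrightarrow> gb L R"
proof -
  assume R: "R = L + 1"
  have "\<not> two_ent L (L + 1)" by (simp add: two_ent_def crset_def)
  thus ?thesis using R gam_0(1)[of L] by (simp add: gb_def)
qed

text \<open>The hypothesis \<open>arcs\<close> falls short in two situations: for five inner
  vertices, and for an even number when the chord \<open>LR\<close> is present and two feet are
  available. There the arc is cut at the foot of an entering edge. At most 3 edges are lost, so the
  cut itself contributes at least 5 - 6 = -1, and the two parts must make up for it.\<close>

lemma gam_main:
  assumes "L < R" "R - L + 1 < n" "good L R"
  shows "gb L R"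
  using assms
proof (induction "nat (R - L)" arbitrary: L R rule: less_induct)
  case less
  note LR' = less.prems(1,2) and good = less.prems(3)
  show ?case
  proof (cases "R = L + 1")
    case True thus ?thesis by (rule gb_1)
  next
  case ne: False
  have LR: "L + 2 \<le> R" "R - L + 1 < n" using LR' ne by simp_all
  have sub: "gb L' R'" if "good L' R'" "L \<le> L'" "R' \<le> R" "L' < R'" "L < L' \<or> R' < R" for L' R'
  proof (rule less.hyps)
    show "nat (R' - L') < nat (R - L)" using that by linarith
  qed (use that LR in linarith)+
  have odd3: "3 \<le> gam L R" if "odd (R - L - 1)" "2 \<le> gam L R"
  proof -
    have "gam L R \<noteq> 2" using gam_parity[of L R] that(1) by (metis even_numeral)
    thus ?thesis using that(2) by simp
  qed
  have ents: "gb L z" "gb z R" "L < z" "z < R" if z: "(z, w) \<in> crset n E L R" for z w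
  proof -
    show zo: "L < z" "z < R" using z by (simp_all add: crset_def)
    show "gb L z" by (rule sub[OF good_left[OF good z]]) (use zo in linarith)+
    show "gb z R" by (rule sub[OF good_right[OF good z]]) (use zo in linarith)+
  qed
  have A: "2 \<le> gam L R"
  proof (cases "R - L - 1 = 5")
    case False
    thus ?thesis using gam_raw[OF LR] by (cases "E L R") auto
  next
    case t5: True
    obtain z w where z: "(z, w) \<in> crset n E L R" using conn[of L R] LR by auto
    have zo: "L < z" "z < R" "R < w" "w < L + n" using z by (auto simp: crset_def)
    have c3: "card (overset E L z R) \<le> 3" by (rule good_over[OF good z])
    have eq: "gam L R = 5 - 2 * int (card (overset E L z R)) + gam L z + gam z R" by (rule gam_split[OF zo(1,2)])
    note gl = ents(1)[OF z] and gr = ents(2)[OF z]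
    show ?thesis
    proof (cases "card (overset E L z R) \<le> 2")
      case True
      have "L + 2 \<le> z \<or> z + 2 \<le> R" using t5 by linarith
      hence "2 \<le> gam L z + gam z R" using gbD(1,2)[OF gl] gbD(1,2)[OF gr] by linarith
      thus ?thesis using eq True by simp
    next
      case False
      hence c: "card (overset E L z R) = 3" using c3 by simp
      consider "z = L + 1" | "z = R - 1" | "z \<noteq> L + 1" "z \<noteq> R - 1" by blast
      thus ?thesis
      proof cases
        case 1
        obtain r1 r2 where rr: "L + 1 < r1" "r1 < r2" "r2 < R" "E L r1" "E L r2"
          by (rule over3_start[of L R]) (use c 1 in simp)
        \<comment> \<open>The edges over \<open>L + 1\<close> all start at \<open>L\<close>; seen
          from the rest of the arc they enter it at two vertices. The rest has four inner vertices,
          so its slack is 4.\<close>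
        have "(r1, L + n) \<in> crset n E z R" "(r2, L + n) \<in> crset n E z R"
          using rr 1 LR flip_E by (auto simp: crset_def)
        hence "two_ent z R" using rr by (auto simp: two_ent_def)
        moreover have "even (R - z - 1)" "z + 2 \<le> R" using 1 t5 by presburger+
        ultimately have "4 \<le> gam z R" using gbD(4)[OF gr] by blast
        thus ?thesis using eq c 1 gam_0(2)[of z L] by simp
      next
        case 2
        obtain p1 p2 where pp: "L < p1" "p1 < p2" "p2 < R - 1" "E p1 R" "E p2 R"
          by (rule over3_end[of L R]) (use c 2 in simp)
        have "(p1, R) \<in> crset n E L z" "(p2, R) \<in> crset n E L z"
          using pp 2 LR by (auto simp: crset_def)
        hence "two_ent L z" using pp by (auto simp: two_ent_def)
        moreover have "even (z - L - 1)" "L + 2 \<le> z" using 2 t5 by presburger+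
        ultimately have "4 \<le> gam L z" using gbD(4)[OF gl] by blast
        thus ?thesis using eq c 2 gam_0(2)[of R z] by simp
      next
        case 3
        hence "L + 2 \<le> z" "z + 2 \<le> R" using zo by simp_all
        thus ?thesis using eq c gbD(2)[OF gl] gbD(2)[OF gr] by simp
      qed
    qed
  qed
  have B: "4 \<le> gam L R" if ev: "even (R - L - 1)" and two: "two_ent L R"
  proof (cases "E L R")
    case False
    moreover have "R - L - 1 \<noteq> 5" using ev by presburger
    ultimately show ?thesis using gam_raw[OF LR] by simp
  next
    case True
    obtain z1 w1 z2 w2 where z: "(z1, w1) \<in> crset n E L R" "(z2, w2) \<in> crset n E L R" "z1 < z2"
      using two unfolding two_ent_def by blast
    have o: "L < z1" "z2 < R" "R < w1" "w1 < L + n" "R < w2" "w2 < L + n" "E z1 w1" "E z2 w2"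
      using z by (auto simp: crset_def)
    have c1: "card (overset E L z1 R) \<le> 3" and c2: "card (overset E L z2 R) \<le> 3"
      using good_over[OF good] z by auto
    have e1: "gam L R = 5 - 2 * int (card (overset E L z1 R)) + gam L z1 + gam z1 R"
      by (rule gam_split) (use z o in auto)
    have e2: "gam L R = 5 - 2 * int (card (overset E L z2 R)) + gam L z2 + gam z2 R"
      by (rule gam_split) (use z o in auto)
    note p1 = gb_split_even[OF ents[OF z(1)] ev] and p2 = gb_split_even[OF ents[OF z(2)] ev]
    show ?thesis
    proof (cases "card (overset E L z1 R) \<le> 2 \<or> card (overset E L z2 R) \<le> 2 \<or> z1 \<noteq> L + 1 \<or> z2 \<noteq> R - 1")
      case True
      have s1: "3 \<le> gam L z1 + gam z1 R" "z1 \<noteq> L + 1 \<Longrightarrow> 5 \<le> gam L z1 + gam z1 R" using p1 z(3) o(1,2) by linarith+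
      have s2: "3 \<le> gam L z2 + gam z2 R" "z2 \<noteq> R - 1 \<Longrightarrow> 5 \<le> gam L z2 + gam z2 R" using p2 z(3) o(1,2) by linarith+
      from True show ?thesis
      proof (elim disjE)
        assume "card (overset E L z1 R) \<le> 2" thus ?thesis using e1 s1(1) by linarith
      next
        assume "card (overset E L z2 R) \<le> 2" thus ?thesis using e2 s2(1) by linarith
      next
        assume "z1 \<noteq> L + 1" thus ?thesis using e1 s1(2) c1 by linarith
      next
        assume "z2 \<noteq> R - 1" thus ?thesis using e2 s2(2) c2 by linarith
      qed
    next
      case False
      hence d: "card (overset E L z1 R) = 3" "card (overset E L z2 R) = 3" "z1 = L + 1" "z2 = R - 1"
        using c1 c2 by auto
      obtain r1 r2 where rr: "L + 1 < r1" "r1 < r2" "r2 < R" "E L r1" "E L r2"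
        by (rule over3_start[of L R]) (use d in simp)
      obtain p1 p2 where pp: "L < p1" "p1 < p2" "p2 < R - 1" "E p1 R" "E p2 R"
        by (rule over3_end[of L R]) (use d in simp)
      have g1: "good z1 R" by (rule good_right[OF good z(1)])
      have z2': "(z2, w2) \<in> crset n E z1 R" using z o by (auto simp: crset_def)
      have gm: "good z1 z2" by (rule good_left[OF g1 z2'])
      \<comment> \<open>The chord \<open>LR\<close> is destroyed by the first cut and cannot be lost
        again, so the two cuts together lose at most 3 + 2 edges. They contribute at least (5 - 6) +
        (5 - 4) = 0, and the claim passes to the inner arc.\<close>
      have "overset E z1 z2 R \<subseteq> overset E L z2 R - {(L, R)}" using o by (auto simp: overset_def)
      hence "card (overset E z1 z2 R) \<le> card (overset E L z2 R - {(L, R)})"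
        by (rule card_mono[rotated]) (simp add: finite_overset)
      also have "\<dots> = 2" using d z o True by (subst card_Diff_singleton) (auto simp: overset_def finite_overset)
      finally have c': "card (overset E z1 z2 R) \<le> 2" .
      have e3: "gam z1 R = 5 - 2 * int (card (overset E z1 z2 R)) + gam z1 z2 + gam z2 R"
        by (rule gam_split) (use z o in auto)
      have "gam L z1 = 0" "gam z2 R = 0" using d by (simp_all add: gam_0)
      hence le: "gam z1 z2 \<le> gam L R" using e1 e3 d c' by simp
      have m: "z1 + 2 \<le> z2" "even (z2 - z1 - 1)" using rr d ev by auto
      have ent1: "(r1, L + n) \<in> crset n E z1 z2" and ent2: "(p2, R) \<in> crset n E z1 z2"
        using rr pp d LR flip_E by (auto simp: crset_def)
      have "4 \<le> gam z1 z2"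
      proof (cases "two_ent z1 z2")
        case True
        have "gb z1 z2" by (rule sub[OF gm]) (use m d in linarith)+
        thus ?thesis using True m(2) gbD(4) by blast
      next
        case False
        \<comment> \<open>With only one foot available, the edges from \<open>L\<close> and from
          \<open>R\<close> end at the same vertex \<open>r1\<close>, and \<open>R\<close> is also
          joined to \<open>z1\<close>. Then two edges at \<open>z1\<close>, one to \<open>w1\<close>
          and one to \<open>R\<close>, cross the edge from \<open>r1\<close> to \<open>L\<close>
          outside the inner arc.\<close>
        hence "\<not> r1 < p2" "\<not> p2 < r1" using ent1 ent2 unfolding two_ent_def by blast+
        hence rp: "r1 = p2" by simp
        have "p1 = z1"
        proof (rule ccontr)
          assume "p1 \<noteq> z1"
          hence "(p1, R) \<in> crset n E z1 z2" using pp d LR by (auto simp: crset_def)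
          thus False using False ent2 pp(2) unfolding two_ent_def by blast
        qed
        hence "{(w1, z1 + n), (R, z1 + n)} \<subseteq> outset z1 z2 r1 (L + n)"
          using rr pp d o flip_E by (auto simp: outset_def crset_def)
        hence "card {(w1, z1 + n), (R, z1 + n)} \<le> card (outset z1 z2 r1 (L + n))"
          by (rule card_mono[OF finite_outset])
        hence "2 \<le> card (outset z1 z2 r1 (L + n))" using o by simp
        hence c2: "card (overset E z1 r1 z2) \<le> 2" using over_out[OF ent1] by simp
        have ro: "z1 < r1" "r1 < z2" using ent1 by (auto simp: crset_def)
        have "gam z1 z2 = 5 - 2 * int (card (overset E z1 r1 z2)) + gam z1 r1 + gam r1 z2"
          by (rule gam_split[OF ro])
        moreover have "3 \<le> gam z1 r1 + gam r1 z2"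
        proof (rule gb_split_even(1)[OF _ _ ro m(2)])
          show "gb z1 r1" by (rule sub[OF good_left[OF gm ent1]]) (use ro d in linarith)+
          show "gb r1 z2" by (rule sub[OF good_right[OF gm ent1]]) (use ro d in linarith)+
        qed
        ultimately show ?thesis using c2 by simp
      qed
      thus ?thesis using le by simp
    qed
  qed
  show ?thesis using A odd3[OF _ A] B unfolding gb_def by simp
  qed
qed

lemma gam_ge:
  assumes "L < R" "R - L + 1 < n" "good L R"
  shows "0 \<le> gam L R" "R \<noteq> L + 1 \<Longrightarrow> 2 \<le> gam L R" "odd (R - L - 1) \<Longrightarrow> 3 \<le> gam L R"
    "even (R - L - 1) \<Longrightarrow> two_ent L R \<Longrightarrow> 4 \<le> gam L R"
  using gbD(1)[OF gam_main[OF assms]] gbD(2)[OF gam_main[OF assms]]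
    gbD(3)[OF gam_main[OF assms]] gbD(4)[OF gam_main[OF assms]] assms(1) by simp_all

text \<open>The cut at \<open>x\<close> destroys at most 4 minus the number of outside crossings,
  and the parts contribute 3 if the number of inner vertices is even, otherwise 2 unless there is a
  single inner vertex. The values are 5 - 4 + 3, 5 - 2 + 3 and 5 - 2 + 2.\<close>

lemma gam_out:
  assumes LR: "L < R" "R - L + 1 < n" and g: "good L R" and e: "(x, y) \<in> crset n E L R"
  shows "2 \<le> card (outset L R x y) \<Longrightarrow> even (R - L - 1) \<Longrightarrow> 4 \<le> gam L R"
    "3 \<le> card (outset L R x y) \<Longrightarrow> even (R - L - 1) \<Longrightarrow> 6 \<le> gam L R"
    "3 \<le> card (outset L R x y) \<Longrightarrow> R - L - 1 \<noteq> 1 \<Longrightarrow> 5 \<le> gam L R"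
proof -
  have o: "L < x" "x < R" using e by (auto simp: crset_def)
  have eq: "gam L R = 5 - 2 * int (card (overset E L x R)) + gam L x + gam x R" by (rule gam_split[OF o])
  have l: "0 \<le> gam L x" "x \<noteq> L + 1 \<Longrightarrow> 2 \<le> gam L x" "odd (x - L - 1) \<Longrightarrow> 3 \<le> gam L x"
    using gam_ge[of L x] good_left[OF g e] o LR by auto
  have r: "0 \<le> gam x R" "x \<noteq> R - 1 \<Longrightarrow> 2 \<le> gam x R" "odd (R - x - 1) \<Longrightarrow> 3 \<le> gam x R"
    using gam_ge[of x R] good_right[OF g e] o LR by auto
  have ev: "even (R - L - 1) \<Longrightarrow> 3 \<le> gam L x + gam x R"
  proof -
    assume "even (R - L - 1)"
    hence "odd (x - L - 1) \<or> odd (R - x - 1)" by presburger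
    thus ?thesis using l(1,3) r(1,3) by linarith
  qed
  show "2 \<le> card (outset L R x y) \<Longrightarrow> even (R - L - 1) \<Longrightarrow> 4 \<le> gam L R"
    using over_out[OF e] ev eq by simp
  show "3 \<le> card (outset L R x y) \<Longrightarrow> even (R - L - 1) \<Longrightarrow> 6 \<le> gam L R"
    using over_out[OF e] ev eq by simp
  assume c: "3 \<le> card (outset L R x y)" and t: "R - L - 1 \<noteq> 1"
  have "x \<noteq> L + 1 \<or> x \<noteq> R - 1" using t by auto
  hence "2 \<le> gam L x + gam x R" using l(1,2) r(1,2) by linarith
  thus "5 \<le> gam L R" using over_out[OF e] eq c by simp
qed

text \<open>In the odd case the cut at the left foot contributes 5 - 4, and the parts contribute 4:
  if both are nonempty each has 2, and if the left one is empty the second foot gives the right one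
  4 by \<open>gam_out\<close>.\<close>

lemma gam_two_out:
  assumes LR: "L < R" "R - L + 1 < n" and g: "good L R"
    and e: "(x, y) \<in> crset n E L R" "(x', y') \<in> crset n E L R" "x \<noteq> x'"
    and c: "2 \<le> card (outset L R x y)" "2 \<le> card (outset L R x' y')"
  shows "4 \<le> gam L R" "odd (R - L - 1) \<Longrightarrow> 5 \<le> gam L R"
proof -
  have *: "5 \<le> gam L R" if odd: "odd (R - L - 1)" and e: "(x, y) \<in> crset n E L R" "(x', y') \<in> crset n E L R" "x < x'"
    and c: "2 \<le> card (outset L R x y)" "2 \<le> card (outset L R x' y')" for x y x' y'
  proof -
    have o: "L < x" "x < x'" "x' < R" "R < y'" "y' < L + n" "E x' y'" using e by (auto simp: crset_def)
    have eq: "gam L R = 5 - 2 * int (card (overset E L x R)) + gam L x + gam x R"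
      by (rule gam_split) (use o in auto)
    have gr: "good x R" and gl: "good L x" using good_left[OF g e(1)] good_right[OF g e(1)] by auto
    have "4 \<le> gam L x + gam x R"
    proof (cases "x = L + 1")
      case True
      have "(x', y') \<in> crset n E x R" using o by (auto simp: crset_def)
      moreover have "card (outset L R x' y') \<le> card (outset x R x' y')"
        by (rule card_mono[OF finite_outset outset_mono_right]) (use o in simp)
      ultimately have "4 \<le> gam x R" using gam_out(1)[of x R x' y'] gr c o LR True odd by auto
      thus ?thesis using True gam_0 by simp
    next
      case False
      thus ?thesis using gam_ge(2)[of L x] gam_ge(2)[of x R] gl gr o LR by auto
    qed
    thus ?thesis using eq over_out[OF e(1)] c by simp
  qed
  show odd: "5 \<le> gam L R" if "odd (R - L - 1)"
    using *[OF that e(1,2)] *[OF that e(2,1)] e(3) c by (cases "x < x'") auto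
  show "4 \<le> gam L R" using odd gam_out(1)[OF LR g e(1)] c by (cases "even (R - L - 1)") auto
qed

end

section \<open>Two disjoint edges crossing an edge\<close>

definition mir :: "(int \<Rightarrow> int \<Rightarrow> bool) \<Rightarrow> int \<Rightarrow> int \<Rightarrow> bool" where
  "mir E u v = E (- u) (- v)"

lemma cyc_mir: "cyc n E \<Longrightarrow> cyc n (mir E)"
proof -
  assume "cyc n E"
  then interpret cyc n E .
  show ?thesis
  proof
    fix u v
    show "3 \<le> n" by (rule n3)
    show "mir E u v \<Longrightarrow> mir E v u" using sym by (simp add: mir_def)
    show "mir E (u + n) v = mir E u v" using per[of "- u - n" "- v"] by (simp add: mir_def)
    show "\<not> mir E u u" using irrefl by (simp add: mir_def)
    show "\<not> mir E u (u + 1)" using no_side[of "- u - 1"] sym[of "- u" "- u - 1"] by (auto simp: mir_def)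
  qed
qed

lemma crset_mir:
  assumes "cyc n E"
  shows "bij_betw (\<lambda>(x, y). (- x, n - y)) (crset n (mir E) u v) (crset n E (- v) (- u))"
proof -
  interpret cyc n E by fact
  have p: "E x (n - y) = E x (- y)" for x y using per2[of x "- y"] by (simp add: algebra_simps)
  show ?thesis
  proof (rule bij_betw_byWitness[where f' = "\<lambda>(x, y). (- x, n - y)"])
    show "(\<lambda>(x, y). (- x, n - y)) ` crset n (mir E) u v \<subseteq> crset n E (- v) (- u)"
      using p by (auto simp: crset_def mir_def)
    show "(\<lambda>(x, y). (- x, n - y)) ` crset n E (- v) (- u) \<subseteq> crset n (mir E) u v"
    proof clarify
      fix x y assume "(x, y) \<in> crset n E (- v) (- u)"
      hence o: "- v < x" "x < - u" "- u < y" "y < - v + n" "E x y" by (auto simp: crset_def)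
      have "E x (y - n)" using per2[of x "y - n"] o(5) by simp
      thus "(- x, n - y) \<in> crset n (mir E) u v" using o by (simp add: crset_def mir_def)
    qed
  qed auto
qed

lemma card_crset_mir: "cyc n E \<Longrightarrow> card (crset n (mir E) u v) = card (crset n E (- v) (- u))"
  by (rule bij_betw_same_card[OF crset_mir])

lemma crset_mirD: "cyc n E \<Longrightarrow> (x, y) \<in> crset n (mir E) u v \<Longrightarrow> (- x, n - y) \<in> crset n E (- v) (- u)"
  using bij_betwE[OF crset_mir] by fastforce

lemma wt_mir:
  assumes "cyc n E"
  shows "wt (mir E) L R = wt E (- R) (- L)"
proof -
  interpret cyc n E by fact
  have "bij_betw (\<lambda>(x, y). (- y, - x)) (arcset (mir E) L R) (arcset E (- R) (- L))"
    by (rule bij_betw_byWitness[where f' = "\<lambda>(x, y). (- y, - x)"]) (auto simp: arcset_def mir_def intro: sym)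
  thus ?thesis by (simp add: wt_def bij_betw_same_card)
qed

lemma kf_mir: "kf n E \<Longrightarrow> kf n (mir E)"
proof -
  assume "kf n E"
  then interpret kf n E .
  have c: "cyc n E" by unfold_locales
  show ?thesis
  proof (rule kf.intro[OF cyc_mir[OF c]], standard)
    fix u v assume "u < v" "v < u + n" "mir E u v"
    thus "card (crset n (mir E) u v) \<le> 4"
      using cr[of "- v" "- u"] sym by (simp add: card_crset_mir[OF c] mir_def)
  next
    fix L R :: int assume "L + 2 \<le> R" "R - L + 1 < n"
    thus "2 * int (wt (mir E) L R) \<le> 5 * (R - L - 1) - 4 + of_bool (R - L - 1 = 5) + 2 * of_bool (mir E L R)"
      using arcs[of "- R" "- L"] sym[of "- R" "- L"] sym[of "- L" "- R"]
      by (cases "E (- L) (- R)"; cases "E (- R) (- L)") (simp_all add: wt_mir[OF c] mir_def algebra_simps)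
  next
    fix L R :: int assume "L + 2 \<le> R" "R + 2 \<le> L + n"
    hence "crset n E (- R) (- L) \<noteq> {}" by (intro conn) simp_all
    thus "crset n (mir E) L R \<noteq> {}" using crset_mir[OF c, of L R] by (auto simp: bij_betw_def)
  qed
qed

lemma no3_mir:
  assumes "no3 n E" "cyc n E"
  shows "no3 n (mir E)"
  unfolding no3_def
proof (intro notI, elim exE conjE)
  interpret cyc n E by fact
  fix p1 p2 p3 q1 q2 q3
  assume o: "p1 < p2" "p2 < p3" "p3 < q1" "q1 < q2" "q2 < q3" "q3 < p1 + n"
    and "mir E p1 q1" "mir E p2 q2" "mir E p3 q3"
  hence "E (- q1) (- p1)" "E (- q2) (- p2)" "E (- q3) (- p3)" using sym by (auto simp: mir_def)
  moreover have "- q3 < - q2" "- q2 < - q1" "- q1 < - p3" "- p3 < - p2" "- p2 < - p1" "- p1 < - q3 + n" using o by auto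
  ultimately show False using assms(1) unfolding no3_def by blast
qed

lemma two_le_card: "finite A \<Longrightarrow> x \<in> A \<Longrightarrow> y \<in> A \<Longrightarrow> x \<noteq> y \<Longrightarrow> 2 \<le> card A"
  using card_mono[of A "{x, y}"] by simp

lemma three_le_card: "finite A \<Longrightarrow> x \<in> A \<Longrightarrow> y \<in> A \<Longrightarrow> z \<in> A \<Longrightarrow> x \<noteq> y \<Longrightarrow> x \<noteq> z \<Longrightarrow> y \<noteq> z \<Longrightarrow> 3 \<le> card A"
  using card_mono[of A "{x, y, z}"] by simp

lemma card_le_1: "A \<subseteq> {x} \<Longrightarrow> card A \<le> 1"
  using card_mono[of "{x}" A] by simp

lemma card_le_2: "A \<subseteq> {x, y} \<Longrightarrow> card A \<le> 2"
  using card_mono[of "{x, y}" A] card_insert_le_m1[of 2 "{y}" x] by simp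

lemma card_le_3: "A \<subseteq> {x, y, z} \<Longrightarrow> card A \<le> 3"
  using card_mono[of "{x, y, z}" A] card_insert_le_m1[of 3 "{y, z}" x] card_insert_le_m1[of 2 "{z}" y] by simp

lemma card_Diff1: "finite A \<Longrightarrow> card A \<le> card (A - {x}) + 1"
  by (cases "x \<in> A") (simp_all add: card_Suc_Diff1)

text \<open>
  The assumptions \<open>mid1\<close> and \<open>mid2\<close> come from choosing the two disjoint crossing edges as close together
  as possible.
\<close>

locale hex = kf +
  fixes a x1 x2 b y2 y1 :: int
  assumes no3: "no3 n E" and n7: "7 \<le> n"
    and ord: "a < x1" "x1 < x2" "x2 < b" "b < y2" "y2 < y1" "y1 < a + n"
    and ed: "E a b" "E x1 y1" "E x2 y2"
    and mid1: "\<And>x y. (x, y) \<in> crset n E a b \<Longrightarrow> x \<le> x1 \<or> x2 \<le> x"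
    and mid2: "\<And>x y. (x, y) \<in> crset n E a b \<Longrightarrow> y \<le> y2 \<or> y1 \<le> y"
begin

lemma E_flip: "E b (a + n)" "E y1 (x1 + n)" "E y2 (x2 + n)"
  using flip_E ed by auto

text \<open>Crossing rungs would form a triple with \<open>ab\<close>. Hence the edges crossing
  \<open>ab\<close> are ordered like the rungs of a ladder.\<close>

lemma rung_order: "(x, y) \<in> crset n E a b \<Longrightarrow> (x', y') \<in> crset n E a b \<Longrightarrow> x < x' \<Longrightarrow> y' \<le> y"
proof (rule ccontr)
  assume e: "(x, y) \<in> crset n E a b" "(x', y') \<in> crset n E a b" "x < x'" "\<not> y' \<le> y"
  hence "a < x" "x < x'" "x' < b" "b < y" "y < y'" "y' < a + n" "E a b" "E x y" "E x' y'"
    using ed(1) by (auto simp: crset_def)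
  thus False using no3 unfolding no3_def by blast
qed

lemma rungs_in: "(x1, y1) \<in> crset n E a b" "(x2, y2) \<in> crset n E a b"
  using ord ed by (auto simp: crset_def)

text \<open>Exchanges the two sides of \<open>ab\<close>. Together with \<open>mirror\<close> it
  carries each of the four arcs next to \<open>a\<close> or \<open>b\<close> to any other of them,
  and exchanges the arcs \<open>x1x2\<close> and \<open>y2y1\<close>; one case from each orbit has
  to be treated.\<close>

lemma rot: "hex n E b y2 y1 (a + n) (x1 + n) (x2 + n)"
proof
  show "no3 n E" "7 \<le> n" by (fact no3 n7)+
  show "b < y2" "y2 < y1" "y1 < a + n" "a + n < x1 + n" "x1 + n < x2 + n" "x2 + n < b + n" using ord by auto
  show "E b (a + n)" "E y2 (x2 + n)" "E y1 (x1 + n)" by (fact E_flip)+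
  fix x y assume "(x, y) \<in> crset n E b (a + n)"
  hence "a < y - n" "y - n < b" "b < x" "x < a + n" "E x y" by (auto simp: crset_def)
  hence "(y - n, x) \<in> crset n E a b" using sym per2[of x "y - n"] by (simp add: crset_def)
  from mid1[OF this] mid2[OF this] show "x \<le> y2 \<or> y1 \<le> x" "y \<le> x1 + n \<or> x2 + n \<le> y" by auto
qed

lemma mirror: "hex n (mir E) (- b) (- x2) (- x1) (- a) (n - y1) (n - y2)"
proof -
  have c: "cyc n E" and k: "kf n E" by unfold_locales
  interpret m: kf n "mir E" by (rule kf_mir[OF k])
  show ?thesis
  proof
    show "no3 n (mir E)" by (rule no3_mir[OF no3 c])
    show "7 \<le> n" by (rule n7)
    show "- b < - x2" "- x2 < - x1" "- x1 < - a" "- a < n - y1" "n - y1 < n - y2" "n - y2 < - b + n" using ord by auto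
    have p: "E x (y - n) = E x y" for x y using per2[of x "y - n"] by simp
    show "mir E (- b) (- a)" "mir E (- x2) (n - y2)" "mir E (- x1) (n - y1)"
      using ed sym p by (auto simp: mir_def)
    fix x y assume "(x, y) \<in> crset n (mir E) (- b) (- a)"
    from crset_mirD[OF c this] have "(- x, n - y) \<in> crset n E a b" by simp
    from mid1[OF this] mid2[OF this] show "x \<le> - x2 \<or> - x1 \<le> x" "y \<le> n - y1 \<or> n - y2 \<le> y" by auto
  qed
qed

text \<open>Twice the bound wanted for the number of edges plus 1, because \<open>tot a b\<close>
  counts \<open>ab\<close> twice.\<close>

definition sparse :: bool where
  "sparse \<longleftrightarrow> 2 * int (tot a b) \<le> 5 * (n - 2) - 2 + of_bool (n = 7)"

lemma sparse_rot: "hex.sparse n E b (a + n) = sparse"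
proof -
  interpret r: hex n E b y2 y1 "a + n" "x1 + n" "x2 + n" by (rule rot)
  have "tot b (a + n) = tot a b" by (simp add: tot_def wt_shift crset_swap)
  thus ?thesis by (simp only: sparse_def r.sparse_def)
qed

lemma sparse_mirror: "hex.sparse n (mir E) (- b) (- a) = sparse"
proof -
  have c: "cyc n E" by unfold_locales
  interpret m: hex n "mir E" "- b" "- x2" "- x1" "- a" "n - y1" "n - y2" by (rule mirror)
  have "wt E (b - n) a = wt E b (a + n)" using wt_shift[of "b - n" a] by simp
  hence "m.tot (- b) (- a) = tot a b" by (simp add: tot_def m.tot_def wt_mir[OF c] card_crset_mir[OF c])
  thus ?thesis by (simp only: sparse_def m.sparse_def)
qed


section \<open>Destroyed edges against slack\<close>

definition k :: nat where "k = card (crset n E a b)"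
definition o1 :: nat where "o1 = card (overset E a x1 b)"
definition o2 :: nat where "o2 = card (overset E x1 x2 b)"
definition o3 :: nat where "o3 = card (overset E b y2 (a + n))"
definition o4 :: nat where "o4 = card (overset E y2 y1 (a + n))"

definition G :: int where
  "G = gam a x1 + gam x1 x2 + gam x2 b + gam b y2 + gam y2 y1 + gam y1 (a + n)"

text \<open>The six arcs have \<open>n - 6\<close> inner vertices; the four lost ones are worth 20,
  of which 2 are reserved. Since \<open>k\<close>, \<open>o1 + o4\<close> and \<open>o2 + o3\<close>
  are at most 4, the left side is at most 24 and a total slack of 6 always suffices.\<close>

lemma sparse_iff: "sparse \<longleftrightarrow> 2 * int (k + o1 + o2 + o3 + o4) \<le> 18 + G + of_bool (n = 7)"
proof -
  have "2 * int (tot a b) = 5 * (n - 6) - G + 2 * int (k + o1 + o2 + o3 + o4)"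
    using wt_split[of a x1 b E] wt_split[of x1 x2 b E] wt_split[of b y2 "a + n" E] wt_split[of y2 y1 "a + n" E] ord
    by (simp add: tot_def G_def gam_def k_def o1_def o2_def o3_def o4_def)
  thus ?thesis by (auto simp: sparse_def)
qed

lemma k_le: "k \<le> 4"
  unfolding k_def by (rule cr) (use ord ed in auto)

lemma cover1: "flip (overset E a x1 b) \<union> overset E y2 y1 (a + n) \<subseteq> crset n E x1 y1"
  using flip_over_cr[of a a x1 b b y1] over_cr_bot[of x1 y2 y1 "a + n"] ord by auto

lemma cover1_card: "card (flip (overset E a x1 b) \<union> overset E y2 y1 (a + n)) = o1 + o4"
proof -
  have "card (flip (overset E a x1 b) \<union> overset E y2 y1 (a + n)) =
      card (flip (overset E a x1 b)) + card (overset E y2 y1 (a + n))"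
    by (rule card_Un_disjoint) (use ord in \<open>auto simp: flip_def finite_overset, auto simp: overset_def\<close>)
  thus ?thesis by (simp add: card_flip o1_def o4_def)
qed

lemma cover2: "flip (overset E x1 x2 b) \<union> overset E b y2 (a + n) \<subseteq> crset n E x2 y2"
  using flip_over_cr[of x1 x1 x2 b b y2] over_cr_bot[of x2 b y2 "a + n"] ord by auto

lemma cover2_card: "card (flip (overset E x1 x2 b) \<union> overset E b y2 (a + n)) = o2 + o3"
proof -
  have "card (flip (overset E x1 x2 b) \<union> overset E b y2 (a + n)) =
      card (flip (overset E x1 x2 b)) + card (overset E b y2 (a + n))"
    by (rule card_Un_disjoint) (use ord in \<open>auto simp: flip_def finite_overset, auto simp: overset_def\<close>)
  thus ?thesis by (simp add: card_flip o2_def o3_def)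
qed

lemma o14: "o1 + o4 \<le> 4"
  using card_mono[OF finite_crset cover1] cr[of x1 y1] ord ed cover1_card by simp

lemma o23: "o2 + o3 \<le> 4"
  using card_mono[OF finite_crset cover2] cr[of x2 y2] ord ed cover2_card by simp

text \<open>If the destroyed edges exhaust the four crossings of \<open>x2y2\<close>, no further
  edge crosses it. An edge from before \<open>x1\<close> to beyond \<open>x2\<close> would be a
  further one, unless it is \<open>ab\<close>, already charged on the other side.\<close>

lemma top_split:
  assumes "o2 + o3 = 4" "a \<le> u" "u < x1" "x2 < v" "v \<le> b" "E u v"
  shows "u = a" "v = b"
proof -
  have "flip (overset E x1 x2 b) \<union> overset E b y2 (a + n) = crset n E x2 y2"
    by (rule card_seteq[OF finite_crset cover2]) (use cr[of x2 y2] ord ed cover2_card assms(1) in simp)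
  moreover have "(v, u + n) \<in> crset n E x2 y2" using assms ord flip_E by (auto simp: crset_def)
  ultimately have "(v, u + n) \<in> flip (overset E x1 x2 b) \<union> overset E b y2 (a + n)" by simp
  thus "u = a" "v = b" using assms by (auto simp: flip_def overset_def)
qed

lemma bot_split:
  assumes "o1 + o4 = 4" "b \<le> u" "u < y2" "y1 < v" "v \<le> a + n" "E u v"
  shows "u = b" "v = a + n"
proof -
  have "flip (overset E a x1 b) \<union> overset E y2 y1 (a + n) = crset n E x1 y1"
    by (rule card_seteq[OF finite_crset cover1]) (use cr[of x1 y1] ord ed cover1_card assms(1) in simp)
  moreover have "(u, v) \<in> crset n E x1 y1" using assms ord by (auto simp: crset_def)
  ultimately have "(u, v) \<in> flip (overset E a x1 b) \<union> overset E y2 y1 (a + n)" by simp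
  thus "u = b" "v = a + n" using assms by (auto simp: flip_def overset_def)
qed

lemma good012: "good a x1" "good x1 x2" "good x2 b"
proof -
  show "good a x1" unfolding good_def
  proof (intro allI impI)
    fix x y assume "(x, y) \<in> crset n E a x1"
    hence o: "a < x" "x < x1" "x1 < y" "y < a + n" by (auto simp: crset_def)
    show "outset a x1 x y \<noteq> {}"
    proof (cases "y < y1")
      case True
      hence "(x1, y1) \<in> outset a x1 x y" using o ord ed by (simp add: outset_def crset_def)
      thus ?thesis by blast
    next
      case False
      hence "(b, a + n) \<in> outset a x1 x y" using o ord E_flip by (simp add: outset_def crset_def)
      thus ?thesis by blast
    qed
  qed
  show "good x1 x2" unfolding good_def
  proof (intro allI impI)
    fix x y assume "(x, y) \<in> crset n E x1 x2"
    hence o: "x1 < x" "x < x2" "x2 < y" "y < x1 + n" by (auto simp: crset_def)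
    consider "y < y2" | "y2 \<le> y" "y < a + n" | "a + n \<le> y" by linarith
    thus "outset x1 x2 x y \<noteq> {}"
    proof cases
      case 1
      hence "(x2, y2) \<in> outset x1 x2 x y" using o ord ed by (simp add: outset_def crset_def)
      thus ?thesis by blast
    next
      case 2
      hence "(b, a + n) \<in> outset x1 x2 x y" using o ord E_flip by (simp add: outset_def crset_def)
      thus ?thesis by blast
    next
      case 3
      hence "(y1, x1 + n) \<in> outset x1 x2 x y" using o ord E_flip by (simp add: outset_def crset_def)
      thus ?thesis by blast
    qed
  qed
  show "good x2 b" unfolding good_def
  proof (intro allI impI)
    fix x y assume "(x, y) \<in> crset n E x2 b"
    hence o: "x2 < x" "x < b" "b < y" "y < x2 + n" by (auto simp: crset_def)
    show "outset x2 b x y \<noteq> {}"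
    proof (cases "y < a + n")
      case True
      hence "(b, a + n) \<in> outset x2 b x y" using o ord E_flip by (simp add: outset_def crset_def)
      thus ?thesis by blast
    next
      case False
      hence "(y2, x2 + n) \<in> outset x2 b x y" using o ord E_flip by (simp add: outset_def crset_def)
      thus ?thesis by blast
    qed
  qed
qed

lemma good345: "good b y2" "good y2 y1" "good y1 (a + n)"
  by (rule hex.good012[OF rot])+

lemma short: "x1 - a + 1 < n" "x2 - x1 + 1 < n" "b - x2 + 1 < n" "y2 - b + 1 < n" "y1 - y2 + 1 < n" "a + n - y1 + 1 < n"
  using ord by auto

lemmas gap0 = gam_ge[OF ord(1) short(1) good012(1)]
lemmas gap1 = gam_ge[OF ord(2) short(2) good012(2)]
lemmas gap2 = gam_ge[OF ord(3) short(3) good012(3)]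
lemmas gap3 = gam_ge[OF ord(4) short(4) good345(1)]
lemmas gap4 = gam_ge[OF ord(5) short(5) good345(2)]
lemmas gap5 = gam_ge[OF ord(6) short(6) good345(3)]

text \<open>The ladder order and the minimality assumptions leave rungs beyond \<open>x1y1\<close>,
  rungs beyond \<open>x2y2\<close>, and edges joining the four endpoints. The last kind includes the
  two diagonals \<open>x1y2\<close> and \<open>x2y1\<close>.\<close>

lemma rung_cases:
  assumes "(x, y) \<in> crset n E a b"
  shows "x < x1 \<and> y1 \<le> y \<or> x = x1 \<and> y1 < y \<or> x2 < x \<and> y \<le> y2 \<or> x = x2 \<and> y < y2 \<or>
    (x, y) \<in> {(x1, y1), (x2, y2), (x1, y2), (x2, y1)}"
proof -
  have "x < x1 \<longrightarrow> y1 \<le> y" "x2 < x \<longrightarrow> y \<le> y2" "x1 < x \<longrightarrow> y \<le> y1" "x < x2 \<longrightarrow> y2 \<le> y"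
    using rung_order[OF assms rungs_in(1)] rung_order[OF rungs_in(2) assms]
      rung_order[OF rungs_in(1) assms] rung_order[OF assms rungs_in(2)] by blast+
  hence "x < x1 \<and> y1 \<le> y \<or> x = x1 \<and> y1 < y \<or> x2 < x \<and> y \<le> y2 \<or> x = x2 \<and> y < y2 \<or>
    (x = x1 \<or> x = x2) \<and> (y = y1 \<or> y = y2)"
    using mid1[OF assms] mid2[OF assms] ord by linarith
  thus ?thesis by blast
qed

lemma mids: "\<not> ((x1, y2) \<in> crset n E a b \<and> (x2, y1) \<in> crset n E a b)"
  using rung_order[of x1 y2 x2 y1] ord by auto

text \<open>By \<open>mids\<close> at most three rungs join the four endpoints, so a fourth one lies
  outside the quadrilateral.\<close>

lemma k4_side:
  assumes "k = 4"
  shows "\<exists>x y. (x, y) \<in> crset n E a b \<and> (x < x1 \<or> y1 < y \<or> x2 < x \<or> y < y2)"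
proof (rule ccontr)
  assume no: "\<not> ?thesis"
  have "p \<in> {(x1, y1), (x2, y2), (x1, y2), (x2, y1)}" if p: "p \<in> crset n E a b" for p
  proof -
    obtain x y where xy: "p = (x, y)" by (cases p)
    have "\<not> (x < x1 \<or> y1 < y \<or> x2 < x \<or> y < y2)" using no p xy by blast
    thus ?thesis using rung_cases[of x y] p xy by blast
  qed
  hence "crset n E a b \<subseteq> {(x1, y1), (x2, y2), (x1, y2)} \<or> crset n E a b \<subseteq> {(x1, y1), (x2, y2), (x2, y1)}"
    using mids by blast
  hence "card (crset n E a b) \<le> 3" using card_le_3 by metis
  thus False using assms by (simp add: k_def)
qed

lemma k4_mid:
  assumes "k = 4" and "\<And>x y. (x, y) \<in> crset n E a b \<Longrightarrow> x < x1 \<or> y1 < y \<or> x2 < x \<or> y < y2 \<Longrightarrow> (x, y) = r"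
  shows "(x1, y2) \<in> crset n E a b \<or> (x2, y1) \<in> crset n E a b"
proof (rule ccontr)
  assume no: "\<not> ?thesis"
  have "p \<in> {(x1, y1), (x2, y2), r}" if p: "p \<in> crset n E a b" for p
  proof -
    obtain x y where xy: "p = (x, y)" by (cases p)
    thus ?thesis using rung_cases[of x y] assms(2)[of x y] no p by blast
  qed
  hence "card (crset n E a b) \<le> 3" by (intro card_le_3[of _ "(x1, y1)" "(x2, y2)" r] subsetI)
  thus False using assms by (simp add: k_def)
qed

end

lemma subset_card_ne: "A \<subseteq> {x} \<Longrightarrow> 1 \<le> card A \<Longrightarrow> x \<in> A"
  by (metis card.empty not_one_le_zero subset_singletonD insertI1)

section \<open>A single nonempty arc\<close>

context hex
begin

lemma no3D:
  assumes "p1 < p2" "p2 < p3" "p3 < q1" "q1 < q2" "q2 < q3" "q3 < p1 + n" "E p1 q1" "E p2 q2" "E p3 q3"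
  shows False
  using no3 assms unfolding no3_def by blast

lemma not_sparse:
  assumes "\<not> sparse" "k + o1 + o2 + o3 + o4 \<le> m"
  shows "G < 2 * int m - 18" "n = 7 \<Longrightarrow> G < 2 * int m - 19"
proof -
  define N where "N = k + o1 + o2 + o3 + o4"
  have 1: "18 + G + of_bool (n = 7) < 2 * int N" using assms(1)[unfolded sparse_iff not_le] by (simp only: N_def)
  have 2: "int N \<le> int m" using assms(2) by (simp only: N_def of_nat_le_iff)
  have "0 \<le> (of_bool (n = 7) :: int)" by simp
  thus "G < 2 * int m - 18" using 1 2 by linarith
  assume "n = 7"
  hence "of_bool (n = 7) = (1::int)" by simp
  thus "G < 2 * int m - 19" using 1 2 by linarith
qed

text \<open>With five empty arcs few edges can be destroyed, so a failure exhausts every estimate at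
  slack at most 3. It produces an edge from a vertex inside the remaining arc to \<open>x2\<close>
  or \<open>b\<close> and a rung from a vertex inside it. These are crossed by so many edges outside
  the arc that its slack would have to be larger.\<close>

lemma corner:
  assumes e: "x2 = x1 + 1" "b = x2 + 1" "y2 = b + 1" "y1 = y2 + 1" "a + n = y1 + 1"
  shows sparse
proof (rule ccontr)
  assume not: "\<not> sparse"
  have G: "G = gam a x1" unfolding G_def using e by (simp add: gam_0(2))
  have s2: "overset E x1 x2 b \<subseteq> {(x1, b)}" using e by (auto simp: overset_def)
  have s3: "overset E b y2 (a + n) \<subseteq> {(b, y1), (b, a + n)}" using e by (auto simp: overset_def)
  have s4: "overset E y2 y1 (a + n) \<subseteq> {(y2, a + n)}" using e by (auto simp: overset_def)
  have os: "o2 \<le> 1" "o3 \<le> 2" "o4 \<le> 1"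
    using card_le_1[OF s2] card_le_2[OF s3] card_le_1[OF s4] by (simp_all add: o2_def o3_def o4_def)
  have ne: "x1 \<noteq> a + 1" using e n7 by simp
  \<comment> \<open>The total is at most 4 + 4 + 1 + 2. A total of 10 would need slack below 2; for
    \<open>n = 7\<close> the single inner vertex has slack 3, which suffices there.\<close>
  have big: "k + o1 + o2 + o3 + o4 = 11 \<and> gam a x1 \<le> 3 \<and> n \<noteq> 7"
  proof (cases "n = 7")
    case True
    hence "x1 - a - 1 = 1" using e by linarith
    hence "odd (x1 - a - 1)" by simp
    hence "3 \<le> G" using gap0(3) G by simp
    moreover have "k + o1 + o2 + o3 + o4 \<le> 11" using k_le o14 os by linarith
    ultimately show ?thesis using not_sparse(2)[OF not _ True] by fastforce
  next
    case False
    have "\<not> k + o1 + o2 + o3 + o4 \<le> 10" using not_sparse(1)[OF not, of 10] G gap0(2)[OF ne] by auto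
    moreover have le: "k + o1 + o2 + o3 + o4 \<le> 11" using k_le o14 os by linarith
    moreover have "gam a x1 \<le> 3" using not_sparse(1)[OF not le] G by simp
    ultimately show ?thesis using False by linarith
  qed
  hence k4: "k = 4" and o14': "o1 + o4 = 4" and o2: "o2 = 1" and g3: "gam a x1 \<le> 3" and n8: "8 \<le> n"
    using k_le o14 os n7 by linarith+
  have t1: "x1 - a - 1 \<noteq> 1" using e n8 by simp
  have E1: "E x1 b" using subset_card_ne[OF s2] o2 unfolding o2_def overset_def by simp
  have entx: "(z, x2) \<in> crset n E a x1 \<and> 2 \<le> card (outset a x1 z x2)" if z: "a < z" "z < x1" "E z x2" for z
  proof
    show "(z, x2) \<in> crset n E a x1" using z ord by (simp add: crset_def)
    show "2 \<le> card (outset a x1 z x2)"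
      by (rule two_le_card[OF finite_outset, of "(x1, y1)" _ _ _ _ "(x1, b)"])
        (use z ord ed E1 in \<open>simp_all add: outset_def crset_def\<close>)
  qed
  have entb: "(z, b) \<in> crset n E a x1 \<and> 2 \<le> card (outset a x1 z b)" if z: "a < z" "z < x1" "E z b" for z
  proof
    show "(z, b) \<in> crset n E a x1" using z ord by (simp add: crset_def)
    show "2 \<le> card (outset a x1 z b)"
      by (rule two_le_card[OF finite_outset, of "(x1, y1)" _ _ _ _ "(x2, y2)"])
        (use z ord ed in \<open>simp_all add: outset_def crset_def\<close>)
  qed
  have side: "a < x \<and> x < x1 \<and> y = y1 \<and> (x, y1) \<in> crset n E a x1 \<and> E x y1"
    if "(x, y) \<in> crset n E a b" "x < x1 \<or> y1 < y \<or> x2 < x \<or> y < y2" for x y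
  proof -
    have o: "a < x" "x < b" "b < y" "y < a + n" "E x y" using that(1) by (auto simp: crset_def)
    have "x < x1" using that(2) o e by linarith
    moreover have "y = y1" using rung_cases[OF that(1)] calculation o e ord by auto
    ultimately show ?thesis using o ord by (simp add: crset_def)
  qed
  obtain zr where zr: "a < zr" "zr < x1" "(zr, y1) \<in> crset n E a x1" "E zr y1"
    using k4_side[OF k4] side by blast
  \<comment> \<open>Otherwise only \<open>ax2\<close> and \<open>ab\<close> can lie over
    \<open>x1\<close>, and \<open>o1 + o4\<close> is at most 3.\<close>
  have "\<exists>z. a < z \<and> z < x1 \<and> (E z x2 \<or> E z b)"
  proof (rule ccontr)
    assume "\<not> ?thesis"
    hence no: "\<not> E z x2" "\<not> E z b" if "a < z" "z < x1" for z using that by blast+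
    have "overset E a x1 b \<subseteq> {(a, x2), (a, b)}"
    proof
      fix p assume "p \<in> overset E a x1 b"
      then obtain u v where p: "p = (u, v)" "a \<le> u" "u < x1" "x1 < v" "v \<le> b" "E u v" by (auto simp: overset_def)
      hence "v = x2 \<or> v = b" using e by linarith
      thus "p \<in> {(a, x2), (a, b)}" using p no[of u] by (cases "u = a") auto
    qed
    thus False using card_le_2 o14' os(3) unfolding o1_def by fastforce
  qed
  then obtain z where z: "a < z" "z < x1" "E z x2 \<or> E z b" by blast
  obtain v where v: "(z, v) \<in> crset n E a x1" "2 \<le> card (outset a x1 z v)" using entx[of z] entb[of z] z by blast
  \<comment> \<open>From here on slack 3 admits only one foot with two outside crossings, and no
    entering edge with three.\<close>
  have odd: "odd (x1 - a - 1)"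
    using gam_out(1)[OF ord(1) short(1) good012(1) v] g3 by linarith
  have uniq: "z' = z" if "(z', v') \<in> crset n E a x1" "2 \<le> card (outset a x1 z' v')" for z' v'
    using gam_two_out(2)[OF ord(1) short(1) good012(1) that(1) v(1) _ that(2) v(2) odd] g3 by linarith
  have no3out: "\<not> 3 \<le> card (outset a x1 x y)" if "(x, y) \<in> crset n E a x1" for x y
    using gam_out(3)[OF ord(1) short(1) good012(1) that] t1 g3 by linarith
  have tops: "p \<in> {(a, x2), (a, b), (z, x2), (z, b)}" if "p \<in> overset E a x1 b" for p
  proof -
    obtain u v where p: "p = (u, v)" "a \<le> u" "u < x1" "x1 < v" "v \<le> b" "E u v" using \<open>p \<in> _\<close> by (auto simp: overset_def)
    hence v: "v = x2 \<or> v = b" using e by linarith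
    hence "u = a \<or> u = z" using uniq[of u] entx[of u] entb[of u] p by (cases "u = a") auto
    thus ?thesis using v p(1) by blast
  qed
  show False
  proof (cases "E z b")
    case True
    \<comment> \<open>The edges \<open>ax2\<close>, \<open>zb\<close> and \<open>x1y1\<close> would
      cross mutually.\<close>
    hence "\<not> E a x2" using no3D[of a z x1 x2 b y1] z ord ed by auto
    hence "overset E a x1 b \<subseteq> {(a, b), (z, x2), (z, b)}" using tops by (auto simp: overset_def)
    hence "o1 \<le> 3" unfolding o1_def by (rule card_le_3)
    hence "o4 \<ge> 1" using o14' by simp
    hence E4: "E y2 (a + n)" using subset_card_ne[OF s4] unfolding o4_def overset_def by simp
    have two: "2 \<le> card (outset a x1 x y1)" if "a < x" "x < x1" for x
      by (rule two_le_card[OF finite_outset, of "(b, a + n)" _ _ _ _ "(y2, a + n)"])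
        (use that ord E_flip E4 in \<open>simp_all add: outset_def crset_def\<close>)
    have "(x, y) = (z, y1)" if "(x, y) \<in> crset n E a b" "x < x1 \<or> y1 < y \<or> x2 < x \<or> y < y2" for x y
      using side[OF that] uniq[of x y1] two[of x] by blast
    from k4_mid[OF k4 this] have m: "(x1, y2) \<in> crset n E a b \<or> (x2, y1) \<in> crset n E a b" by blast
    have "3 \<le> card (outset a x1 z b)"
    proof (cases "(x1, y2) \<in> crset n E a b")
      case True
      hence "E x1 y2" by (simp add: crset_def)
      thus ?thesis
        by (intro three_le_card[OF finite_outset, of "(x1, y1)" _ _ _ _ "(x2, y2)" "(x1, y2)"])
          (use z ord ed in \<open>simp_all add: outset_def crset_def\<close>)
    next
      case False
      hence "E x2 y1" using m unfolding crset_def by blast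
      thus ?thesis
        by (intro three_le_card[OF finite_outset, of "(x1, y1)" _ _ _ _ "(x2, y2)" "(x2, y1)"])
          (use z ord ed in \<open>simp_all add: outset_def crset_def\<close>)
    qed
    thus False using no3out entb[of z] z True by blast
  next
    case False
    hence sub: "overset E a x1 b \<subseteq> {(a, b), (a, x2), (z, x2)}" using tops by (auto simp: overset_def)
    hence "o1 \<le> 3" unfolding o1_def by (rule card_le_3)
    hence o: "o4 \<ge> 1" "o1 = 3" using o14' os by auto
    have E4: "E y2 (a + n)" using o(1) subset_card_ne[OF s4] unfolding o4_def overset_def by simp
    have Ea: "E a x2"
    proof (rule ccontr)
      assume "\<not> E a x2"
      hence "overset E a x1 b \<subseteq> {(a, b), (z, x2)}" using sub by (auto simp: overset_def)
      thus False using card_le_2 o(2) unfolding o1_def by fastforce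
    qed
    have "3 \<le> card (outset a x1 zr y1)"
      by (rule three_le_card[OF finite_outset, of "(b, a + n)" _ _ _ _ "(y2, a + n)" "(x2, a + n)"])
        (use zr ord E_flip E4 flip_E[OF Ea] in \<open>simp_all add: outset_def crset_def\<close>)
    thus False using no3out zr(3) by blast
  qed
qed

text \<open>At most one of the diagonals \<open>x1y2\<close> and \<open>x2y1\<close> is an edge, and
  reflection exchanges them, so excluding \<open>x2y1\<close> is no restriction. Failure makes
  \<open>x1y2\<close> an edge; an edge \<open>ap\<close> into the arc then has the outside crossings
  \<open>x1y1\<close> and \<open>x1y2\<close>. Slack 3 admits one such foot only, which forces
  \<open>ax2\<close> and finally \<open>x1b\<close> to be edges, and \<open>x1b\<close> is a third
  outside crossing of \<open>ap\<close>.\<close>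

lemma mid_aux:
  assumes e: "x1 = a + 1" "b = x2 + 1" "y2 = b + 1" "y1 = y2 + 1" "a + n = y1 + 1"
    and nm: "(x2, y1) \<notin> crset n E a b"
  shows sparse
proof (rule ccontr)
  assume not: "\<not> sparse"
  have G: "G = gam x1 x2" unfolding G_def using e by (simp add: gam_0(2))
  have s3: "overset E b y2 (a + n) \<subseteq> {(b, y1), (b, a + n)}" using e by (auto simp: overset_def)
  have s4: "overset E y2 y1 (a + n) \<subseteq> {(y2, a + n)}" using e by (auto simp: overset_def)
  have rs: "p \<in> {(x1, y1), (x2, y2), (x1, y2)}" if p: "p \<in> crset n E a b" for p
  proof -
    obtain x y where xy: "p = (x, y)" by (cases p)
    have o: "a < x" "x < b" "b < y" "y < a + n" using p xy by (auto simp: crset_def)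
    have "\<not> (x < x1 \<or> y1 < y \<or> x2 < x \<or> y < y2)" using o e by linarith
    thus ?thesis using rung_cases[of x y] p xy nm by blast
  qed
  hence k3: "k \<le> 3" unfolding k_def by (intro card_le_3 subsetI)
  have os: "o3 \<le> 2" "o4 \<le> 1"
    using card_le_2[OF s3] card_le_1[OF s4] by (simp_all add: o3_def o4_def)
  have ne: "x2 \<noteq> x1 + 1" using e n7 by simp
  have big: "k + o1 + o2 + o3 + o4 = 11 \<and> gam x1 x2 \<le> 3 \<and> n \<noteq> 7"
  proof (cases "n = 7")
    case True
    hence "x2 - x1 - 1 = 1" using e by linarith
    hence "odd (x2 - x1 - 1)" by simp
    hence "3 \<le> G" using gap1(3) G by simp
    moreover have "k + o1 + o2 + o3 + o4 \<le> 11" using k3 o14 o23 by linarith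
    ultimately show ?thesis using not_sparse(2)[OF not _ True] by fastforce
  next
    case False
    have "\<not> k + o1 + o2 + o3 + o4 \<le> 10" using not_sparse(1)[OF not, of 10] G gap1(2)[OF ne] by auto
    moreover have le: "k + o1 + o2 + o3 + o4 \<le> 11" using k3 o14 o23 by linarith
    moreover have "gam x1 x2 \<le> 3" using not_sparse(1)[OF not le] G by simp
    ultimately show ?thesis using False by linarith
  qed
  hence k3': "k = 3" and o1: "3 \<le> o1" and o2: "2 \<le> o2" and g3: "gam x1 x2 \<le> 3" and n8: "8 \<le> n"
    using k3 o14 o23 os n7 by linarith+
  have t1: "x2 - x1 - 1 \<noteq> 1" using e n8 by simp
  have "E x1 y2"
  proof (rule ccontr)
    assume "\<not> E x1 y2"
    hence "p \<in> {(x1, y1), (x2, y2)}" if "p \<in> crset n E a b" for p using rs[OF that] that by (auto simp: crset_def)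
    hence "k \<le> 2" unfolding k_def by (intro card_le_2 subsetI)
    thus False using k3' by simp
  qed
  hence F1: "E y2 (x1 + n)" by (rule flip_E)
  have entp: "(p, a + n) \<in> crset n E x1 x2 \<and> 2 \<le> card (outset x1 x2 p (a + n))" if p: "x1 < p" "p < x2" "E a p" for p
  proof
    show "(p, a + n) \<in> crset n E x1 x2" using p ord flip_E[OF p(3)] by (simp add: crset_def)
    show "2 \<le> card (outset x1 x2 p (a + n))"
      by (rule two_le_card[OF finite_outset, of "(y1, x1 + n)" _ _ _ _ "(y2, x1 + n)"])
        (use p ord E_flip F1 in \<open>simp_all add: outset_def crset_def\<close>)
  qed
  \<comment> \<open>Edges over \<open>x1\<close> start at \<open>a\<close>, and there are at least
    three of them. With \<open>r = (a, b)\<close> this yields a first foot \<open>p\<close>; with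
    \<open>r = (a, p)\<close>, when \<open>ax2\<close> is missing, a second foot different from
    it.\<close>
  have ex_p: "\<exists>p. x1 < p \<and> p < x2 \<and> E a p \<and> (a, p) \<noteq> r" if r: "r = (a, b) \<or> r \<noteq> (a, b) \<and> \<not> E a x2" for r
  proof (rule ccontr)
    assume no: "\<not> ?thesis"
    have "overset E a x1 b \<subseteq> {(a, b), (if E a x2 then (a, x2) else r)}"
    proof
      fix p assume "p \<in> overset E a x1 b"
      then obtain u v where p: "p = (u, v)" "a \<le> u" "u < x1" "x1 < v" "v \<le> b" "E u v" by (auto simp: overset_def)
      hence ua: "u = a" using e by linarith
      have "v = b \<or> v = x2 \<or> v < x2" using p e by linarith
      thus "p \<in> {(a, b), (if E a x2 then (a, x2) else r)}" using no p ua r by auto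
    qed
    hence "o1 \<le> 2" unfolding o1_def by (rule card_le_2)
    thus False using o1 by simp
  qed
  obtain p where p: "x1 < p" "p < x2" "E a p" using ex_p[of "(a, b)"] by blast
  note ep = entp[OF p, THEN conjunct1] and op = entp[OF p, THEN conjunct2]
  have odd: "odd (x2 - x1 - 1)"
    using gam_out(1)[OF ord(2) short(2) good012(2) ep op] g3 by linarith
  have uniq: "z' = p" if "(z', v') \<in> crset n E x1 x2" "2 \<le> card (outset x1 x2 z' v')" for z' v'
    using gam_two_out(2)[OF ord(2) short(2) good012(2) that(1) ep _ that(2) op odd] g3 by linarith
  have no3out: "\<not> 3 \<le> card (outset x1 x2 x y)" if "(x, y) \<in> crset n E x1 x2" for x y
    using gam_out(3)[OF ord(2) short(2) good012(2) that] t1 g3 by linarith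
  have Ea: "E a x2"
  proof (rule ccontr)
    assume "\<not> E a x2"
    then obtain p' where "x1 < p'" "p' < x2" "E a p'" "p' \<noteq> p" using ex_p[of "(a, p)"] p e by auto
    thus False using uniq entp by blast
  qed
  have entq: "(q, b) \<in> crset n E x1 x2 \<and> 2 \<le> card (outset x1 x2 q b)" if q: "x1 < q" "q < x2" "E q b" for q
  proof
    show "(q, b) \<in> crset n E x1 x2" using q ord by (simp add: crset_def)
    show "2 \<le> card (outset x1 x2 q b)"
      by (rule two_le_card[OF finite_outset, of "(x2, y2)" _ _ _ _ "(x2, a + n)"])
        (use q ord ed flip_E[OF Ea] in \<open>simp_all add: outset_def crset_def\<close>)
  qed
  have "q = p" if "x1 < q" "q < x2" "E q b" for q using uniq entq[OF that] by blast
  hence tops: "overset E x1 x2 b \<subseteq> {(p, b), (x1, b)}"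
  proof (intro subsetI)
    fix r assume *: "\<And>q. x1 < q \<Longrightarrow> q < x2 \<Longrightarrow> E q b \<Longrightarrow> q = p" and "r \<in> overset E x1 x2 b"
    then obtain u v where r: "r = (u, v)" "x1 \<le> u" "u < x2" "x2 < v" "v \<le> b" "E u v" by (auto simp: overset_def)
    have "v = b" using r e by linarith
    thus "r \<in> {(p, b), (x1, b)}" using r *[of u] by (cases "u = x1") auto
  qed
  have "E x1 b"
  proof (rule ccontr)
    assume "\<not> E x1 b"
    hence "overset E x1 x2 b \<subseteq> {(p, b)}" using tops by (auto simp: overset_def)
    thus False using card_le_1 o2 unfolding o2_def by fastforce
  qed
  hence "3 \<le> card (outset x1 x2 p (a + n))"
    by (intro three_le_card[OF finite_outset, of "(y1, x1 + n)" _ _ _ _ "(y2, x1 + n)" "(b, x1 + n)"])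
      (use p ord E_flip F1 flip_E in \<open>simp_all add: outset_def crset_def\<close>)
  thus False using no3out ep by blast
qed

lemma mid:
  assumes e: "x1 = a + 1" "b = x2 + 1" "y2 = b + 1" "y1 = y2 + 1" "a + n = y1 + 1"
  shows sparse
proof (cases "(x2, y1) \<in> crset n E a b")
  case False
  show ?thesis by (rule mid_aux[OF e False])
next
  case True
  have c: "cyc n E" by unfold_locales
  have "(- x1, n - y2) \<notin> crset n (mir E) (- b) (- a)"
    using crset_mirD[OF c, of "- x1" "n - y2" "- b" "- a"] mids True by auto
  hence "hex.sparse n (mir E) (- b) (- a)"
    by (intro hex.mid_aux[OF mirror]) (use e in simp_all)
  thus ?thesis by (simp only: sparse_mirror)
qed

lemma one_gap:
  assumes "x1 = a + 1 \<and> b = x2 + 1 \<and> y2 = b + 1 \<and> y1 = y2 + 1 \<and> a + n = y1 + 1 \<or>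
    x2 = x1 + 1 \<and> b = x2 + 1 \<and> y2 = b + 1 \<and> y1 = y2 + 1 \<and> a + n = y1 + 1 \<or>
    x1 = a + 1 \<and> x2 = x1 + 1 \<and> y2 = b + 1 \<and> y1 = y2 + 1 \<and> a + n = y1 + 1 \<or>
    x1 = a + 1 \<and> x2 = x1 + 1 \<and> b = x2 + 1 \<and> y1 = y2 + 1 \<and> a + n = y1 + 1 \<or>
    x1 = a + 1 \<and> x2 = x1 + 1 \<and> b = x2 + 1 \<and> y2 = b + 1 \<and> a + n = y1 + 1 \<or>
    x1 = a + 1 \<and> x2 = x1 + 1 \<and> b = x2 + 1 \<and> y2 = b + 1 \<and> y1 = y2 + 1"
  shows sparse
  using assms
proof (elim disjE conjE)
  assume e: "x1 = a + 1" "x2 = x1 + 1" "y2 = b + 1" "y1 = y2 + 1" "a + n = y1 + 1"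
  have "hex.sparse n (mir E) (- b) (- a)" by (rule hex.corner[OF mirror]) (use e in simp_all)
  thus ?thesis by (simp only: sparse_mirror)
next
  assume e: "x1 = a + 1" "x2 = x1 + 1" "b = x2 + 1" "y1 = y2 + 1" "a + n = y1 + 1"
  have "hex.sparse n E b (a + n)" by (rule hex.corner[OF rot]) (use e in simp_all)
  thus ?thesis by (simp only: sparse_rot)
next
  assume e: "x1 = a + 1" "x2 = x1 + 1" "b = x2 + 1" "y2 = b + 1" "a + n = y1 + 1"
  have "hex.sparse n E b (a + n)" by (rule hex.mid[OF rot]) (use e in simp_all)
  thus ?thesis by (simp only: sparse_rot)
next
  assume e: "x1 = a + 1" "x2 = x1 + 1" "b = x2 + 1" "y2 = b + 1" "y1 = y2 + 1"
  interpret r: hex n E b y2 y1 "a + n" "x1 + n" "x2 + n" by (rule rot)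
  have "hex.sparse n (mir E) (- (a + n)) (- b)" by (rule hex.corner[OF r.mirror]) (use e in simp_all)
  hence "r.sparse" by (simp only: r.sparse_mirror)
  thus ?thesis by (simp only: sparse_rot)
qed (rule mid corner; assumption)+

end

text \<open>Two nonempty arcs would already have total slack 4. Here \<open>p0\<close> to
  \<open>p5\<close> say that the respective arc is empty.\<close>

lemma six_gaps:
  fixes g0 g1 g2 g3 g4 g5 :: int
  assumes "0 \<le> g0" "p0 \<or> 2 \<le> g0" "0 \<le> g1" "p1 \<or> 2 \<le> g1" "0 \<le> g2" "p2 \<or> 2 \<le> g2"
    "0 \<le> g3" "p3 \<or> 2 \<le> g3" "0 \<le> g4" "p4 \<or> 2 \<le> g4" "0 \<le> g5" "p5 \<or> 2 \<le> g5"
    and "\<not> 4 \<le> g0 + g1 + g2 + g3 + g4 + g5"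
  shows "p0 \<and> p2 \<and> p3 \<and> p4 \<and> p5 \<or> p1 \<and> p2 \<and> p3 \<and> p4 \<and> p5 \<or> p0 \<and> p1 \<and> p3 \<and> p4 \<and> p5 \<or>
    p0 \<and> p1 \<and> p2 \<and> p4 \<and> p5 \<or> p0 \<and> p1 \<and> p2 \<and> p3 \<and> p5 \<or> p0 \<and> p1 \<and> p2 \<and> p3 \<and> p4"
  using assms by (smt (verit))

text \<open>Three nonempty arcs would have total slack 6. So besides the first one exactly one of
  the arcs 1 to 4 is nonempty, and neither of the two exceeds 3.\<close>

lemma five_gaps:
  fixes g0 g1 g2 g3 g4 g5 :: int
  assumes "2 \<le> g0" "0 \<le> g1" "p1 \<or> 2 \<le> g1" "0 \<le> g2" "p2 \<or> 2 \<le> g2"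
    "0 \<le> g3" "p3 \<or> 2 \<le> g3" "0 \<le> g4" "p4 \<or> 2 \<le> g4" "0 \<le> g5" "p5 \<or> 2 \<le> g5"
    and "g0 + g1 + g2 + g3 + g4 + g5 \<le> 5" "\<not> (p1 \<and> p2 \<and> p3 \<and> p4)"
  shows "p5 \<and> g0 \<le> 3 \<and> (p2 \<and> p3 \<and> p4 \<and> g1 \<le> 3 \<and> \<not> p1 \<or> p1 \<and> p3 \<and> p4 \<and> g2 \<le> 3 \<and> \<not> p2 \<or>
    p1 \<and> p2 \<and> p4 \<and> g3 \<le> 3 \<and> \<not> p3 \<or> p1 \<and> p2 \<and> p3 \<and> g4 \<le> 3 \<and> \<not> p4)"
  using assms by (smt (verit))

section \<open>Two nonempty arcs, all crossings used up\<close>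

context hex
begin

text \<open>Deals with slack 2 on the arc from \<open>a\<close> to \<open>x1\<close>: all edges
  entering it have the same foot \<open>z\<close>, with fewer than two outside crossings each. The
  rung \<open>zy1\<close> is already crossed by \<open>ab\<close>, so \<open>a\<close> has no other
  neighbour strictly between \<open>x1\<close> and \<open>y1\<close>; hence the edges over
  \<open>x1\<close> other than \<open>ab\<close> start at \<open>z\<close>. They leave room over
  \<open>x2\<close> only for edges to \<open>b\<close> from vertices inside the arc
  \<open>x1x2\<close>, and two of these, each crossed by \<open>x2y1\<close> and
  \<open>x2y2\<close>, give that arc slack 4.\<close>

lemma alpha:
  assumes N: "k = 4" "o1 + o4 = 4" "o2 + o3 = 4"
    and z: "(z, u) \<in> crset n E a b" "z < x1" and e5: "a + n = y1 + 1"
    and e: "x2 \<noteq> x1 + 1 \<Longrightarrow> b = x2 + 1 \<and> y2 = b + 1 \<and> y1 = y2 + 1"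
    and single: "\<And>x y x' y'. (x, y) \<in> crset n E a x1 \<Longrightarrow> (x', y') \<in> crset n E a x1 \<Longrightarrow> x = x'"
    and out: "\<And>x y. (x, y) \<in> crset n E a x1 \<Longrightarrow> \<not> 2 \<le> card (outset a x1 x y)"
  shows "4 \<le> gam x1 x2"
proof -
  have side0: "x = z' \<and> y = y1" if "(x, y) \<in> crset n E a b" "x < x1" "(z', w) \<in> crset n E a x1" for x y z' w
  proof -
    have o: "a < x" "b < y" "y < a + n" "E x y" using that(1) by (auto simp: crset_def)
    have "y = y1" using rung_cases[OF that(1)] that(2) o e5 ord by auto
    moreover have "(x, y) \<in> crset n E a x1" using o that(2) ord by (simp add: crset_def)
    ultimately show ?thesis using single that(3) by blast
  qed
  have zo: "a < z" "b < u" "u < a + n" "E z u" using z(1) by (auto simp: crset_def)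
  have ez: "(z, u) \<in> crset n E a x1" using zo z(2) ord by (simp add: crset_def)
  have uy: "u = y1" using side0[OF z ez] by simp
  have Ez: "E z y1" and ez1: "(z, y1) \<in> crset n E a x1" using zo ez uy by simp_all
  have noa: "\<not> E v (a + n)" if v: "x1 < v" "v < y1" "v \<noteq> b" for v
  proof
    assume "E v (a + n)"
    hence "2 \<le> card (outset a x1 z y1)"
      by (intro two_le_card[OF finite_outset, of "(b, a + n)" _ _ _ _ "(v, a + n)"])
        (use v zo z(2) ord E_flip in \<open>simp_all add: outset_def crset_def\<close>)
    thus False using out ez1 by blast
  qed
  have "overset E y2 y1 (a + n) = {}"
  proof (rule ccontr)
    assume "overset E y2 y1 (a + n) \<noteq> {}"
    then obtain p q where p: "y2 \<le> p" "p < y1" "y1 < q" "q \<le> a + n" "E p q" by (auto simp: overset_def)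
    hence "q = a + n" using e5 by linarith
    thus False using noa[of p] p ord by auto
  qed
  hence "o1 = 4" using N(2) by (simp add: o4_def)
  hence c3: "2 \<le> card (overset E a x1 b - {(a, b)})"
    using card_Diff1[OF finite_overset, of E a x1 b "(a, b)"] by (simp add: o1_def)
  have tops: "p = z \<and> q \<le> x2 \<and> x1 < q \<and> E z q" if "(p, q) \<in> overset E a x1 b - {(a, b)}" for p q
  proof -
    have o: "a \<le> p" "p < x1" "x1 < q" "q \<le> b" "E p q" "(p, q) \<noteq> (a, b)" using that by (auto simp: overset_def)
    have qx: "q \<le> x2" using top_split[OF N(3) o(1,2) _ o(4,5)] o(6) by fastforce
    have "p \<noteq> a"
    proof
      assume "p = a"
      hence "E q (a + n)" using flip_E o(5) by blast
      thus False using noa[of q] o qx ord by auto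
    qed
    hence "(p, q) \<in> crset n E a x1" using o qx ord by (simp add: crset_def)
    thus ?thesis using single[OF _ ez1] o qx by blast
  qed
  obtain t t' where tt: "t \<in> overset E a x1 b - {(a, b)}" "t' \<in> overset E a x1 b - {(a, b)}" "t \<noteq> t'"
    using obtain_card[OF c3] by blast
  obtain v v' where tv: "t = (z, v)" "t' = (z, v')" using tops tt by (metis prod.collapse)
  \<comment> \<open>Two distinct ends after \<open>x1\<close> and not beyond \<open>x2\<close> make
    the arc \<open>x1x2\<close> nonempty. An edge starting before the larger end and passing over it
    would cross \<open>zw\<close> in addition to \<open>x1y1\<close>.\<close>
  define w where "w = max v v'"
  have w: "x1 < w" "w \<le> x2" "E z w" "x2 \<noteq> x1 + 1"
    using tops[of z v] tops[of z v'] tt tv by (auto simp: w_def max_def)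
  note ee = e[OF w(4)]
  have "overset E b y2 (a + n) \<subseteq> {(b, y1), (b, a + n)}" using ee e5 by (auto simp: overset_def)
  hence "o3 \<le> 2" unfolding o3_def by (rule card_le_2)
  hence c2: "2 \<le> card (overset E x1 x2 b)" using N(3) by (simp add: o2_def)
  have ew: "(z, w) \<in> crset n E a x1" using w zo z(2) ord by (simp add: crset_def)
  have noz: "\<not> (E p q \<and> x1 \<le> p \<and> p < w \<and> w < q \<and> q < a + n \<and> (p, q) \<noteq> (x1, y1))" for p q
  proof
    assume "E p q \<and> x1 \<le> p \<and> p < w \<and> w < q \<and> q < a + n \<and> (p, q) \<noteq> (x1, y1)"
    hence "2 \<le> card (outset a x1 z w)"
      by (intro two_le_card[OF finite_outset, of "(x1, y1)" _ _ _ _ "(p, q)"])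
        (use w zo z(2) ord ed in \<open>auto simp: outset_def crset_def\<close>)
    thus False using out ew by blast
  qed
  have bots: "q = b \<and> w \<le> p \<and> p < x2 \<and> E p b" if "(p, q) \<in> overset E x1 x2 b" for p q
  proof -
    have o: "x1 \<le> p" "p < x2" "x2 < q" "q \<le> b" "E p q" using that by (auto simp: overset_def)
    have "q = b" using o ee by linarith
    moreover have "w \<le> p" using noz[of p q] o w ord by auto
    ultimately show ?thesis using o by simp
  qed
  obtain s s' where ss: "s \<in> overset E x1 x2 b" "s' \<in> overset E x1 x2 b" "s \<noteq> s'"
    using obtain_card[OF c2] by blast
  obtain g g' where sg: "s = (g, b)" "s' = (g', b)" using bots ss by (metis prod.collapse)
  have gg: "g \<noteq> g'" "x1 < g" "g < x2" "E g b" "x1 < g'" "g' < x2" "E g' b"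
    using bots[of g b] bots[of g' b] ss sg w by auto
  have "(x, y) = (z, y1)" if "(x, y) \<in> crset n E a b" "x < x1 \<or> y1 < y \<or> x2 < x \<or> y < y2" for x y
  proof -
    have o: "a < x" "x < b" "b < y" "y < a + n" using that(1) by (auto simp: crset_def)
    have "x < x1" using that(2) o ee e5 by linarith
    thus ?thesis using side0[OF that(1) _ ez1] by simp
  qed
  from k4_mid[OF N(1) this] have "(x1, y2) \<in> crset n E a b \<or> (x2, y1) \<in> crset n E a b" by blast
  moreover have "(x1, y2) \<notin> crset n E a b" using noz[of x1 y2] w ord by (auto simp: crset_def)
  ultimately have Em: "E x2 y1" unfolding crset_def by blast
  have ent: "(p, b) \<in> crset n E x1 x2 \<and> 2 \<le> card (outset x1 x2 p b)" if p: "x1 < p" "p < x2" "E p b" for p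
  proof
    show "(p, b) \<in> crset n E x1 x2" using p ord by (simp add: crset_def)
    show "2 \<le> card (outset x1 x2 p b)"
      by (rule two_le_card[OF finite_outset, of "(x2, y1)" _ _ _ _ "(x2, y2)"])
        (use p ord ed Em in \<open>simp_all add: outset_def crset_def\<close>)
  qed
  show ?thesis
    using gam_two_out(1)[OF ord(2) short(2) good012(2), of g b g' b] ent[of g] ent[of g'] gg by blast
qed

text \<open>The edges over \<open>y2\<close> start at \<open>b\<close>, and \<open>bot_split\<close>
  lets only \<open>ab\<close> pass beyond \<open>y1\<close>.\<close>

lemma o3_le_2:
  assumes "o1 + o4 = 4" "y2 = b + 1" "y1 = y2 + 1"
  shows "o3 \<le> 2"
proof -
  have "overset E b y2 (a + n) \<subseteq> {(b, y1), (b, a + n)}"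
  proof
    fix p assume "p \<in> overset E b y2 (a + n)"
    then obtain u v where p: "p = (u, v)" "b \<le> u" "u < y2" "y2 < v" "v \<le> a + n" "E u v" by (auto simp: overset_def)
    have u: "u = b" using p assms by linarith
    show "p \<in> {(b, y1), (b, a + n)}"
    proof (cases "y1 < v")
      case True
      thus ?thesis using bot_split[OF assms(1), of u v] p u by simp
    next
      case False
      hence "v = y1" using p assms by linarith
      thus ?thesis using p u by simp
    qed
  qed
  thus ?thesis unfolding o3_def by (rule card_le_2)
qed

lemma no4:
  assumes "o1 + o4 = 4" "o2 + o3 = 4" "x2 = x1 + 1" "b = x2 + 1" "y2 = b + 1" "y1 = y2 + 1"
  shows False
proof -
  have "overset E x1 x2 b \<subseteq> {(x1, b)}" using assms by (auto simp: overset_def)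
  hence "o2 \<le> 1" unfolding o2_def by (rule card_le_1)
  thus False using o3_le_2[OF assms(1,5,6)] assms(2) by simp
qed

text \<open>With \<open>o4 = 0\<close> four edges lie over \<open>x1\<close>. By
  \<open>top_split\<close> all except \<open>ab\<close> end at \<open>x2\<close>, so two of them
  start strictly between \<open>a\<close> and \<open>x1\<close>; both are crossed by
  \<open>x1y1\<close> and \<open>x1b\<close>.\<close>

lemma tops_two:
  assumes N: "o1 + o4 = 4" "o2 + o3 = 4" and e: "x2 = x1 + 1" and E1: "E x1 b" and o4: "o4 = 0"
    and two: "\<And>x y x' y'. (x, y) \<in> crset n E a x1 \<Longrightarrow> (x', y') \<in> crset n E a x1 \<Longrightarrow> x \<noteq> x' \<Longrightarrow>
      2 \<le> card (outset a x1 x y) \<Longrightarrow> 2 \<le> card (outset a x1 x' y') \<Longrightarrow> False"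
  shows False
proof -
  let ?S = "overset E a x1 b - {(a, b)} - {(a, x2)}"
  have "2 \<le> card ?S"
    using card_Diff1[OF finite_overset, of E a x1 b "(a, b)"]
      card_Diff1[of "overset E a x1 b - {(a, b)}" "(a, x2)"] N(1) o4 by (simp add: o1_def finite_overset)
  then obtain t t' where tt: "t \<in> ?S" "t' \<in> ?S" "t \<noteq> t'" by (rule obtain_card)
  have tops: "q = x2 \<and> a < p \<and> p < x1 \<and> E p x2" if "(p, q) \<in> ?S" for p q
  proof -
    have o: "a \<le> p" "p < x1" "x1 < q" "q \<le> b" "E p q" "(p, q) \<noteq> (a, b)" "(p, q) \<noteq> (a, x2)"
      using that by (auto simp: overset_def)
    have "q \<le> x2" using top_split[OF N(2) o(1,2) _ o(4,5)] o(6) by fastforce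
    hence "q = x2" using o(3) e by simp
    thus ?thesis using o by auto
  qed
  have ent: "(z, x2) \<in> crset n E a x1 \<and> 2 \<le> card (outset a x1 z x2)" if z: "a < z" "z < x1" "E z x2" for z
  proof
    show "(z, x2) \<in> crset n E a x1" using z ord by (simp add: crset_def)
    show "2 \<le> card (outset a x1 z x2)"
      by (rule two_le_card[OF finite_outset, of "(x1, y1)" _ _ _ _ "(x1, b)"])
        (use z ord ed E1 in \<open>simp_all add: outset_def crset_def\<close>)
  qed
  obtain p p' where pp: "t = (p, x2)" "t' = (p', x2)" using tops tt by (metis prod.collapse)
  have "p \<noteq> p'" "a < p" "p < x1" "E p x2" "a < p'" "p' < x1" "E p' x2" using tops[of p x2] tops[of p' x2] tt pp by auto
  thus False using two[of p x2 p' x2] ent[of p] ent[of p'] by blast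
qed

text \<open>In \<open>beta1\<close> to \<open>beta4\<close> the second nonempty arc is
  \<open>x1x2\<close>, \<open>x2b\<close>, \<open>by2\<close> and \<open>y2y1\<close> respectively.
  Here two edges to \<open>b\<close> lie over \<open>x2\<close>, but the arc has only one foot, so
  one of them is \<open>x1b\<close>. An edge \<open>zv\<close> over \<open>x1\<close> other than
  \<open>ab\<close> then produces two outside crossings: on the other edge to \<open>b\<close> if
  \<open>v = x2\<close>, and otherwise on \<open>zv\<close> itself, from \<open>x1b\<close> and
  \<open>x1y1\<close>.\<close>

lemma beta1:
  assumes N: "o1 + o4 = 4" "o2 + o3 = 4"
    and e: "b = x2 + 1" "y2 = b + 1" "y1 = y2 + 1" "a + n = y1 + 1"
    and single: "\<And>x y x' y'. (x, y) \<in> crset n E x1 x2 \<Longrightarrow> (x', y') \<in> crset n E x1 x2 \<Longrightarrow> x = x'"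
    and out: "\<And>x y. (x, y) \<in> crset n E x1 x2 \<Longrightarrow> \<not> 2 \<le> card (outset x1 x2 x y)"
  shows False
proof -
  have "2 \<le> card (overset E x1 x2 b)" using o3_le_2[OF N(1) e(2,3)] N(2) by (simp add: o2_def)
  then obtain s s' where ss: "s \<in> overset E x1 x2 b" "s' \<in> overset E x1 x2 b" "s \<noteq> s'" by (rule obtain_card)
  have bots: "q = b \<and> x1 \<le> p \<and> p < x2 \<and> E p b" if "(p, q) \<in> overset E x1 x2 b" for p q
  proof -
    have o: "x1 \<le> p" "p < x2" "x2 < q" "q \<le> b" "E p q" using that by (auto simp: overset_def)
    have "q = b" using o e by linarith
    thus ?thesis using o by simp
  qed
  obtain g g' where sg: "s = (g, b)" "s' = (g', b)" using bots ss by (metis prod.collapse)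
  have gg: "g \<noteq> g'" "x1 \<le> g" "g < x2" "E g b" "x1 \<le> g'" "g' < x2" "E g' b"
    using bots[of g b] bots[of g' b] ss sg by auto
  have en: "(p, b) \<in> crset n E x1 x2" if "x1 < p" "p < x2" "E p b" for p using that ord by (simp add: crset_def)
  have "g = x1 \<or> g' = x1" using single[OF en[of g] en[of g']] gg by linarith
  then obtain q where E1: "E x1 b" and q: "x1 < q" "q < x2" "E q b" using gg by (metis order_le_imp_less_or_eq)
  have "overset E y2 y1 (a + n) \<subseteq> {(y2, a + n)}" using e by (auto simp: overset_def)
  hence "o4 \<le> 1" unfolding o4_def by (rule card_le_1)
  hence "3 \<le> o1" using N(1) by simp
  hence "card (overset E a x1 b - {(a, b)}) \<noteq> 0"
    using card_Diff1[OF finite_overset, of E a x1 b "(a, b)"] by (simp add: o1_def)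
  hence "overset E a x1 b - {(a, b)} \<noteq> {}" by (metis card.empty)
  then obtain z v where "(z, v) \<in> overset E a x1 b - {(a, b)}" by (metis ex_in_conv prod.collapse)
  hence o: "a \<le> z" "z < x1" "x1 < v" "v \<le> b" "E z v" "(z, v) \<noteq> (a, b)" by (auto simp: overset_def)
  have vx: "v \<le> x2" using top_split[OF N(2) o(1,2) _ o(4,5)] o(6) by fastforce
  have Ev: "E v (z + n)" by (rule flip_E[OF o(5)])
  show False
  proof (cases "v = x2")
    case True
    have "2 \<le> card (outset x1 x2 q b)"
      by (rule two_le_card[OF finite_outset, of "(x2, y2)" _ _ _ _ "(x2, z + n)"])
        (use q o ord ed Ev True in \<open>simp_all add: outset_def crset_def\<close>)
    thus False using out en[OF q] by blast
  next
    case False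
    hence ent: "(v, z + n) \<in> crset n E x1 x2" using o vx ord Ev by (simp add: crset_def)
    have "2 \<le> card (outset x1 x2 v (z + n))"
      by (rule two_le_card[OF finite_outset, of "(b, x1 + n)" _ _ _ _ "(y1, x1 + n)"])
        (use o vx False ord E_flip flip_E[OF E1] in \<open>simp_all add: outset_def crset_def\<close>)
    thus False using out ent by blast
  qed
qed

text \<open>Some edge \<open>x1w\<close> ends inside the arc from \<open>x2\<close> to
  \<open>b\<close>, and two edges over \<open>x1\<close> end at \<open>x2\<close>. Both of the
  latter cross \<open>x1w\<close> outside the arc.\<close>

lemma beta2:
  assumes N: "o1 + o4 = 4" "o2 + o3 = 4"
    and e: "x2 = x1 + 1" "y2 = b + 1" "y1 = y2 + 1" "a + n = y1 + 1"
    and out: "\<And>x y. (x, y) \<in> crset n E x2 b \<Longrightarrow> \<not> 2 \<le> card (outset x2 b x y)"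
  shows False
proof -
  have "2 \<le> card (overset E x1 x2 b)" using o3_le_2[OF N(1) e(2,3)] N(2) by (simp add: o2_def)
  hence "card (overset E x1 x2 b - {(x1, b)}) \<noteq> 0"
    using card_Diff1[OF finite_overset, of E x1 x2 b "(x1, b)"] by simp
  hence "overset E x1 x2 b - {(x1, b)} \<noteq> {}" by (metis card.empty)
  then obtain g w where "(g, w) \<in> overset E x1 x2 b - {(x1, b)}" by (metis ex_in_conv prod.collapse)
  hence "x1 \<le> g" "g < x2" and w: "x2 < w" "w \<le> b" "E g w" "(g, w) \<noteq> (x1, b)" by (auto simp: overset_def)
  hence "g = x1" using e by linarith
  hence w: "x2 < w" "w < b" "E x1 w" using w by auto
  have "overset E y2 y1 (a + n) \<subseteq> {(y2, a + n)}" using e by (auto simp: overset_def)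
  hence "o4 \<le> 1" unfolding o4_def by (rule card_le_1)
  hence "3 \<le> o1" using N(1) by simp
  hence "2 \<le> card (overset E a x1 b - {(a, b)})"
    using card_Diff1[OF finite_overset, of E a x1 b "(a, b)"] by (simp add: o1_def)
  then obtain t t' where tt: "t \<in> overset E a x1 b - {(a, b)}" "t' \<in> overset E a x1 b - {(a, b)}" "t \<noteq> t'"
    by (rule obtain_card)
  have tops: "q = x2 \<and> a \<le> p \<and> p < x1 \<and> E p x2" if "(p, q) \<in> overset E a x1 b - {(a, b)}" for p q
  proof -
    have o: "a \<le> p" "p < x1" "x1 < q" "q \<le> b" "E p q" "(p, q) \<noteq> (a, b)" using that by (auto simp: overset_def)
    have "q \<le> x2" using top_split[OF N(2) o(1,2) _ o(4,5)] o(6) by fastforce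
    hence "q = x2" using o(3) e by simp
    thus ?thesis using o by auto
  qed
  obtain p p' where pp: "t = (p, x2)" "t' = (p', x2)" using tops tt by (metis prod.collapse)
  have p: "p \<noteq> p'" "a \<le> p" "p < x1" "E p x2" "a \<le> p'" "p' < x1" "E p' x2" using tops[of p x2] tops[of p' x2] tt pp by auto
  have "2 \<le> card (outset x2 b w (x1 + n))"
    by (rule two_le_card[OF finite_outset, of "(p + n, x2 + n)" _ _ _ _ "(p' + n, x2 + n)"])
      (use p w ord in \<open>simp_all add: outset_def crset_def per per2\<close>)
  moreover have "(w, x1 + n) \<in> crset n E x2 b" using w ord flip_E[OF w(3)] by (simp add: crset_def)
  ultimately show False using out by blast
qed

text \<open>As \<open>o2\<close> is at most 1, some edge \<open>wy1\<close> starts inside the arc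
  from \<open>b\<close> to \<open>y2\<close>. Since \<open>x2y2\<close> crosses it, an edge from
  \<open>y2\<close> to \<open>a\<close> would be a second outside crossing; so
  \<open>o4 = 0\<close>. The single foot bounds \<open>o3\<close> by 3, which makes
  \<open>x1b\<close> an edge, and \<open>tops_two\<close> applies.\<close>

lemma beta3:
  assumes N: "o1 + o4 = 4" "o2 + o3 = 4"
    and e: "x2 = x1 + 1" "b = x2 + 1" "y1 = y2 + 1" "a + n = y1 + 1"
    and single: "\<And>x y x' y'. (x, y) \<in> crset n E b y2 \<Longrightarrow> (x', y') \<in> crset n E b y2 \<Longrightarrow> x = x'"
    and out: "\<And>x y. (x, y) \<in> crset n E b y2 \<Longrightarrow> \<not> 2 \<le> card (outset b y2 x y)"
    and two: "\<And>x y x' y'. (x, y) \<in> crset n E a x1 \<Longrightarrow> (x', y') \<in> crset n E a x1 \<Longrightarrow> x \<noteq> x' \<Longrightarrow>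
      2 \<le> card (outset a x1 x y) \<Longrightarrow> 2 \<le> card (outset a x1 x' y') \<Longrightarrow> False"
  shows False
proof -
  have s2: "overset E x1 x2 b \<subseteq> {(x1, b)}" using e by (auto simp: overset_def)
  have o2: "o2 \<le> 1" unfolding o2_def by (rule card_le_1[OF s2])
  have bots: "(p, q) = (b, a + n) \<or> q = y1 \<and> b \<le> p \<and> p < y2 \<and> E p y1" if "(p, q) \<in> overset E b y2 (a + n)" for p q
  proof -
    have o: "b \<le> p" "p < y2" "y2 < q" "q \<le> a + n" "E p q" using that by (auto simp: overset_def)
    show ?thesis
    proof (cases "y1 < q")
      case True
      thus ?thesis using bot_split[OF N(1) o(1,2) _ o(4,5)] by simp
    next
      case False
      hence "q = y1" using o e by linarith
      thus ?thesis using o by simp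
    qed
  qed
  have en: "(p, y1) \<in> crset n E b y2" if "b < p" "p < y2" "E p y1" for p using that ord by (simp add: crset_def)
  have "\<exists>w. b < w \<and> w < y2 \<and> E w y1"
  proof (rule ccontr)
    assume no: "\<not> ?thesis"
    have "overset E b y2 (a + n) \<subseteq> {(b, a + n), (b, y1)}"
    proof
      fix r assume r: "r \<in> overset E b y2 (a + n)"
      obtain p q where pq: "r = (p, q)" by (cases r)
      have "p = b \<or> \<not> (b \<le> p \<and> p < y2 \<and> E p y1)" using no by (metis order_le_imp_less_or_eq)
      thus "r \<in> {(b, a + n), (b, y1)}" using bots[of p q] r pq by blast
    qed
    hence "o3 \<le> 2" unfolding o3_def by (rule card_le_2)
    thus False using o2 N(2) by simp
  qed
  then obtain w where w: "b < w" "w < y2" "E w y1" by blast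
  have "overset E b y2 (a + n) \<subseteq> {(b, a + n), (b, y1), (w, y1)}"
  proof
    fix r assume r: "r \<in> overset E b y2 (a + n)"
    obtain p q where pq: "r = (p, q)" by (cases r)
    show "r \<in> {(b, a + n), (b, y1), (w, y1)}"
    proof (cases "(p, q) = (b, a + n)")
      case False
      hence o: "q = y1" "b \<le> p" "p < y2" "E p y1" using bots[of p q] r pq by blast+
      have "p = b \<or> p = w" using single[OF en[of p] en[OF w]] o by linarith
      thus ?thesis using pq o(1) by blast
    qed (use pq in simp)
  qed
  hence "o3 \<le> 3" unfolding o3_def by (rule card_le_3)
  hence "1 \<le> card (overset E x1 x2 b)" using N(2) by (simp add: o2_def)
  hence E1: "E x1 b" using subset_card_ne[OF s2] by (simp add: overset_def)
  have "overset E y2 y1 (a + n) \<subseteq> {(y2, a + n)}" using e by (auto simp: overset_def)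
  moreover have "\<not> E y2 (a + n)"
  proof
    assume "E y2 (a + n)"
    hence "2 \<le> card (outset b y2 w y1)"
      by (intro two_le_card[OF finite_outset, of "(y2, x2 + n)" _ _ _ _ "(y2, a + n)"])
        (use w ord E_flip in \<open>simp_all add: outset_def crset_def\<close>)
    thus False using out en[OF w] by blast
  qed
  ultimately have "overset E y2 y1 (a + n) = {}" by (auto simp: overset_def)
  hence "o4 = 0" by (simp add: o4_def)
  thus False by (rule tops_two[OF N e(1) E1 _ two])
qed

text \<open>Here the edges over \<open>y2\<close> start at \<open>b\<close>, and counting makes
  \<open>x1b\<close>, \<open>by1\<close> and some \<open>bw\<close> with \<open>w\<close> inside the
  arc edges. An edge from \<open>p\<close> to \<open>a\<close> over \<open>y1\<close> would give two
  outside crossings, on \<open>bw\<close> if \<open>p = y2\<close> and on itself otherwise. So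
  \<open>o4 = 0\<close> and \<open>tops_two\<close> applies.\<close>

lemma beta4:
  assumes N: "o1 + o4 = 4" "o2 + o3 = 4"
    and e: "x2 = x1 + 1" "b = x2 + 1" "y2 = b + 1" "a + n = y1 + 1"
    and single: "\<And>x y x' y'. (x, y) \<in> crset n E y2 y1 \<Longrightarrow> (x', y') \<in> crset n E y2 y1 \<Longrightarrow> x = x'"
    and out: "\<And>x y. (x, y) \<in> crset n E y2 y1 \<Longrightarrow> \<not> 2 \<le> card (outset y2 y1 x y)"
    and two: "\<And>x y x' y'. (x, y) \<in> crset n E a x1 \<Longrightarrow> (x', y') \<in> crset n E a x1 \<Longrightarrow> x \<noteq> x' \<Longrightarrow>
      2 \<le> card (outset a x1 x y) \<Longrightarrow> 2 \<le> card (outset a x1 x' y') \<Longrightarrow> False"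
  shows False
proof -
  have s2: "overset E x1 x2 b \<subseteq> {(x1, b)}" using e by (auto simp: overset_def)
  have o2: "o2 \<le> 1" unfolding o2_def by (rule card_le_1[OF s2])
  have bots: "(p, q) = (b, a + n) \<or> p = b \<and> y2 < q \<and> q \<le> y1 \<and> E b q" if "(p, q) \<in> overset E b y2 (a + n)" for p q
  proof -
    have o: "b \<le> p" "p < y2" "y2 < q" "q \<le> a + n" "E p q" using that by (auto simp: overset_def)
    have "p = b" using o e by linarith
    thus ?thesis using bot_split[OF N(1) o(1,2) _ o(4,5)] o by fastforce
  qed
  have en: "(w, b + n) \<in> crset n E y2 y1" if "y2 < w" "w < y1" "E b w" for w
    using that ord flip_E by (simp add: crset_def)
  have "\<exists>w. y2 < w \<and> w < y1 \<and> E b w"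
  proof (rule ccontr)
    assume no: "\<not> ?thesis"
    have "overset E b y2 (a + n) \<subseteq> {(b, a + n), (b, y1)}"
    proof
      fix r assume r: "r \<in> overset E b y2 (a + n)"
      obtain p q where pq: "r = (p, q)" by (cases r)
      have "q = y1 \<or> \<not> (y2 < q \<and> q \<le> y1 \<and> E b q)" using no by (metis order_le_imp_less_or_eq)
      thus "r \<in> {(b, a + n), (b, y1)}" using bots[of p q] r pq by blast
    qed
    hence "o3 \<le> 2" unfolding o3_def by (rule card_le_2)
    thus False using o2 N(2) by simp
  qed
  then obtain w where w: "y2 < w" "w < y1" "E b w" by blast
  have sub: "r \<in> {(b, a + n), (b, y1), (b, w)} \<and> (r = (b, y1) \<longrightarrow> E b y1)" if r: "r \<in> overset E b y2 (a + n)" for r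
  proof -
    obtain p q where pq: "r = (p, q)" by (cases r)
    show ?thesis
    proof (cases "(p, q) = (b, a + n)")
      case False
      hence o: "p = b" "y2 < q" "q \<le> y1" "E b q" using bots[of p q] r pq by blast+
      have "q = y1 \<or> q = w" using single[OF en[of q] en[OF w]] o by linarith
      thus ?thesis using pq o(1,4) by blast
    qed (use pq ord in simp)
  qed
  have "o3 \<le> 3" unfolding o3_def by (rule card_le_3[of _ "(b, a + n)" "(b, y1)" "(b, w)"]) (use sub in blast)
  hence "1 \<le> card (overset E x1 x2 b)" and o3: "o3 = 3" using N(2) o2 by (simp_all add: o2_def)
  hence E1: "E x1 b" using subset_card_ne[OF s2] by (simp add: overset_def)
  have Eb: "E b y1"
  proof (rule ccontr)
    assume "\<not> E b y1"
    hence "overset E b y2 (a + n) \<subseteq> {(b, a + n), (b, w)}" using sub by blast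
    hence "o3 \<le> 2" unfolding o3_def by (rule card_le_2)
    thus False using o3 by simp
  qed
  have "overset E y2 y1 (a + n) = {}"
  proof (rule ccontr)
    assume "overset E y2 y1 (a + n) \<noteq> {}"
    then obtain p q where "y2 \<le> p" "p < y1" "y1 < q" "q \<le> a + n" "E p q" by (auto simp: overset_def)
    moreover from this have "q = a + n" using e by linarith
    ultimately have p: "y2 \<le> p" "p < y1" "E p (a + n)" by simp_all
    show False
    proof (cases "p = y2")
      case True
      have "2 \<le> card (outset y2 y1 w (b + n))"
        by (rule two_le_card[OF finite_outset, of "(x2 + n, y2 + n)" _ _ _ _ "(a + n, y2 + n)"])
          (use w ord ed p True flip_E[OF p(3)] sym in \<open>auto simp: outset_def crset_def per per2\<close>)
      thus False using out en[OF w] by blast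
    next
      case False
      hence ent: "(p, a + n) \<in> crset n E y2 y1" using p ord by (simp add: crset_def)
      have "2 \<le> card (outset y2 y1 p (a + n))"
        by (rule two_le_card[OF finite_outset, of "(y1, b + n)" _ _ _ _ "(y1, x1 + n)"])
          (use p False ord E_flip flip_E[OF Eb] in \<open>simp_all add: outset_def crset_def\<close>)
      thus False using out ent by blast
    qed
  qed
  hence "o4 = 0" by (simp add: o4_def)
  thus False by (rule tops_two[OF N e(1) E1 _ two])
qed

lemma low_even:
  assumes LR: "L < R" "R - L + 1 < n" "good L R" and g: "gam L R \<le> 3" and ev: "even (R - L - 1)"
  shows "(x, y) \<in> crset n E L R \<Longrightarrow> (x', y') \<in> crset n E L R \<Longrightarrow> x = x'"
    "(x, y) \<in> crset n E L R \<Longrightarrow> \<not> 2 \<le> card (outset L R x y)"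
proof -
  have "\<not> two_ent L R" using gam_ge(4)[OF LR ev] g by linarith
  hence "\<not> x < x'" if "(x, y) \<in> crset n E L R" "(x', y') \<in> crset n E L R" for x y x' y'
    using that unfolding two_ent_def by blast
  thus "(x, y) \<in> crset n E L R \<Longrightarrow> (x', y') \<in> crset n E L R \<Longrightarrow> x = x'" by (meson linorder_neqE)
  show "(x, y) \<in> crset n E L R \<Longrightarrow> \<not> 2 \<le> card (outset L R x y)"
    using gam_out(1)[OF LR _ _ ev] g by fastforce
qed

text \<open>The rung makes the first arc nonempty. A failure forces the total 12 and
  \<open>G <= 5\<close>, hence exactly one more nonempty arc. By \<open>alpha\<close> the first arc
  has an odd number of inner vertices and thus slack 3. The other arc is left with slack 2, so it
  has an even number of inner vertices, which \<open>beta1\<close> to \<open>beta4\<close>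
  refute.\<close>

lemma left:
  assumes z: "(z, u) \<in> crset n E a b" "z < x1"
  shows sparse
proof (rule ccontr)
  assume not: "\<not> sparse"
  have "a < z" using z(1) by (simp add: crset_def)
  hence ne0: "x1 \<noteq> a + 1" using z(2) by linarith
  have l0: "2 \<le> gam a x1" by (rule gap0(2)[OF ne0])
  have l1: "0 \<le> gam x1 x2" "x2 = x1 + 1 \<or> 2 \<le> gam x1 x2" using gap1(1,2) by blast+
  have l2: "0 \<le> gam x2 b" "b = x2 + 1 \<or> 2 \<le> gam x2 b" using gap2(1,2) by blast+
  have l3: "0 \<le> gam b y2" "y2 = b + 1 \<or> 2 \<le> gam b y2" using gap3(1,2) by blast+
  have l4: "0 \<le> gam y2 y1" "y1 = y2 + 1 \<or> 2 \<le> gam y2 y1" using gap4(1,2) by blast+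
  have l5: "0 \<le> gam y1 (a + n)" "a + n = y1 + 1 \<or> 2 \<le> gam y1 (a + n)" using gap5(1,2) by blast+
  have all: "\<not> (x2 = x1 + 1 \<and> b = x2 + 1 \<and> y2 = b + 1 \<and> y1 = y2 + 1 \<and> a + n = y1 + 1)"
    using corner not by blast
  have G4: "4 \<le> G"
  proof (rule ccontr)
    assume "\<not> 4 \<le> G"
    hence "\<not> 4 \<le> gam a x1 + gam x1 x2 + gam x2 b + gam b y2 + gam y2 y1 + gam y1 (a + n)" by (simp add: G_def)
    from six_gaps[OF _ _ l1 l2 l3 l4 l5 this, of "x1 = a + 1"] l0 ne0 all show False by simp
  qed
  have "\<not> k + o1 + o2 + o3 + o4 \<le> 11" using not_sparse(1)[OF not, of 11] G4 by auto
  hence N: "k = 4" "o1 + o4 = 4" "o2 + o3 = 4" using k_le o14 o23 by linarith+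
  have "k + o1 + o2 + o3 + o4 \<le> 12" using N by linarith
  hence G5: "G \<le> 5" using not_sparse(1)[OF not, of 12] by simp
  have n4: "\<not> (x2 = x1 + 1 \<and> b = x2 + 1 \<and> y2 = b + 1 \<and> y1 = y2 + 1)" using no4[OF N(2,3)] by blast
  note f = five_gaps[OF l0 l1 l2 l3 l4 l5 G5[unfolded G_def] n4]
  have g0: "gam a x1 \<le> 3" and e5: "a + n = y1 + 1" using f by blast+
  have two: "False" if "(x, y) \<in> crset n E a x1" "(x', y') \<in> crset n E a x1" "x \<noteq> x'"
      "2 \<le> card (outset a x1 x y)" "2 \<le> card (outset a x1 x' y')" for x y x' y'
    using gam_two_out(1)[OF ord(1) short(1) good012(1) that] g0 by linarith
  consider "b = x2 + 1 \<and> y2 = b + 1 \<and> y1 = y2 + 1 \<and> gam x1 x2 \<le> 3 \<and> x2 \<noteq> x1 + 1"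
    | "x2 = x1 + 1 \<and> y2 = b + 1 \<and> y1 = y2 + 1 \<and> gam x2 b \<le> 3 \<and> b \<noteq> x2 + 1"
    | "x2 = x1 + 1 \<and> b = x2 + 1 \<and> y1 = y2 + 1 \<and> gam b y2 \<le> 3 \<and> y2 \<noteq> b + 1"
    | "x2 = x1 + 1 \<and> b = x2 + 1 \<and> y2 = b + 1 \<and> gam y2 y1 \<le> 3 \<and> y1 \<noteq> y2 + 1"
    using f by blast
  note B = this
  have al: "x2 \<noteq> x1 + 1 \<Longrightarrow> b = x2 + 1 \<and> y2 = b + 1 \<and> y1 = y2 + 1"
    using B by cases blast+
  have odd0: "odd (x1 - a - 1)"
  proof
    assume ev: "even (x1 - a - 1)"
    note s = low_even[OF ord(1) short(1) good012(1) g0 ev]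
    have "4 \<le> gam x1 x2" by (rule alpha[OF N z e5 al s(1,2)])
    thus False using l0 l2(1) l3(1) l4(1) l5(1) G5 unfolding G_def by linarith
  qed
  have g3: "3 \<le> gam a x1" by (rule gap0(3)[OF odd0])
  from B show False
  proof cases
    case 1
    have "even (x2 - x1 - 1)"
    proof (rule ccontr)
      assume "odd (x2 - x1 - 1)"
      hence "3 \<le> gam x1 x2" by (rule gap1(3))
      thus False using g3 l2(1) l3(1) l4(1) l5(1) G5 unfolding G_def by linarith
    qed
    note s = low_even[OF ord(2) short(2) good012(2) _ this]
    show False by (rule beta1[OF N(2,3) _ _ _ e5]) (use 1 s(1,2) two in blast)+
  next
    case 2
    have "even (b - x2 - 1)"
    proof (rule ccontr)
      assume "odd (b - x2 - 1)"
      hence "3 \<le> gam x2 b" by (rule gap2(3))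
      thus False using g3 l1(1) l3(1) l4(1) l5(1) G5 unfolding G_def by linarith
    qed
    note s = low_even[OF ord(3) short(3) good012(3) _ this]
    show False by (rule beta2[OF N(2,3) _ _ _ e5]) (use 2 s(2) in blast)+
  next
    case 3
    have "even (y2 - b - 1)"
    proof (rule ccontr)
      assume "odd (y2 - b - 1)"
      hence "3 \<le> gam b y2" by (rule gap3(3))
      thus False using g3 l1(1) l2(1) l4(1) l5(1) G5 unfolding G_def by linarith
    qed
    note s = low_even[OF ord(4) short(4) good345(1) _ this]
    show False by (rule beta3[OF N(2,3) _ _ _ e5]) (use 3 s(1,2) two in blast)+
  next
    case 4
    have "even (y1 - y2 - 1)"
    proof (rule ccontr)
      assume "odd (y1 - y2 - 1)"
      hence "3 \<le> gam y2 y1" by (rule gap4(3))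
      thus False using g3 l1(1) l2(1) l3(1) l5(1) G5 unfolding G_def by linarith
    qed
    note s = low_even[OF ord(5) short(5) good345(2) _ this]
    show False by (rule beta4[OF N(2,3) _ _ _ e5]) (use 4 s(1,2) two in blast)+
  qed
qed

text \<open>If the slack is below 4, at most one arc is nonempty and \<open>one_gap\<close> applies.
  Otherwise a failure needs \<open>k = 4\<close>, hence a rung outside the quadrilateral, and the
  symmetries bring it to the position treated in \<open>left\<close>.\<close>

lemma sparse: sparse
proof (rule ccontr)
  assume not: "\<not> sparse"
  have l0: "0 \<le> gam a x1" "x1 = a + 1 \<or> 2 \<le> gam a x1" using gap0(1,2) by blast+
  have l1: "0 \<le> gam x1 x2" "x2 = x1 + 1 \<or> 2 \<le> gam x1 x2" using gap1(1,2) by blast+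
  have l2: "0 \<le> gam x2 b" "b = x2 + 1 \<or> 2 \<le> gam x2 b" using gap2(1,2) by blast+
  have l3: "0 \<le> gam b y2" "y2 = b + 1 \<or> 2 \<le> gam b y2" using gap3(1,2) by blast+
  have l4: "0 \<le> gam y2 y1" "y1 = y2 + 1 \<or> 2 \<le> gam y2 y1" using gap4(1,2) by blast+
  have l5: "0 \<le> gam y1 (a + n)" "a + n = y1 + 1 \<or> 2 \<le> gam y1 (a + n)" using gap5(1,2) by blast+
  have G4: "4 \<le> G"
  proof (rule ccontr)
    assume "\<not> 4 \<le> G"
    hence "x1 = a + 1 \<and> b = x2 + 1 \<and> y2 = b + 1 \<and> y1 = y2 + 1 \<and> a + n = y1 + 1 \<or>
      x2 = x1 + 1 \<and> b = x2 + 1 \<and> y2 = b + 1 \<and> y1 = y2 + 1 \<and> a + n = y1 + 1 \<or>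
      x1 = a + 1 \<and> x2 = x1 + 1 \<and> y2 = b + 1 \<and> y1 = y2 + 1 \<and> a + n = y1 + 1 \<or>
      x1 = a + 1 \<and> x2 = x1 + 1 \<and> b = x2 + 1 \<and> y1 = y2 + 1 \<and> a + n = y1 + 1 \<or>
      x1 = a + 1 \<and> x2 = x1 + 1 \<and> b = x2 + 1 \<and> y2 = b + 1 \<and> a + n = y1 + 1 \<or>
      x1 = a + 1 \<and> x2 = x1 + 1 \<and> b = x2 + 1 \<and> y2 = b + 1 \<and> y1 = y2 + 1"
      by (intro six_gaps[OF l0 l1 l2 l3 l4 l5]) (simp add: G_def)
    thus False using one_gap not by blast
  qed
  hence "\<not> k + o1 + o2 + o3 + o4 \<le> 11" using not_sparse(1)[OF not, of 11] by auto
  hence "k = 4" using k_le o14 o23 by linarith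
  then obtain x y where r: "(x, y) \<in> crset n E a b" "x < x1 \<or> y1 < y \<or> x2 < x \<or> y < y2"
    using k4_side by blast
  have c: "cyc n E" by unfold_locales
  interpret r: hex n E b y2 y1 "a + n" "x1 + n" "x2 + n" by (rule rot)
  have f: "(y, x + n) \<in> crset n E b (a + n)" by (rule crset_flip[OF r(1)])
  have m: "(- u, n - v) \<in> crset n (mir E) (- q) (- p)" if "(u, v) \<in> crset n E p q" for u v p q
    using that per2[of u "- n + v"] by (simp add: crset_def mir_def)
  from r(2) show False
  proof (elim disjE)
    assume "x < x1" thus False using left r(1) not by blast
  next
    assume "y < y2"
    hence "r.sparse" using r.left f by blast
    thus False using not by (simp only: sparse_rot)
  next
    assume "x2 < x"
    hence "hex.sparse n (mir E) (- b) (- a)" by (intro hex.left[OF mirror m[OF r(1)]]) simp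
    thus False using not by (simp only: sparse_mirror)
  next
    assume "y1 < y"
    hence "hex.sparse n (mir E) (- (a + n)) (- b)" by (intro hex.left[OF r.mirror m[OF f]]) simp
    hence "r.sparse" by (simp only: r.sparse_mirror)
    thus False using not by (simp only: sparse_rot)
  qed
qed

end

section \<open>Four crossings\<close>

lemma dgs_3: "dgs 3 = {}"
  by (auto simp: dgs_def)

lemma dgs_4: "dgs 4 \<subseteq> set [(0, 2), (1, 3)]"
proof
  fix p assume "p \<in> dgs 4"
  then obtain u v where p: "p = (u, v)" "0 \<le> u" "u + 2 \<le> v" "v < 4" "\<not> (u = 0 \<and> v = 3)" by (auto simp: dgs_def)
  hence "u = 0 \<and> v = 2 \<or> u = 1 \<and> v = 3" by presburger
  thus "p \<in> set [(0, 2), (1, 3)]" using p(1) by auto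
qed

lemma dgs_5: "dgs 5 \<subseteq> set [(0, 2), (0, 3), (1, 3), (1, 4), (2, 4)]"
proof
  fix p assume "p \<in> dgs 5"
  then obtain u v where p: "p = (u, v)" "0 \<le> u" "u + 2 \<le> v" "v < 5" "\<not> (u = 0 \<and> v = 4)" by (auto simp: dgs_def)
  hence "u = 0 \<and> v = 2 \<or> u = 0 \<and> v = 3 \<or> u = 1 \<and> v = 3 \<or> u = 1 \<and> v = 4 \<or> u = 2 \<and> v = 4" by presburger
  thus "p \<in> set [(0, 2), (0, 3), (1, 3), (1, 4), (2, 4)]" using p(1) by auto
qed

lemma dgs_6: "dgs 6 \<subseteq> set [(0, 2), (0, 3), (0, 4), (1, 3), (1, 4), (1, 5), (2, 4), (2, 5), (3, 5)]"
proof
  fix p assume "p \<in> dgs 6"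
  then obtain u v where p: "p = (u, v)" "0 \<le> u" "u + 2 \<le> v" "v < 6" "\<not> (u = 0 \<and> v = 5)" by (auto simp: dgs_def)
  hence "u = 0 \<and> v = 2 \<or> u = 0 \<and> v = 3 \<or> u = 0 \<and> v = 4 \<or> u = 1 \<and> v = 3 \<or> u = 1 \<and> v = 4 \<or> u = 1 \<and> v = 5
    \<or> u = 2 \<and> v = 4 \<or> u = 2 \<and> v = 5 \<or> u = 3 \<and> v = 5" by presburger
  thus "p \<in> set [(0, 2), (0, 3), (0, 4), (1, 3), (1, 4), (1, 5), (2, 4), (2, 5), (3, 5)]" using p(1) by auto
qed

lemma card_set_le: "A \<subseteq> set xs \<Longrightarrow> card A \<le> length xs"
  using card_mono[of "set xs" A] card_length[of xs] by simp

text \<open>The three long diagonals of the hexagon cross mutually, so one of the nine diagonals is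
  missing.\<close>

lemma card_dgs6_no3:
  assumes "F \<subseteq> dgs 6" "no3F F"
  shows "card F \<le> 8"
proof -
  let ?D = "set [(0, 2), (0, 3), (0, 4), (1, 3), (1, 4), (1, 5), (2, 4), (2, 5), (3, 5)] :: (int \<times> int) set"
  have "\<not> ((0, 3) \<in> F \<and> (1, 4) \<in> F \<and> (2, 5) \<in> F)"
  proof
    assume h: "(0, 3) \<in> F \<and> (1, 4) \<in> F \<and> (2, 5) \<in> F"
    have "(0::int) < 1" "(1::int) < 2" "(2::int) < 3" "(3::int) < 4" "(4::int) < 5" by simp_all
    thus False using assms(2) h unfolding no3F_def by blast
  qed
  moreover have "F \<subseteq> ?D" using assms(1) dgs_6 by blast
  moreover have "(0, 3) \<in> ?D" "(1, 4) \<in> ?D" "(2, 5) \<in> ?D" by simp_all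
  ultimately have "F \<subset> ?D" by blast
  hence "card F < card ?D" by (intro psubset_card_mono) simp_all
  thus ?thesis using card_length[of "[(0, 2), (0, 3), (0, 4), (1, 3), (1, 4), (1, 5), (2, 4), (2, 5), (3, 5)] :: (int \<times> int) list"] by simp
qed

context kf
begin

lemma arc_le:
  assumes "L < R" "R - L + 1 < n"
  shows "2 * int (wt E L R) \<le> 5 * (R - L - 1)" "R \<noteq> L + 1 \<Longrightarrow> 2 * int (wt E L R) + 1 \<le> 5 * (R - L - 1)"
proof -
  show *: "2 * int (wt E L R) + 1 \<le> 5 * (R - L - 1)" if "R \<noteq> L + 1"
  proof -
    have "of_bool (R - L - 1 = 5) \<le> (1::int)" "of_bool (E L R) \<le> (1::int)" by simp_all
    moreover have "L + 2 \<le> R" using assms that by simp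
    ultimately show ?thesis using arcs[of L R] assms by linarith
  qed
  show "2 * int (wt E L R) \<le> 5 * (R - L - 1)" using * assms(1) by (cases "R = L + 1") (auto simp: wt_0)
qed

text \<open>\<open>star_cut4\<close> leaves seven arcs with \<open>n - 7\<close> inner vertices and
  costs 12 edges; 5 (n - 7) + 24 exceeds the target by 1. A nonempty arc supplies this 1, and if all
  arcs are empty then \<open>n = 7\<close>, where the exceptional summand supplies it.\<close>

lemma star_bound:
  assumes m: meet_all and ab: "a < b" "b < a + n" "E a b" "card (crset n E a b) = 4" and n7: "7 \<le> n"
  shows "\<exists>a b. a < b \<and> b < a + n \<and> E a b \<and> 2 * int (tot a b) \<le> 5 * (n - 2) - 2 + of_bool (n = 7)"
proof -
  have two: "(2::nat) \<le> 4" by simp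
  obtain a b v W where
    s: "a < v" "v < b" "b < a + n" "E a b" "card (crset n E a b) = 4" "card W = 4"
    and W: "\<And>w. w \<in> W \<Longrightarrow> b < w \<and> w < a + n \<and> E v w"
    using star_shape[OF m ab(1-3) ab(4) two] by metis
  obtain w1 w2 w3 w4 where w: "w1 \<in> W" "w2 \<in> W" "w3 \<in> W" "w4 \<in> W" "w1 < w2" "w2 < w3" "w3 < w4"
    using sorted4[OF s(6)] .
  have o: "a < v" "v < b" "b < w1" "w1 < w2" "w2 < w3" "w3 < w4" "w4 < a + n" "E a b"
    using s w W[OF w(1)] W[OF w(4)] by blast+
  have f: "fan a b v w1" "fan a b v w2" "fan a b v w3" "fan a b v w4"
    using meet_all_fan[OF m s(1,2) _ _ s(4)] W[OF w(1)] W[OF w(2)] W[OF w(3)] W[OF w(4)] by blast+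
  have c: "card (crset n E v w1) \<le> 4" "card (crset n E v w4) \<le> 4"
    by (rule cr; use o W[OF w(1)] W[OF w(4)] in linarith)+
  have t: "tot a b \<le> wt E a v + wt E v b + wt E b w1 + wt E w1 w2 + wt E w2 w3 + wt E w3 w4 + wt E w4 (a + n) + 12"
    using star_cut4[OF o f] s(5) c by linarith
  define d where "d = (\<lambda>L R. 5 * (R - L - 1) - 2 * int (wt E L R))"
  have d: "0 \<le> d L R" "R \<noteq> L + 1 \<Longrightarrow> 1 \<le> d L R" if "L < R" "R - L + 1 < n" for L R
    using arc_le[OF that] by (auto simp: d_def)
  define D where "D = d a v + d v b + d b w1 + d w1 w2 + d w2 w3 + d w3 w4 + d w4 (a + n)"
  have "2 * int (tot a b) \<le> 5 * (n - 7) - D + 24" using t by (simp add: D_def d_def)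
  moreover have "1 \<le> D + of_bool (n = 7)"
  proof (cases "n = 7")
    case True
    have "0 \<le> D" unfolding D_def by (intro add_nonneg_nonneg d) (use o in linarith)+
    thus ?thesis using True by simp
  next
    case False
    have z: "0 \<le> d a v" "0 \<le> d v b" "0 \<le> d b w1" "0 \<le> d w1 w2" "0 \<le> d w2 w3" "0 \<le> d w3 w4" "0 \<le> d w4 (a + n)"
      by (rule d; use o in linarith)+
    have "v \<noteq> a + 1 \<or> b \<noteq> v + 1 \<or> w1 \<noteq> b + 1 \<or> w2 \<noteq> w1 + 1 \<or> w3 \<noteq> w2 + 1 \<or> w4 \<noteq> w3 + 1 \<or> a + n \<noteq> w4 + 1"
      using False by linarith
    hence "1 \<le> d a v \<or> 1 \<le> d v b \<or> 1 \<le> d b w1 \<or> 1 \<le> d w1 w2 \<or> 1 \<le> d w2 w3 \<or> 1 \<le> d w3 w4 \<or> 1 \<le> d w4 (a + n)"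
    proof (elim disjE)
      assume "v \<noteq> a + 1" hence "1 \<le> d a v" by (rule d(2)[rotated 2]) (use o in linarith)+
      thus ?thesis by blast
    next
      assume "b \<noteq> v + 1" hence "1 \<le> d v b" by (rule d(2)[rotated 2]) (use o in linarith)+
      thus ?thesis by blast
    next
      assume "w1 \<noteq> b + 1" hence "1 \<le> d b w1" by (rule d(2)[rotated 2]) (use o in linarith)+
      thus ?thesis by blast
    next
      assume "w2 \<noteq> w1 + 1" hence "1 \<le> d w1 w2" by (rule d(2)[rotated 2]) (use o in linarith)+
      thus ?thesis by blast
    next
      assume "w3 \<noteq> w2 + 1" hence "1 \<le> d w2 w3" by (rule d(2)[rotated 2]) (use o in linarith)+
      thus ?thesis by blast
    next
      assume "w4 \<noteq> w3 + 1" hence "1 \<le> d w3 w4" by (rule d(2)[rotated 2]) (use o in linarith)+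
      thus ?thesis by blast
    next
      assume "a + n \<noteq> w4 + 1" hence "1 \<le> d w4 (a + n)" by (rule d(2)[rotated 2]) (use o in linarith)+
      thus ?thesis by blast
    qed
    hence "1 \<le> D" unfolding D_def using z by (elim disjE) linarith+
    thus ?thesis using False by simp
  qed
  moreover have "x \<le> 5 * (n - 2) - 2 + q" if "x \<le> 5 * (n - 7) - D + 24" "1 \<le> D + q" for x q
    using that by simp
  ultimately have "2 * int (tot a b) \<le> 5 * (n - 2) - 2 + of_bool (n = 7)" by blast
  thus ?thesis using s o(1) by (intro exI[of _ a] exI[of _ b]) simp
qed

lemma hex_bound:
  assumes m: "\<not> meet_all" and no3: "no3 n E" and n7: "7 \<le> n"
  shows "\<exists>a b. a < b \<and> b < a + n \<and> E a b \<and> 2 * int (tot a b) \<le> 5 * (n - 2) - 2 + of_bool (n = 7)"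
proof -
  define Q where "Q = (\<lambda>a x1 x2 b y2 y1. a < x1 \<and> x1 < x2 \<and> x2 < b \<and> b < y2 \<and> y2 < y1 \<and> y1 < a + n \<and>
    E a b \<and> E x1 y1 \<and> E x2 y2)"
  have order: "y' \<le> y" if "a < x" "x < x'" "x' < b" "b < y" "y' < a + n" "E a b" "E x y" "E x' y'" for a b x y x' y'
  proof (rule ccontr)
    assume "\<not> y' \<le> y"
    hence "y < y'" by simp
    thus False using no3 that unfolding no3_def by blast
  qed
  obtain u v x y x' y' where "u < v" "v < u + n" "E u v" "(x, y) \<in> crset n E u v" "(x', y') \<in> crset n E u v"
    "x \<noteq> x'" "y \<noteq> y'" using m unfolding meet_all_def by blast
  hence o: "u < x" "x < v" "v < y" "y < u + n" "E x y" "u < x'" "x' < v" "v < y'" "y' < u + n" "E x' y'" "E u v"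
    "x \<noteq> x'" "y \<noteq> y'" by (auto simp: crset_def)
  define M where "M = (\<lambda>k. \<exists>a x1 x2 b y2 y1. Q a x1 x2 b y2 y1 \<and> nat (x2 - x1 + (y1 - y2)) = k)"
  have "\<exists>k. M k"
  proof (cases "x < x'")
    case True
    hence "Q u x x' v y' y" using order[of u x x' v y y'] o by (simp add: Q_def)
    thus ?thesis unfolding M_def by blast
  next
    case False
    hence "Q u x' x v y y'" using order[of u x' x v y' y] o by (simp add: Q_def)
    thus ?thesis unfolding M_def by blast
  qed
  hence "M (LEAST k. M k)" by (rule LeastI_ex)
  then obtain k where k: "M k" and min: "\<And>j. j < k \<Longrightarrow> \<not> M j" using not_less_Least[of _ M] by blast
  obtain a x1 x2 b y2 y1 where q: "Q a x1 x2 b y2 y1" and kk: "nat (x2 - x1 + (y1 - y2)) = k"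
    using k unfolding M_def by blast
  have less: "\<not> Q a x1' x2' b y2' y1'" if "nat (x2' - x1' + (y1' - y2')) < k" for x1' x2' y2' y1'
    using min[OF that] unfolding M_def by blast
  have Q: "a < x1" "x1 < x2" "x2 < b" "b < y2" "y2 < y1" "y1 < a + n" "E a b" "E x1 y1" "E x2 y2"
    using q by (simp_all add: Q_def)
  interpret h: hex n E a x1 x2 b y2 y1
  proof
    fix x y assume "(x, y) \<in> crset n E a b"
    hence c: "a < x" "x < b" "b < y" "y < a + n" "E x y" by (auto simp: crset_def)
    have r1: "x1 < x \<Longrightarrow> y \<le> y1" by (rule order[of a x1 x b y1 y]) (use c Q in simp_all)
    have r2: "x < x2 \<Longrightarrow> y2 \<le> y" by (rule order[of a x x2 b y y2]) (use c Q in simp_all)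
    have r3: "x < x1 \<Longrightarrow> y1 \<le> y" by (rule order[of a x x1 b y y1]) (use c Q in simp_all)
    have r4: "x2 < x \<Longrightarrow> y \<le> y2" by (rule order[of a x2 x b y2 y]) (use c Q in simp_all)
    \<comment> \<open>A rung starting strictly between could replace one of the two edges:
      \<open>x1y1\<close> if it ends at \<open>y1\<close>, and \<open>x2y2\<close> otherwise. Either
      way the pair would come closer together.\<close>
    show "x \<le> x1 \<or> x2 \<le> x"
    proof (rule ccontr)
      assume "\<not> ?thesis"
      hence x: "x1 < x" "x < x2" by simp_all
      note y = r1[OF x(1)] r2[OF x(2)]
      show False
      proof (cases "y = y1")
        case True
        have "Q a x x2 b y2 y1" using c x Q True by (simp add: Q_def)
        moreover have "nat (x2 - x + (y1 - y2)) < k" using kk x Q by linarith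
        ultimately show False using less by blast
      next
        case False
        have "Q a x1 x b y y1" using c x y Q False by (simp add: Q_def)
        moreover have "nat (x - x1 + (y1 - y)) < k" using kk x y Q by linarith
        ultimately show False using less by blast
      qed
    qed
    show "y \<le> y2 \<or> y1 \<le> y"
    proof (rule ccontr)
      assume "\<not> ?thesis"
      hence y: "y2 < y" "y < y1" by simp_all
      have x: "x1 \<le> x" "x \<le> x2" using r3 r4 y by linarith+
      show False
      proof (cases "x = x1")
        case True
        have "Q a x1 x2 b y2 y" using c y Q True by (simp add: Q_def)
        moreover have "nat (x2 - x1 + (y - y2)) < k" using kk y Q by linarith
        ultimately show False using less by blast
      next
        case False
        have "Q a x1 x b y y1" using c x y Q False by (simp add: Q_def)
        moreover have "nat (x - x1 + (y1 - y)) < k" using kk x y Q by linarith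
        ultimately show False using less by blast
      qed
    qed
  qed (use Q no3 n7 in simp_all)
  have "2 * int (tot a b) \<le> 5 * (n - 2) - 2 + of_bool (n = 7)" using h.sparse by (simp only: h.sparse_def)
  thus ?thesis using Q by (intro exI[of _ a] exI[of _ b]) simp
qed

end

lemma no3_bound:
  assumes "3 \<le> n" "F \<subseteq> dgs n" "lcr 4 F" "no3F F"
  shows "2 * int (card F) \<le> 5 * (n - 2) - 4 + of_bool (n = 7)"
  using assms
proof (induction "nat n" arbitrary: n F rule: less_induct)
  case less
  note n = less.prems(1) and F = less.prems(2) and l = less.prems(3) and no3 = less.prems(4)
  consider "n = 3" | "n = 4" | "n = 5" | "n = 6" | "7 \<le> n" using n by linarith
  thus ?case
  proof cases
    case 1
    thus ?thesis using F by (simp add: dgs_3)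
  next
    case 2
    hence "card F \<le> length [(0::int, 2::int), (1, 3)]" using F dgs_4 by (intro card_set_le) blast
    hence "card F \<le> 2" by simp
    thus ?thesis using 2 by simp
  next
    case 3
    hence "card F \<le> length [(0::int, 2::int), (0, 3), (1, 3), (1, 4), (2, 4)]" using F dgs_5 by (intro card_set_le) blast
    hence "card F \<le> 5" by simp
    thus ?thesis using 3 by simp
  next
    case 4
    have "card F \<le> 8" by (rule card_dgs6_no3) (use F no3 4 in simp_all)
    thus ?thesis using 4 by simp
  next
    case n7: 5
    define E where "E = lift n F"
    interpret cyc n E unfolding E_def by (rule lift_cyc[OF n F])
    have c: "cyc n E" by unfold_locales
    have cr: "card (crset n E u v) \<le> 4" if "u < v" "v < u + n" "E u v" for u v
      using lift_cr[OF n F l that(1,2)] that(3) by (simp add: E_def)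
    have n3E: "no3 n E" unfolding E_def by (rule lift_no3[OF n no3])
    have arcs: "2 * int (wt E L R) \<le> 5 * (R - L - 1) - 4 + of_bool (R - L - 1 = 5) + 2 * of_bool (E L R)"
      if LR: "L + 2 \<le> R" "R - L + 1 < n" for L R
    proof -
      have "R < L + n" using LR by simp
      note s = arc_sub[OF c cr LR(1) this] and s3 = arc_no3[OF n3E this]
      let ?F = "{(u, v). (L + u, L + v) \<in> arcset E L R \<and> \<not> (u = 0 \<and> v = R - L)}"
      have "2 * int (card ?F) \<le> 5 * ((R - L + 1) - 2) - 4 + of_bool (R - L + 1 = 7)"
      proof (rule less.hyps)
        show "nat (R - L + 1) < nat n" "3 \<le> R - L + 1" using LR by linarith+
        show "?F \<subseteq> dgs (R - L + 1)" by (rule s(1))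
        show "lcr 4 ?F" by (rule s(2))
        show "no3F ?F" by (rule s3)
      qed
      moreover have "wt E L R = card ?F + of_bool (E L R)" by (rule s(3))
      moreover have "(R - L + 1 = 7) = (R - L - 1 = 5)" by auto
      moreover have "5 * ((R - L + 1) - 2) = 5 * (R - L - 1)" by simp
      ultimately show ?thesis by simp
    qed
    have goal: ?thesis if "a < b" "b < a + n" "E a b" "2 * int (tot a b) \<le> 5 * (n - 2) - 2 + of_bool (n = 7)" for a b
    proof -
      have "card F + 1 \<le> tot a b" using edge_tot[OF n F that(1,2)] that(3) by (simp add: E_def)
      thus ?thesis using that(4) by linarith
    qed
    show ?thesis
    proof (cases "\<exists>L R. L + 2 \<le> R \<and> R + 2 \<le> L + n \<and> crset n E L R = {}")
      case True
      then obtain L R where LR: "L + 2 \<le> R" "R + 2 \<le> L + n" "crset n E L R = {}" by blast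
      have "card F + of_bool (E L R) \<le> wt E L R + wt E R (L + n)"
        using lift_total[OF n F, of L] total_split[of L R] LR by (simp add: E_def)
      hence 1: "int (card F) + of_bool (E L R) \<le> int (wt E L R) + int (wt E R (L + n))"
        unfolding of_nat_le_iff[symmetric, where 'a = int] of_nat_add of_nat_of_bool .
      have 2: "2 * int (wt E L R) \<le> 5 * (R - L - 1) - 4 + of_bool (R - L - 1 = 5) + 2 * of_bool (E L R)"
        by (rule arcs) (use LR in simp_all)
      have "2 * int (wt E R (L + n)) \<le> 5 * (L + n - R - 1) - 4 + of_bool (L + n - R - 1 = 5) + 2 * of_bool (E R (L + n))"
        by (rule arcs) (use LR in simp_all)
      moreover have "E R (L + n) = E L R" using per2[of R L] sym by blast
      ultimately have 3: "2 * int (wt E R (L + n)) \<le> 5 * (L + n - R - 1) - 4 + of_bool (L + n - R - 1 = 5) + 2 * of_bool (E L R)"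
        by (simp only:)
      \<comment> \<open>Both parts bring a deficit of 4. The two exceptional summands take back at
        most 2, and so does the chord, which is counted in both parts: -8 + 2 + 2 = -4.\<close>
      have *: "2 * c \<le> 5 * (n - 2) - 4 + q"
        if "c + e \<le> w + w'" "2 * w \<le> 5 * (R - L - 1) - 4 + p + 2 * e" "2 * w' \<le> 5 * (L + n - R - 1) - 4 + p' + 2 * e"
          "p \<le> 1" "p' \<le> 1" "e \<le> 1" "0 \<le> q" for c e w w' p p' q :: int
        using that by (simp add: algebra_simps)
      show ?thesis by (rule *[OF 1 2 3]) simp_all
    next
      case False
      interpret kf n E
      proof
        fix u v assume "u < v" "v < u + n" "E u v"
        thus "card (crset n E u v) \<le> 4" by (rule cr)
      next
        fix L R :: int assume "L + 2 \<le> R" "R - L + 1 < n"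
        thus "2 * int (wt E L R) \<le> 5 * (R - L - 1) - 4 + of_bool (R - L - 1 = 5) + 2 * of_bool (E L R)" by (rule arcs)
      next
        fix L R :: int assume "L + 2 \<le> R" "R + 2 \<le> L + n"
        thus "crset n E L R \<noteq> {}" using False by blast
      qed
      show ?thesis
      proof (cases "lcr 3 F")
        case True
        define s where "s = nat (n - 2)"
        have "card F + 1 \<le> g3 s" using ub3 n F True unfolding ub_def s_def by blast
        moreover have "g3 s \<le> 2 * s + s div 4" by (simp add: g3_def)
        moreover have s: "5 \<le> s" "int s = n - 2" using n7 by (simp_all add: s_def)
        moreover have "2 * (s div 4) + 2 \<le> s" using s(1) by presburger
        ultimately have "2 * card F + 4 \<le> 5 * s" by linarith
        hence "2 * int (card F) + 4 \<le> 5 * int s" by presburger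
        hence "2 * int (card F) \<le> 5 * (n - 2) - 4" using s(2) by simp
        moreover have "0 \<le> (of_bool (n = 7) :: int)" by simp
        ultimately show ?thesis by (meson add_increasing2 order_trans)
      next
        case nl: False
        then obtain a b where e: "(a, b) \<in> F" "\<not> card {f \<in> F. crs (a, b) f} \<le> 3" unfolding lcr_def by auto
        have ab: "a < b" "b < a + n" using e(1) F by (auto simp: dgs_def)
        have E: "E a b" using lift_in[OF F e(1)] by (simp add: E_def)
        have c4: "card (crset n E a b) = 4"
          using cr_lin[OF n F e(1)] e(2) cr[OF ab E] unfolding E_def by linarith
        have "\<exists>a b. a < b \<and> b < a + n \<and> E a b \<and> 2 * int (tot a b) \<le> 5 * (n - 2) - 2 + of_bool (n = 7)"
          using star_bound[OF _ ab E c4 n7] hex_bound[OF _ n3E n7] by blast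
        thus ?thesis using goal by blast
      qed
    qed
  qed
qed

lemma g4_step: "4 \<le> s \<Longrightarrow> g4 (s - 4) + 10 \<le> g4 s"
proof -
  assume "4 \<le> s"
  then obtain t where t: "s = t + 4" using le_Suc_ex by (metis add.commute)
  have "t = 1 \<or> t = 2 \<or> g4 t = 2 * t + 2 * (t div 4)" by (simp add: g4_def)
  moreover have "(t + 4) div 4 = t div 4 + 1" by simp
  ultimately show ?thesis by (auto simp: t g4_def)
qed

lemma ub4: "ub 4 g4"
proof (rule ub_step)
  show "g4 0 = 0" by (simp add: g4_def)
  fix n F
  assume n: "3 \<le> n" and F: "F \<subseteq> dgs n" and l: "lcr 4 F"
    and IH: "\<And>L R. L < R \<Longrightarrow> R - L + 1 < n \<Longrightarrow> wt (lift n F) L R \<le> g4 (nat (R - L - 1))"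
  show "card F + 1 \<le> g4 (nat (n - 2))"
  proof (cases "no3F F")
    case True
    note b = no3_bound[OF n F l True]
    define s where "s = nat (n - 2)"
    have s: "int s = n - 2" "1 \<le> s" using n by (simp_all add: s_def)
    show ?thesis
    \<comment> \<open>For the quadrilateral \<open>no3_bound\<close> still allows 3 edges, so its
      two diagonals are counted directly.\<close>
    proof (cases "s = 2")
      case True
      hence "n = 4" using s by simp
      hence "card F \<le> length [(0::int, 2::int), (1, 3)]" using F dgs_4 by (intro card_set_le) blast
      hence "card F \<le> 2" by simp
      moreover have "g4 (nat (n - 2)) = 3" using True by (simp add: g4_def s_def)
      ultimately show ?thesis by simp
    next
      case False
      have "2 * card F + 4 \<le> 5 * s + (if s = 5 then 1 else 0)"
      proof -
        have q: "(n = 7) = (s = 5)" using s by auto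
        have "2 * int (card F) \<le> 5 * int s - 4 + of_bool (s = 5)" using b unfolding s(1)[symmetric] q .
        thus ?thesis by (cases "s = 5") simp_all
      qed
      moreover have "s = 1 \<or> 3 \<le> s" using s False by linarith
      ultimately have "card F + 1 \<le> g4 s"
      proof (elim disjE)
        assume "3 \<le> s" and b: "2 * card F + 4 \<le> 5 * s + (if s = 5 then 1 else 0)"
        hence g: "g4 s = 2 * s + 2 * (s div 4)" by (simp add: g4_def)
        show ?thesis
        proof (cases "s = 5")
          case True thus ?thesis using b g by simp
        next
          case False
          hence "2 * card F + 4 \<le> 5 * s" using b by simp
          moreover have "4 * (s div 4) + s mod 4 = s" by simp
          moreover note nat_mod4[of s]
          \<comment> \<open>Here 5s - 2 = 4s + 4 (s div 4) + (s mod 4) - 2, and the last two terms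
            contribute at most 1. This 1 disappears because everything else is even.\<close>
          ultimately have "2 * card F + 2 \<le> 4 * s + 4 * (s div 4) + 1" by linarith
          thus ?thesis unfolding g by linarith
        qed
      qed (simp add: g4_def)
      thus ?thesis by (simp add: s_def)
    qed
  next
    case False
    then obtain p1 p2 p3 q1 q2 q3 where o: "p1 < p2" "p2 < p3" "p3 < q1" "q1 < q2" "q2 < q3"
      and e: "(p1, q1) \<in> F" "(p2, q2) \<in> F" "(p3, q3) \<in> F" unfolding no3F_def by blast
    interpret cyc n "lift n F" by (rule lift_cyc[OF n F])
    interpret cycg n "lift n F" 4 g4
    proof
      show "\<And>u v. u < v \<Longrightarrow> v < u + n \<Longrightarrow> lift n F u v \<Longrightarrow> card (crset n (lift n F) u v) \<le> 4"
        by (rule lift_cr[OF n F l])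
      show "\<And>L R. L < R \<Longrightarrow> R - L + 1 < n \<Longrightarrow> wt (lift n F) L R \<le> g4 (nat (R - L - 1))" by (rule IH)
      show "\<And>x y. g4 x + g4 y \<le> g4 (x + y)" by (rule g4_add)
    qed
    have "(p1, q1) \<in> dgs n" "(p3, q3) \<in> dgs n" using e F by blast+
    hence b: "0 \<le> p1" "q3 < n" by (simp_all add: dgs_def)
    have E: "lift n F p1 q1" "lift n F p2 q2" "lift n F p3 q3" using lift_in[OF F] e by blast+
    have "tot p1 q1 + 2 \<le> g4 (nat (n - 2) - 4) + 3 * 4"
      by (rule cut_disj1(2)[of p1 p2 p3 q1 q2 q3]) (use o b E in simp_all)
    moreover have "card F + 1 \<le> tot p1 q1" by (rule edge_tot[OF n F _ _ E(1)]) (use o b in simp_all)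
    moreover have "4 \<le> nat (n - 2)" using o b by linarith
    ultimately show ?thesis using g4_step[of "nat (n - 2)"] by linarith
  qed
qed

section \<open>Gluing polygons\<close>

definition att :: "nat \<Rightarrow> int \<Rightarrow> nat \<Rightarrow> bool" where
  "att l n m \<longleftrightarrow> (\<exists>F. F \<subseteq> dgs n \<and> lcr l F \<and> card F = m)"

lemma att_list:
  assumes "distinct xs" "set xs \<subseteq> dgs n" "\<forall>e\<in>set xs. length (filter (crs e) xs) \<le> l" "length xs = m"
  shows "att l n m"
proof -
  have "card {f \<in> set xs. crs e f} \<le> length (filter (crs e) xs)" for e
    using card_length[of "filter (crs e) xs"] by simp
  hence "lcr l (set xs)" using assms(3) unfolding lcr_def by (meson order_trans)
  thus ?thesis using assms distinct_card[OF assms(1)] by (auto simp: att_def)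
qed

lemma lcr_Un:
  assumes "lcr l A" "lcr l B" "finite A" "finite B"
    and no: "\<And>e f. e \<in> A \<Longrightarrow> f \<in> B \<Longrightarrow> \<not> crs e f"
  shows "lcr l (A \<union> B)"
proof -
  have no': "\<not> crs f e" if "e \<in> A" "f \<in> B" for e f using no[OF that] by (auto simp: crs_def)
  have "{f \<in> A \<union> B. crs e f} = {f \<in> A. crs e f}" if "e \<in> A" for e using no that by blast
  moreover have "{f \<in> A \<union> B. crs e f} = {f \<in> B. crs e f}" if "e \<in> B" for e using no' that by blast
  ultimately show ?thesis using assms(1,2) unfolding lcr_def by auto
qed

lemma lcr_image:
  assumes "lcr l A" "finite A" and h: "\<And>e f. e \<in> A \<Longrightarrow> f \<in> A \<Longrightarrow> crs (h e) (h f) \<Longrightarrow> crs e f"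
  shows "lcr l (h ` A)"
  unfolding lcr_def
proof
  fix e assume "e \<in> h ` A"
  then obtain e' where e: "e' \<in> A" "e = h e'" by blast
  have "{f \<in> h ` A. crs e f} \<subseteq> h ` {f \<in> A. crs e' f}" using h e by blast
  hence "card {f \<in> h ` A. crs e f} \<le> card {f \<in> A. crs e' f}"
    using assms(2) by (intro surj_card_le) simp_all
  thus "card {f \<in> h ` A. crs e f} \<le> l" using assms(1) e(1) unfolding lcr_def by fastforce
qed

text \<open>The polygon with vertices \<open>d, \<dots>, n + d - 1\<close> and the one with vertices \<open>0, \<dots>, d, n + d - 1\<close> are glued along a common side.\<close>

lemma att_glue:
  assumes "att l n m" "att l (d + 2) k" "3 \<le> n" "1 \<le> d"
  shows "att l (n + d) (m + 1 + k)"
proof -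
  obtain F where F: "F \<subseteq> dgs n" "lcr l F" "card F = m" using assms(1) by (auto simp: att_def)
  obtain D where D: "D \<subseteq> dgs (d + 2)" "lcr l D" "card D = k" using assms(2) by (auto simp: att_def)
  have fin: "finite F" "finite D" using F(1) D(1) finite_dgs finite_subset by blast+
  let ?s = "\<lambda>(u, v). (u + d, v + d)" and ?h = "\<lambda>(u, v). (u, if v \<le> d then v else n + d - 1)"
  have Db: "0 \<le> u \<and> u + 2 \<le> v \<and> v \<le> d + 1 \<and> \<not> (u = 0 \<and> v = d + 1)" if "(u, v) \<in> D" for u v
  proof -
    have "(u, v) \<in> dgs (d + 2)" using that D(1) by blast
    thus ?thesis by (auto simp: dgs_def)
  qed
  have Fb: "0 \<le> u \<and> u + 2 \<le> v \<and> v \<le> n - 1 \<and> \<not> (u = 0 \<and> v = n - 1)" if "(u, v) \<in> F" for u v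
  proof -
    have "(u, v) \<in> dgs n" using that F(1) by blast
    thus ?thesis by (simp add: dgs_def)
  qed
  \<comment> \<open>\<open>?B\<close> is the common side, which becomes a diagonal of the glued
    polygon and accounts for the summand 1.\<close>
  let ?A = "?s ` F" and ?B = "{(d, n + d - 1)}" and ?C = "?h ` D"
  have A: "d \<le> u \<and> u + 2 \<le> v \<and> v \<le> n + d - 1 \<and> \<not> (u = d \<and> v = n + d - 1)" if a: "(u, v) \<in> ?A" for u v
  proof -
    obtain u' v' where "(u', v') \<in> F" "u = u' + d" "v = v' + d" using a by auto
    thus ?thesis using Fb[of u' v'] by auto
  qed
  have C: "0 \<le> u \<and> u \<le> d - 1 \<and> u + 2 \<le> v \<and> (v \<le> d \<or> v = n + d - 1) \<and> \<not> (u = 0 \<and> v = n + d - 1)" if a: "(u, v) \<in> ?C" for u v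
  proof -
    obtain u' v' where "(u', v') \<in> D" "u = u'" "v = (if v' \<le> d then v' else n + d - 1)" using a by auto
    thus ?thesis using Db[of u' v'] assms(3) by (auto split: if_splits)
  qed
  have lA: "lcr l ?A"
    by (rule lcr_image[OF F(2) fin(1)]) (auto simp: crs_def)
  have lC: "lcr l ?C"
  proof (rule lcr_image[OF D(2) fin(2)])
    fix e f assume ef: "e \<in> D" "f \<in> D" "crs (?h e) (?h f)"
    obtain u v x y where e: "e = (u, v)" "f = (x, y)" by (cases e; cases f)
    have b: "u + 2 \<le> v \<and> v \<le> d + 1" "x + 2 \<le> y \<and> y \<le> d + 1" using Db[of u v] Db[of x y] ef e by auto
    have "crs (u, if v \<le> d then v else n + d - 1) (x, if y \<le> d then y else n + d - 1)" using ef(3) e by simp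
    thus "crs e f" using b assms(3) by (cases "v \<le> d"; cases "y \<le> d") (auto simp: crs_def e)
  qed
  have lB: "lcr l ?B"
  proof -
    have "card {f \<in> ?B. crs e f} \<le> l" if "e \<in> ?B" for e
    proof -
      have "{f \<in> ?B. crs e f} = {}" using that by (auto simp: crs_def)
      thus ?thesis by (simp only: card.empty)
    qed
    thus ?thesis unfolding lcr_def by blast
  qed
  have AB: "\<not> crs e f" if ef: "e \<in> ?A" "f \<in> ?B" for e f
  proof -
    obtain u v where "e = (u, v)" by (cases e)
    thus ?thesis using A[of u v] ef by (auto simp: crs_def)
  qed
  have AC: "\<not> crs e f \<and> e \<noteq> f" if ef: "e \<in> ?A \<union> ?B" "f \<in> ?C" for e f
  proof -
    obtain u v x y where e: "e = (u, v)" "f = (x, y)" by (cases e; cases f)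
    have "(u, v) \<in> ?A \<or> u = d \<and> v = n + d - 1" using ef(1) unfolding e Un_iff singleton_iff prod.inject .
    hence "d \<le> u \<and> v \<le> n + d - 1 \<and> u < v"
    proof
      assume "(u, v) \<in> ?A"
      from A[OF this] show ?thesis by simp
    qed (use assms(3) in simp)
    moreover have "x \<le> d - 1 \<and> (y \<le> d \<or> y = n + d - 1)" using C[of x y] ef(2)[unfolded e] by blast
    ultimately show ?thesis by (auto simp: crs_def e)
  qed
  have finA: "finite ?A" and finC: "finite ?C" using fin by simp_all
  have lAB: "lcr l (?A \<union> ?B)" by (rule lcr_Un[OF lA lB finA _ AB]) simp_all
  have l: "lcr l ((?A \<union> ?B) \<union> ?C)"
    by (rule lcr_Un[OF lAB lC _ finC]) (use finA AC in blast)+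
  have "p \<in> dgs (n + d)" if p: "p \<in> (?A \<union> ?B) \<union> ?C" for p
  proof -
    obtain u v where uv: "p = (u, v)" by (cases p)
    consider "(u, v) \<in> ?A" | "(u, v) \<in> ?B" | "(u, v) \<in> ?C" using p[unfolded uv Un_iff] by blast
    thus ?thesis
    proof cases
      case 1 thus ?thesis using A[of u v] assms(4) uv by (simp add: dgs_def)
    next
      case 2 thus ?thesis using assms(3,4) uv by (simp add: dgs_def)
    next
      case 3 thus ?thesis using C[of u v] assms(3) uv by (auto simp: dgs_def)
    qed
  qed
  hence sub: "(?A \<union> ?B) \<union> ?C \<subseteq> dgs (n + d)" by blast
  have cA: "card ?A = m" using F(3) by (subst card_image) (auto simp: inj_on_def)
  have "inj_on ?h D"
  proof (rule inj_onI)
    fix e f assume ef: "e \<in> D" "f \<in> D" "?h e = ?h f"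
    obtain u v x y where e: "e = (u, v)" "f = (x, y)" by (cases e; cases f)
    have b: "v \<le> d + 1" "y \<le> d + 1" using Db[of u v] Db[of x y] ef e by auto
    thus "e = f" using ef(3) e assms(3) by (auto split: if_splits)
  qed
  hence cC: "card ?C = k" using D(3) by (simp add: card_image)
  have "(d, n + d - 1) \<notin> ?A" using A[of d "n + d - 1"] by blast
  hence cAB: "card (?A \<union> ?B) = m + 1" using cA finA by simp
  have "(?A \<union> ?B) \<inter> ?C = {}" using AC by blast
  hence "card ((?A \<union> ?B) \<union> ?C) = m + 1 + k"
    using card_Un_disjoint[OF _ finC, of "?A \<union> ?B"] finA cAB cC by (simp only: finite_Un finite.intros simp_thms)
  thus ?thesis using l sub unfolding att_def by blast
qed

text \<open>Up to the hexagon all diagonals are taken, except that for \<open>l = 3\<close> the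
  hexagon omits a long one. For \<open>l = 4\<close> the heptagon and the octagon are new pieces:
  gluing smaller ones gives at most 10 and 12 edges.\<close>

lemma att_steps:
  "att 0 3 0" "att 1 3 0" "att 1 4 2" "att 2 3 0" "att 2 4 2" "att 2 5 5"
  "att 3 3 0" "att 3 4 2" "att 3 5 5" "att 3 6 8" "att 4 3 0" "att 4 4 2" "att 4 5 5" "att 4 6 9"
  "att 4 7 11" "att 4 8 13"
proof -
  have e: "att l 3 0" for l by (rule att_list[of "[]"]) simp_all
  show "att 0 3 0" "att 1 3 0" "att 2 3 0" "att 3 3 0" "att 4 3 0" by (rule e)+
  have "att l 4 2" if "1 \<le> l" for l
    by (rule att_list[of "[(0, 2), (1, 3)]"]) (use that in \<open>simp_all add: dgs_def crs_def\<close>)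
  thus "att 1 4 2" "att 2 4 2" "att 3 4 2" "att 4 4 2" by simp_all
  have "att l 5 5" if "2 \<le> l" for l
    by (rule att_list[of "[(0, 2), (0, 3), (1, 3), (1, 4), (2, 4)]"]) (use that in \<open>simp_all add: dgs_def crs_def\<close>)
  thus "att 2 5 5" "att 3 5 5" "att 4 5 5" by simp_all
  show "att 3 6 8"
    by (rule att_list[of "[(0, 2), (0, 4), (1, 3), (1, 4), (1, 5), (2, 4), (2, 5), (3, 5)]"]) (simp_all add: dgs_def crs_def)
  show "att 4 6 9"
    by (rule att_list[of "[(0, 2), (0, 3), (0, 4), (1, 3), (1, 4), (1, 5), (2, 4), (2, 5), (3, 5)]"])
      (simp_all add: dgs_def crs_def)
  show "att 4 7 11"
    by (rule att_list[of "[(0, 2), (0, 3), (0, 4), (0, 5), (1, 3), (1, 4), (1, 5), (1, 6), (2, 4), (3, 5), (4, 6)]"])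
      (simp_all add: dgs_def crs_def)
  show "att 4 8 13"
    by (rule att_list[of "[(0, 2), (0, 3), (0, 4), (0, 6), (1, 3), (1, 4), (1, 6), (1, 7), (2, 4), (3, 5), (3, 6), (4, 6), (5, 7)]"])
      (simp_all add: dgs_def crs_def)
qed

lemma att_induct:
  assumes d: "1 \<le> d" and b: "\<And>s. base \<le> s \<Longrightarrow> s < base + d \<Longrightarrow> att l (int s + 2) (g s - 1)"
    and p: "att l (int d + 2) k" and base: "1 \<le> base" and pos: "\<And>s. base \<le> s \<Longrightarrow> 1 \<le> g s"
    and step: "\<And>s. base + d \<le> s \<Longrightarrow> g (s - d) + k + 1 = g s" and s: "base \<le> s"
  shows "att l (int s + 2) (g s - 1)"
  using s
proof (induction s rule: less_induct)
  case (less s)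
  show ?case
  proof (cases "s < base + d")
    case True
    thus ?thesis using b less.prems by blast
  next
    case False
    have "att l (int (s - d) + 2) (g (s - d) - 1)" by (rule less.IH) (use False d in linarith)+
    hence "att l (int (s - d) + 2 + int d) (g (s - d) - 1 + 1 + k)"
      by (rule att_glue[OF _ p]) (use False d base in linarith)+
    moreover have "int (s - d) + 2 + int d = int s + 2" using False by simp
    moreover have "g (s - d) - 1 + 1 + k = g s - 1" using step[of s] pos[of "s - d"] False by fastforce
    ultimately show ?thesis by simp
  qed
qed

lemma g_ge: "s \<le> g2 s" "s \<le> g3 s"
proof -
  have "s \<le> g1 s" by (simp add: g1_def)
  thus "s \<le> g2 s" "s \<le> g3 s" using g1_le_g2[of s] g2_le_g3[of s] by linarith+
qed

lemma att0:
  assumes "1 \<le> s"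
  shows "att 0 (int s + 2) (s - 1)"
proof (rule att_induct[where d = 1 and base = 1 and k = 0 and g = "\<lambda>s. s" and l = 0])
  fix s :: nat assume "1 \<le> s" "s < 1 + 1"
  hence "s = 1" by simp
  thus "att 0 (int s + 2) (s - 1)" using att_steps(1) by simp
qed (use assms att_steps(1) in simp_all)

lemma att1:
  assumes "1 \<le> s"
  shows "att 1 (int s + 2) (g1 s - 1)"
proof (rule att_induct[where d = 2 and base = 1 and k = 2 and g = "g1" and l = 1])
  fix s :: nat assume "1 \<le> s" "s < 1 + 2"
  hence "s = 1 \<or> s = 2" by linarith
  thus "att 1 (int s + 2) (g1 s - 1)" using att_steps(2,3) by (auto simp: g1_def)
next
  fix s :: nat assume "1 + 2 \<le> s"
  thus "g1 (s - 2) + 2 + 1 = g1 s" using g1_step[of s] by simp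
qed (use assms att_steps(3) in \<open>simp_all add: g1_def\<close>)

lemma att2:
  assumes "1 \<le> s"
  shows "att 2 (int s + 2) (g2 s - 1)"
proof (rule att_induct[where d = 3 and base = 1 and k = 5 and g = "g2" and l = 2])
  fix s :: nat assume "1 \<le> s" "s < 1 + 3"
  hence "s = 1 \<or> s = 2 \<or> s = 3" by linarith
  thus "att 2 (int s + 2) (g2 s - 1)" using att_steps(4,5,6) by (auto simp: g2_def)
next
  fix s :: nat assume "1 + 3 \<le> s"
  thus "g2 (s - 3) + 5 + 1 = g2 s" using g2_step3[of s] by simp
next
  fix s :: nat assume "1 \<le> s"
  thus "1 \<le> g2 s" using g_ge[of s] by linarith
qed (use assms att_steps(6) in simp_all)

lemma att3:
  assumes "1 \<le> s"
  shows "att 3 (int s + 2) (g3 s - 1)"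
proof (rule att_induct[where d = 4 and base = 1 and k = 8 and g = "g3" and l = 3])
  fix s :: nat assume "1 \<le> s" "s < 1 + 4"
  hence "s = 1 \<or> s = 2 \<or> s = 3 \<or> s = 4" by linarith
  thus "att 3 (int s + 2) (g3 s - 1)" using att_steps(7,8,9,10) by (auto simp: g3_def)
next
  fix s :: nat assume "1 + 4 \<le> s"
  thus "g3 (s - 4) + 8 + 1 = g3 s" using g3_step[of s] by simp
next
  fix s :: nat assume "1 \<le> s"
  thus "1 \<le> g3 s" using g_ge[of s] by linarith
qed (use assms att_steps(10) in simp_all)

lemma att4: "1 \<le> s \<Longrightarrow> att 4 (int s + 2) (g4 s - 1)"
proof -
  have "att 4 (int s + 2) (g4 s - 1)" if "3 \<le> s"
  \<comment> \<open>The recursion cannot start below 3: \<open>g4 5\<close> and \<open>g4 6\<close>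
    exceed \<open>g4 1\<close> and \<open>g4 2\<close> by 11, while gluing a hexagon adds
    10.\<close>
  proof (rule att_induct[where d = 4 and base = 3 and k = 9 and g = g4 and l = 4])
    fix s :: nat assume "3 \<le> s" "s < 3 + 4"
    hence "s = 3 \<or> s = 4 \<or> s = 5 \<or> s = 6" by linarith
    thus "att 4 (int s + 2) (g4 s - 1)" using att_steps(13-16) by (auto simp: g4_def)
  next
    fix s :: nat assume s: "3 + 4 \<le> s"
    then obtain t where t: "s = t + 4" using le_Suc_ex by (metis add.commute add_leD2)
    have "(t + 4) div 4 = t div 4 + 1" by simp
    thus "g4 (s - 4) + 9 + 1 = g4 s" using s by (simp add: t g4_def)
  qed (use that att_steps(14) in \<open>simp_all add: g4_def\<close>)
  moreover assume "1 \<le> s"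
  moreover have "att 4 (int s + 2) (g4 s - 1)" if "s = 1 \<or> s = 2" using that att_steps(11,12) by (auto simp: g4_def)
  ultimately show ?thesis by linarith
qed

section \<open>Convex polygons\<close>

text \<open>Twice the signed area of the triangle \<open>pqr\<close>.\<close>

definition orient :: "real^2 \<Rightarrow> real^2 \<Rightarrow> real^2 \<Rightarrow> real" where
  "orient p q r = (q$1 - p$1) * (r$2 - p$2) - (q$2 - p$2) * (r$1 - p$1)"

lemma orient_cycle: "orient p q r = orient q r p"
  by (simp add: orient_def algebra_simps)

lemma orient_swap: "orient p q r = - orient p r q"
  by (simp add: orient_def algebra_simps)

lemma orient_same [simp]: "orient p p q = 0" "orient p q p = 0" "orient q p p = 0"
  by (simp_all add: orient_def)

lemma orient_sum: "orient p q r = orient w p q + orient w q r - orient w p r"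
  by (simp add: orient_def algebra_simps)

text \<open>Barycentric coordinates of \<open>p\<close> as ratios of areas, with denominators
  cleared.\<close>

lemma orient_bary:
  "orient b c p *\<^sub>R a + orient c a p *\<^sub>R b + orient a b p *\<^sub>R c = orient a b c *\<^sub>R p"
  by (simp add: vec_eq_iff forall_2 orient_def algebra_simps)

lemma orient_affine:
  assumes "s + t = 1"
  shows "orient p q (s *\<^sub>R x + t *\<^sub>R y) = s * orient p q x + t * orient p q y"
proof -
  have s: "s = 1 - t" using assms by simp
  show ?thesis unfolding s by (simp add: orient_def algebra_simps)
qed

lemma in_triangle:
  assumes "0 \<le> orient b c p" "0 \<le> orient c a p" "0 \<le> orient a b p" "0 < orient a b c"
  shows "p \<in> convex hull {a, b, c}"
proof -
  let ?d = "orient a b c"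
  have "orient b c p + orient c a p + orient a b p = ?d" by (simp add: orient_def algebra_simps)
  hence 1: "orient b c p / ?d + orient c a p / ?d + orient a b p / ?d = 1"
    using assms(4) by (simp add: add_divide_distrib[symmetric])
  have "(1 / ?d) *\<^sub>R (orient b c p *\<^sub>R a + orient c a p *\<^sub>R b + orient a b p *\<^sub>R c) = (1 / ?d) *\<^sub>R (?d *\<^sub>R p)"
    by (simp only: orient_bary)
  hence "p = (orient b c p / ?d) *\<^sub>R a + (orient c a p / ?d) *\<^sub>R b + (orient a b p / ?d) *\<^sub>R c"
    using assms(4) by (simp add: scaleR_add_right)
  moreover have "0 \<le> orient b c p / ?d" "0 \<le> orient c a p / ?d" "0 \<le> orient a b p / ?d" using assms by simp_all
  ultimately show ?thesis using 1 unfolding convex_hull_3 by blast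
qed

lemma orient_0_between:
  assumes "orient p q r = 0"
  shows "p \<in> closed_segment q r \<or> q \<in> closed_segment p r \<or> r \<in> closed_segment p q"
proof -
  have "collinear {p, q, r}"
  proof (cases "q = p")
    case True thus ?thesis by simp
  next
    case False
    have e: "(q$1 - p$1) * (r$2 - p$2) = (q$2 - p$2) * (r$1 - p$1)" using assms by (simp add: orient_def)
    have "\<exists>c. r - p = c *\<^sub>R (q - p)"
    proof (cases "q$1 = p$1")
      case True
      hence n: "q$2 - p$2 \<noteq> 0" using False by (auto simp: vec_eq_iff forall_2)
      hence "r$1 = p$1" using e True by simp
      hence "r - p = ((r$2 - p$2) / (q$2 - p$2)) *\<^sub>R (q - p)" using n True by (simp add: vec_eq_iff forall_2)
      thus ?thesis by blast
    next
      case False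
      hence n: "q$1 - p$1 \<noteq> 0" by simp
      have "(r$1 - p$1) / (q$1 - p$1) * (q$2 - p$2) = r$2 - p$2" using e n by (simp add: field_simps)
      hence "r - p = ((r$1 - p$1) / (q$1 - p$1)) *\<^sub>R (q - p)" using n by (simp add: vec_eq_iff forall_2)
      thus ?thesis by blast
    qed
    then obtain c where c: "r - p = c *\<^sub>R (q - p)" by blast
    hence "collinear {0, q - p, r - p}" by (auto simp: collinear_lemma)
    hence "collinear {q, p, r}" by (metis collinear_3 collinear_3_trans NO_MATCH_def)
    thus ?thesis by (simp add: insert_commute)
  qed
  thus ?thesis unfolding collinear_between_cases between_mem_segment by (auto simp: closed_segment_commute)
qed

text \<open>The number of predecessors is strictly monotone, hence injective, and takes exactly the
  values below \<open>card A\<close>; \<open>v\<close> is its inverse.\<close>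

lemma rank_bij:
  assumes fin: "finite A" and irr: "\<And>p. p \<in> A \<Longrightarrow> \<not> R p p"
    and tr: "\<And>p q r. p \<in> A \<Longrightarrow> q \<in> A \<Longrightarrow> r \<in> A \<Longrightarrow> R p q \<Longrightarrow> R q r \<Longrightarrow> R p r"
    and tot: "\<And>p q. p \<in> A \<Longrightarrow> q \<in> A \<Longrightarrow> p \<noteq> q \<Longrightarrow> R p q \<or> R q p"
  shows "\<exists>v. bij_betw v {0..<int (card A)} A \<and> (\<forall>i j. 0 \<le> i \<longrightarrow> i < j \<longrightarrow> j < int (card A) \<longrightarrow> R (v i) (v j))"
proof -
  define k where "k = (\<lambda>q. int (card {p \<in> A. R p q}))"
  have mono: "k p < k q" if "p \<in> A" "q \<in> A" "R p q" for p q
  proof -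
    have "{x \<in> A. R x p} \<subset> {x \<in> A. R x q}" using that tr irr by blast
    thus ?thesis unfolding k_def using fin by (simp add: psubset_card_mono)
  qed
  have inj: "inj_on k A" by (rule inj_onI) (metis mono tot less_irrefl)
  have rng: "k ` A \<subseteq> {0..<int (card A)}"
  proof clarify
    fix q assume q: "q \<in> A"
    hence "{p \<in> A. R p q} \<subset> A" using irr by blast
    hence "card {p \<in> A. R p q} < card A" using fin by (rule psubset_card_mono[rotated])
    thus "k q \<in> {0..<int (card A)}" by (simp add: k_def)
  qed
  have "card (k ` A) = card A" using inj by (rule card_image)
  hence "k ` A = {0..<int (card A)}" by (intro card_seteq[OF _ rng]) simp_all
  hence bij: "bij_betw k A {0..<int (card A)}" using inj by (simp add: bij_betw_def)
  define v where "v = inv_into A k"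
  have v: "bij_betw v {0..<int (card A)} A" unfolding v_def by (rule bij_betw_inv_into[OF bij])
  have kv: "k (v i) = i" if "0 \<le> i" "i < int (card A)" for i
    unfolding v_def using bij_betw_inv_into_right[OF bij] that by simp
  have "R (v i) (v j)" if ij: "0 \<le> i" "i < j" "j < int (card A)" for i j
  proof -
    have A: "v i \<in> A" "v j \<in> A" using v ij by (auto simp: bij_betw_def)
    have kk: "k (v i) = i" "k (v j) = j" using kv ij by simp_all
    hence "v i \<noteq> v j" using ij by auto
    moreover have "\<not> R (v j) (v i)" using mono[OF A(2,1)] kk ij by auto
    ultimately show ?thesis using tot[OF A] by blast
  qed
  thus ?thesis using v by blast
qed

lemma extreme_not_in_hull:
  assumes "convex P" "p extreme_point_of P" "T \<subseteq> P" "p \<in> convex hull T"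
  shows "p \<in> T"
proof -
  have "convex hull T \<subseteq> P" using assms(1,3) by (simp add: hull_minimal)
  hence "p extreme_point_of (convex hull T)" using assms(2,4) by (auto simp: extreme_point_of_def)
  thus ?thesis by (rule extreme_point_of_convex_hull)
qed

text \<open>The vertices are sorted by angle around a fixed vertex \<open>w\<close>. One fact
  settles both transitivity and the orientation of triples: no vertex lies in a triangle spanned by
  three others. Otherwise \<open>w\<close> would lie in the triangle \<open>pqr\<close>, or
  \<open>v j\<close> in the triangle of \<open>w\<close>, \<open>v i\<close> and
  \<open>v k\<close>.\<close>

lemma ordered_vertices:
  assumes "convex_ngon n P" "3 \<le> n"
  shows "\<exists>v. bij_betw v {0..<int n} (polygon_vertices P) \<and>
    (\<forall>i j k. 0 \<le> i \<longrightarrow> i < j \<longrightarrow> j < k \<longrightarrow> k < int n \<longrightarrow> 0 < orient (v i) (v j) (v k))"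
proof -
  let ?V = "polygon_vertices P"
  have cP: "convex P" using assms(1) by (simp add: convex_ngon_def polytope_imp_convex)
  have cn: "card ?V = n" using assms(1) by (simp add: convex_ngon_def)
  have fV: "finite ?V" using cn assms(2) by (metis card.infinite not_numeral_le_zero)
  have VP: "?V \<subseteq> P" by (auto simp: polygon_vertices_def extreme_point_of_def)
  have ext: "p \<in> T" if "p \<in> ?V" "T \<subseteq> ?V" "p \<in> convex hull T" for p T
    using extreme_not_in_hull[OF cP _ _ that(3)] that(1,2) VP by (auto simp: polygon_vertices_def)
  have seg: "p \<notin> closed_segment q r" if "p \<in> ?V" "q \<in> ?V" "r \<in> ?V" "p \<noteq> q" "p \<noteq> r" for p q r
    using ext[of p "{q, r}"] that by (auto simp: segment_convex_hull)
  have nz: "orient p q r \<noteq> 0" if "p \<in> ?V" "q \<in> ?V" "r \<in> ?V" "p \<noteq> q" "p \<noteq> r" "q \<noteq> r" for p q r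
    using orient_0_between[of p q r] seg[of p q r] seg[of q p r] seg[of r p q] that by blast
  have tri: False if "p \<in> ?V" "a \<in> ?V" "b \<in> ?V" "c \<in> ?V" "p \<noteq> a" "p \<noteq> b" "p \<noteq> c"
      "0 \<le> orient b c p" "0 \<le> orient c a p" "0 \<le> orient a b p" "0 < orient a b c" for p a b c
    using ext[of p "{a, b, c}"] in_triangle[OF that(8-11)] that(1-7) by blast
  obtain w where w: "w \<in> ?V" using cn assms(2) by fastforce
  define R where "R = (\<lambda>p q. p \<noteq> q \<and> q \<noteq> w \<and> (p = w \<or> 0 < orient w p q))"
  have "bij_betw v {0..<int n} ?V \<Longrightarrow> (\<And>i j. 0 \<le> i \<Longrightarrow> i < j \<Longrightarrow> j < int n \<Longrightarrow> R (v i) (v j)) \<Longrightarrow> ?thesis" for v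
  proof -
    assume v: "bij_betw v {0..<int n} ?V" and R: "\<And>i j. 0 \<le> i \<Longrightarrow> i < j \<Longrightarrow> j < int n \<Longrightarrow> R (v i) (v j)"
    have vV: "v i \<in> ?V" if "0 \<le> i" "i < int n" for i using v that by (auto simp: bij_betw_def)
    have "0 < orient (v i) (v j) (v k)" if o: "0 \<le> i" "i < j" "j < k" "k < int n" for i j k
    proof -
      have ij: "R (v i) (v j)" and jk: "R (v j) (v k)" and ik: "R (v i) (v k)" using R o by simp_all
      show ?thesis
      proof (cases "v i = w")
        case True
        thus ?thesis using ij jk by (auto simp: R_def)
      next
        case False
        hence p: "0 < orient w (v i) (v j)" "0 < orient w (v j) (v k)" "0 < orient w (v i) (v k)"
          and d: "v i \<noteq> v j" "v j \<noteq> v k" "v i \<noteq> v k" "v j \<noteq> w" using ij jk ik by (auto simp: R_def)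
        have V: "v i \<in> ?V" "v j \<in> ?V" "v k \<in> ?V" using vV o by simp_all
        have "orient (v i) (v j) (v k) \<noteq> 0" using nz V d by blast
        moreover have False if neg: "orient (v i) (v j) (v k) < 0"
        proof (rule tri[of "v j" w "v i" "v k"])
          show "0 \<le> orient (v i) (v k) (v j)" using neg orient_swap[of "v i" "v k" "v j"] by simp
          show "0 \<le> orient (v k) w (v j)" using p(2) orient_cycle[of w "v j" "v k"] orient_cycle[of "v k" w "v j"] by simp
          show "0 \<le> orient w (v i) (v j)" "0 < orient w (v i) (v k)" using p by simp_all
        qed (use V d w in simp_all)
        ultimately show ?thesis by (meson linorder_neqE)
      qed
    qed
    thus ?thesis using v by blast
  qed
  moreover have "\<exists>v. bij_betw v {0..<int (card ?V)} ?V \<and> (\<forall>i j. 0 \<le> i \<longrightarrow> i < j \<longrightarrow> j < int (card ?V) \<longrightarrow> R (v i) (v j))"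
  proof (rule rank_bij[of ?V R])
    show "finite ?V" by fact
    show "\<not> R p p" for p by (simp add: R_def)
    show "R p q \<or> R q p" if "p \<in> ?V" "q \<in> ?V" "p \<noteq> q" for p q
    proof (cases "p = w \<or> q = w")
      case True thus ?thesis using that by (auto simp: R_def)
    next
      case False
      hence "orient w p q \<noteq> 0" using nz that w by blast
      thus ?thesis using False that orient_swap[of w p q] by (auto simp: R_def)
    qed
    show "R p r" if V: "p \<in> ?V" "q \<in> ?V" "r \<in> ?V" and pq: "R p q" and qr: "R q r" for p q r
    proof (cases "p = w")
      case True thus ?thesis using pq qr by (auto simp: R_def)
    next
      case False
      hence o: "0 < orient w p q" "0 < orient w q r" "p \<noteq> q" "q \<noteq> r" "q \<noteq> w" "r \<noteq> w"
        using pq qr by (auto simp: R_def)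
      have pr: "p \<noteq> r" using o orient_swap[of w p q] by auto
      have "orient w p r \<noteq> 0" using nz[OF w V(1,3)] False pr o by blast
      moreover have False if neg: "orient w p r < 0"
      proof (rule tri[of w p q r])
        show "0 \<le> orient q r w" "0 \<le> orient p q w" using o orient_cycle[of w q r] orient_cycle[of w p q] by simp_all
        show "0 \<le> orient r p w" using neg orient_swap[of w p r] orient_cycle[of w r p] by simp
        show "0 < orient p q r" using orient_sum[of p q r w] o neg by simp
      qed (use V w False o in auto)
      ultimately have "0 < orient w p r" by (meson linorder_neqE)
      thus ?thesis using pr o by (simp add: R_def)
    qed
  qed
  then obtain v where "bij_betw v {0..<int (card ?V)} ?V"
    "\<forall>i j. 0 \<le> i \<longrightarrow> i < j \<longrightarrow> j < int (card ?V) \<longrightarrow> R (v i) (v j)" by blast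
  ultimately show ?thesis using cn by simp
qed

section \<open>Crossings and sides in terms of vertex indices\<close>

locale ngon =
  fixes n :: int and P :: "(real^2) set" and v :: "int \<Rightarrow> real^2"
  assumes n3: "3 \<le> n" and poly: "polytope P"
    and bij: "bij_betw v {0..<n} (polygon_vertices P)"
    and ori: "\<And>i j k. 0 \<le> i \<Longrightarrow> i < j \<Longrightarrow> j < k \<Longrightarrow> k < n \<Longrightarrow> 0 < orient (v i) (v j) (v k)"
begin

lemma v_inj: "0 \<le> i \<Longrightarrow> i < n \<Longrightarrow> 0 \<le> j \<Longrightarrow> j < n \<Longrightarrow> v i = v j \<longleftrightarrow> i = j"
  using bij by (auto simp: bij_betw_def inj_on_def)

lemma v_vert: "0 \<le> i \<Longrightarrow> i < n \<Longrightarrow> v i extreme_point_of P"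
  using bij by (auto simp: bij_betw_def polygon_vertices_def)

lemma vertE: "p extreme_point_of P \<Longrightarrow> \<exists>i. 0 \<le> i \<and> i < n \<and> p = v i"
  using bij unfolding bij_betw_def polygon_vertices_def by (metis (mono_tags, lifting) atLeastLessThan_iff imageE mem_Collect_eq)

lemma orient_out: "0 \<le> i \<Longrightarrow> i < j \<Longrightarrow> j < n \<Longrightarrow> 0 \<le> k \<Longrightarrow> k < i \<or> j < k \<Longrightarrow> k < n \<Longrightarrow> 0 < orient (v i) (v j) (v k)"
  using ori[of i j k] ori[of k i j] orient_cycle[of "v k" "v i" "v j"] by auto

lemma orient_in: "0 \<le> i \<Longrightarrow> i < k \<Longrightarrow> k < j \<Longrightarrow> j < n \<Longrightarrow> orient (v i) (v j) (v k) < 0"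
  using ori[of i k j] orient_swap[of "v i" "v k" "v j"] by simp

definition seg :: "int \<times> int \<Rightarrow> (real^2) set" where
  "seg e = closed_segment (v (fst e)) (v (snd e))"

lemma rel_interior_seg:
  "0 \<le> i \<Longrightarrow> i < j \<Longrightarrow> j < n \<Longrightarrow> rel_interior (seg (i, j)) = open_segment (v i) (v j)"
  using v_inj[of i j] by (simp add: seg_def rel_interior_closed_segment)

text \<open>Four points in the plane are affinely dependent, with the areas of the triangles
  omitting one point as coefficients. In convex position all areas are positive and the dependence
  exhibits a common point of the two diagonals of the quadrilateral.\<close>

lemma cross_if:
  assumes "0 \<le> i" "i < k" "k < j" "j < l" "l < n"
  shows "open_segment (v i) (v j) \<inter> open_segment (v k) (v l) \<noteq> {}"
proof -
  define A B C D where "A = orient (v k) (v j) (v l)" and "B = orient (v i) (v j) (v l)"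
    and "C = orient (v i) (v k) (v l)" and "D = orient (v i) (v k) (v j)"
  have pos: "0 < A" "0 < B" "0 < C" "0 < D" unfolding A_def B_def C_def D_def by (rule ori; use assms in simp)+
  have sum: "A + C = B + D" by (simp add: A_def B_def C_def D_def orient_def algebra_simps)
  have eq: "A *\<^sub>R v i + C *\<^sub>R v j = B *\<^sub>R v k + D *\<^sub>R v l"
    by (simp add: A_def B_def C_def D_def vec_eq_iff forall_2 orient_def algebra_simps)
  let ?x = "(1 / (A + C)) *\<^sub>R (A *\<^sub>R v i + C *\<^sub>R v j)"
  have frac: "1 - c / (a + c) = a / (a + c)" "0 < c / (a + c)" "c / (a + c) < 1" if "0 < a" "0 < c" for a c :: real
    using that by (simp_all add: field_simps)
  have "?x = (1 - C / (A + C)) *\<^sub>R v i + (C / (A + C)) *\<^sub>R v j"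
    unfolding frac(1)[OF pos(1,3)] by (simp add: scaleR_add_right)
  moreover have "v i \<noteq> v j" "v k \<noteq> v l" using v_inj[of i j] v_inj[of k l] assms by auto
  ultimately have 1: "?x \<in> open_segment (v i) (v j)"
    using frac(2,3)[OF pos(1,3)] unfolding in_segment by blast
  have "?x = (1 - D / (B + D)) *\<^sub>R v k + (D / (B + D)) *\<^sub>R v l"
    unfolding frac(1)[OF pos(2,4)] eq sum by (simp add: scaleR_add_right)
  hence "?x \<in> open_segment (v k) (v l)"
    using frac(2,3)[OF pos(2,4)] \<open>v k \<noteq> v l\<close> unfolding in_segment by blast
  thus ?thesis using 1 by blast
qed

text \<open>A common inner point forces \<open>v k\<close> and \<open>v l\<close> to opposite sides
  of the line through \<open>v i\<close> and \<open>v j\<close>, or both onto it. The side on which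
  a vertex lies is determined by whether its index is between \<open>i\<close> and
  \<open>j\<close>.\<close>

lemma cross_only_if:
  assumes i: "0 \<le> i" "i < j" "j < n" and k: "0 \<le> k" "k < l" "l < n" and ne: "(i, j) \<noteq> (k, l)"
    and x: "x \<in> open_segment (v i) (v j)" "x \<in> open_segment (v k) (v l)"
  shows "i < k \<and> k < j \<and> j < l \<or> k < i \<and> i < l \<and> l < j"
proof -
  obtain s where s: "x = (1 - s) *\<^sub>R v i + s *\<^sub>R v j" using x(1) unfolding in_segment by blast
  obtain t where t: "0 < t" "t < 1" "x = (1 - t) *\<^sub>R v k + t *\<^sub>R v l" using x(2) unfolding in_segment by blast
  have "orient (v i) (v j) x = 0" unfolding s by (subst orient_affine) simp_all
  hence z: "(1 - t) * orient (v i) (v j) (v k) + t * orient (v i) (v j) (v l) = 0"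
    unfolding t(3) by (subst (asm) orient_affine) simp_all
  define p q where "p = orient (v i) (v j) (v k)" and "q = orient (v i) (v j) (v l)"
  have pq: "(1 - t) * p + t * q = 0" using z by (simp add: p_def q_def)
  have s0: "(p < 0 \<and> 0 < q) \<or> (0 < p \<and> q < 0) \<or> (p = 0 \<and> q = 0)"
  proof -
    have "0 < p \<longrightarrow> q < 0"
    proof
      assume "0 < p"
      hence "0 < (1 - t) * p" using t by simp
      hence "t * q < 0" using pq by linarith
      thus "q < 0" using t(1) by (simp add: mult_less_0_iff)
    qed
    moreover have "p < 0 \<longrightarrow> 0 < q"
    proof
      assume "p < 0"
      hence "(1 - t) * p < 0" using t by (simp add: mult_less_0_iff)
      hence "0 < t * q" using pq by linarith
      thus "0 < q" using t(1) by (simp add: zero_less_mult_iff)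
    qed
    moreover have "p = 0 \<longrightarrow> q = 0" using pq t by auto
    ultimately show ?thesis by (meson linorder_neqE)
  qed
  have sg: "(orient (v i) (v j) (v m) < 0 \<longrightarrow> i < m \<and> m < j) \<and> (0 < orient (v i) (v j) (v m) \<longrightarrow> m < i \<or> j < m) \<and>
      (orient (v i) (v j) (v m) = 0 \<longrightarrow> m = i \<or> m = j)" if m: "0 \<le> m" "m < n" for m
  proof -
    consider "m < i \<or> j < m" | "i < m" "m < j" | "m = i \<or> m = j" by linarith
    thus ?thesis
    proof cases
      case 1
      thus ?thesis using orient_out[OF i m(1) 1 m(2)] by simp
    next
      case 2
      thus ?thesis using orient_in[OF i(1) 2 i(3)] by simp
    qed auto
  qed
  have lm: "k < n" "0 \<le> l" using k by simp_all
  have pk: "p < 0 \<longrightarrow> i < k \<and> k < j" "0 < p \<longrightarrow> k < i \<or> j < k" "p = 0 \<longrightarrow> k = i \<or> k = j"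
    using sg[OF k(1) lm(1)] unfolding p_def by blast+
  have ql: "q < 0 \<longrightarrow> i < l \<and> l < j" "0 < q \<longrightarrow> l < i \<or> j < l" "q = 0 \<longrightarrow> l = i \<or> l = j"
    using sg[OF lm(2) k(3)] unfolding q_def by blast+
  from s0 show ?thesis
  proof (elim disjE conjE)
    assume "p < 0" "0 < q" thus ?thesis using pk(1) ql(2) k(2) by linarith
  next
    assume "0 < p" "q < 0" thus ?thesis using pk(2) ql(1) k(2) by linarith
  next
    assume "p = 0" "q = 0"
    hence "(k = i \<or> k = j) \<and> (l = i \<or> l = j)" using pk ql by blast
    thus ?thesis using ne k(2) i(2) by auto
  qed
qed

lemma crosses_seg:
  assumes "e \<in> dgs n" "f \<in> dgs n" "e \<noteq> f"
  shows "crosses (seg e) (seg f) \<longleftrightarrow> crs e f"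
proof -
  obtain i j k l where ef: "e = (i, j)" "f = (k, l)" by (cases e; cases f)
  have o: "0 \<le> i" "i < j" "j < n" "0 \<le> k" "k < l" "l < n" using assms(1,2) by (auto simp: ef dgs_def)
  have "crosses (seg e) (seg f) \<longleftrightarrow> open_segment (v i) (v j) \<inter> open_segment (v k) (v l) \<noteq> {}"
    unfolding crosses_def ef rel_interior_seg[OF o(1-3)] rel_interior_seg[OF o(4-6)] by blast
  also have "\<dots> \<longleftrightarrow> crs e f"
  proof
    assume "open_segment (v i) (v j) \<inter> open_segment (v k) (v l) \<noteq> {}"
    then obtain x where x: "x \<in> open_segment (v i) (v j)" "x \<in> open_segment (v k) (v l)" by blast
    have "(i, j) \<noteq> (k, l)" using assms(3) ef by simp
    from cross_only_if[OF o this x] show "crs e f" by (simp add: crs_def ef)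
  next
    assume "crs e f"
    hence "i < k \<and> k < j \<and> j < l \<or> k < i \<and> i < l \<and> l < j" by (simp add: crs_def ef)
    thus "open_segment (v i) (v j) \<inter> open_segment (v k) (v l) \<noteq> {}"
    proof (elim disjE conjE)
      assume "i < k" "k < j" "j < l" thus ?thesis by (rule cross_if[OF o(1) _ _ _ o(6)])
    next
      assume "k < i" "i < l" "l < j"
      hence "open_segment (v k) (v l) \<inter> open_segment (v i) (v j) \<noteq> {}" by (rule cross_if[OF o(4) _ _ _ o(3)])
      thus ?thesis by blast
    qed
  qed
  finally show ?thesis .
qed

lemma seg_face: 
  assumes i: "0 \<le> i" "i < j" "j < n" and adj: "j = i + 1 \<or> i = 0 \<and> j = n - 1"
  shows "seg (i, j) edge_of P"
proof -
  have cP: "convex P" using poly by (rule polytope_imp_convex)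
  have PV: "P = convex hull {p. p extreme_point_of P}"
    by (rule Krein_Milman_Minkowski) (simp_all add: poly polytope_imp_compact cP)
  \<comment> \<open>All other vertices lie on the positive side of a segment joining consecutive
    indices, but on the negative side of the one from 0 to \<open>n - 1\<close>; the sign
    compensates. The vector \<open>a\<close> is the normal of the supporting line.\<close>
  define c where "c = (if j = i + 1 then 1 else - 1 :: real)"
  define g where "g = (\<lambda>x. c * orient (v i) (v j) x)"
  define a :: "real^2" where "a = vector [- c * (v j $ 2 - v i $ 2), c * (v j $ 1 - v i $ 1)]"
  have ga: "g x = a \<bullet> x - a \<bullet> v i" for x
    by (simp add: g_def a_def orient_def inner_vec_def sum_2 algebra_simps)
  have gv: "0 \<le> g (v m) \<and> (g (v m) = 0 \<longrightarrow> m = i \<or> m = j)" if m: "0 \<le> m" "m < n" for m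
  proof -
    consider "m = i \<or> m = j" | "m < i \<or> j < m" | "i < m" "m < j" by linarith
    thus ?thesis
    proof cases
      case 1 thus ?thesis by (auto simp: g_def)
    next
      case 2
      hence "j = i + 1" using adj m i by auto
      thus ?thesis using orient_out[OF i m(1) 2 m(2)] by (simp add: g_def c_def)
    next
      case 3
      hence "j \<noteq> i + 1" by simp
      thus ?thesis using orient_in[of i m j] 3 i by (simp add: g_def c_def)
    qed
  qed
  have "{p. p extreme_point_of P} \<subseteq> {x. a \<bullet> x \<ge> a \<bullet> v i}"
  proof
    fix p assume "p \<in> {p. p extreme_point_of P}"
    then obtain m where "0 \<le> m" "m < n" "p = v m" using vertE by blast
    thus "p \<in> {x. a \<bullet> x \<ge> a \<bullet> v i}" using gv[of m] ga[of p] by simp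
  qed
  hence "convex hull {p. p extreme_point_of P} \<subseteq> {x. a \<bullet> x \<ge> a \<bullet> v i}"
    by (rule hull_minimal) (rule convex_halfspace_ge)
  hence "\<And>x. x \<in> P \<Longrightarrow> a \<bullet> x \<ge> a \<bullet> v i" using PV by blast
  hence F: "P \<inter> {x. a \<bullet> x = a \<bullet> v i} face_of P" (is "?F face_of P")
    by (rule face_of_Int_supporting_hyperplane_ge[OF cP])
  have "{p. p extreme_point_of ?F} = {v i, v j}"
  proof -
    have "p extreme_point_of ?F \<longleftrightarrow> p = v i \<or> p = v j" for p
    proof -
      have "p extreme_point_of ?F \<longleftrightarrow> p extreme_point_of P \<and> p \<in> ?F" by (rule extreme_point_of_face[OF F])
      also have "\<dots> \<longleftrightarrow> p = v i \<or> p = v j"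
      proof
        assume p: "p extreme_point_of P \<and> p \<in> ?F"
        then obtain m where m: "0 \<le> m" "m < n" "p = v m" using vertE by blast
        hence "g (v m) = 0" using p ga by simp
        thus "p = v i \<or> p = v j" using gv[OF m(1,2)] m(3) by blast
      next
        assume p: "p = v i \<or> p = v j"
        hence e: "p extreme_point_of P" using v_vert i by auto
        moreover have "g p = 0" using p by (auto simp: g_def)
        ultimately show "p extreme_point_of P \<and> p \<in> ?F" using ga[of p] by (simp add: extreme_point_of_def)
      qed
      finally show ?thesis .
    qed
    thus ?thesis by blast
  qed
  moreover have "compact P" by (simp add: poly polytope_imp_compact)
  hence "compact ?F" using F face_of_imp_compact cP by blast
  hence "?F = convex hull {p. p extreme_point_of ?F}"
    using F by (intro Krein_Milman_Minkowski) (auto dest: face_of_imp_convex)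
  ultimately have "?F = seg (i, j)" by (simp add: seg_def segment_convex_hull)
  moreover have "aff_dim (seg (i, j)) = 1"
    using v_inj[of i j] i by (simp add: seg_def segment_convex_hull aff_dim_convex_hull aff_dim_2)
  ultimately show ?thesis using F by (simp add: edge_of_def)
qed

text \<open>A diagonal has vertices on both sides, and the segment between two such vertices crosses
  it at an inner point. A face containing this point would contain both of these vertices.\<close>

lemma seg_not_edge:
  assumes "e \<in> dgs n"
  shows "\<not> seg e edge_of P"
proof
  obtain i j where e: "e = (i, j)" by (cases e)
  have o: "0 \<le> i" "i + 2 \<le> j" "j < n" "\<not> (i = 0 \<and> j = n - 1)" using assms by (auto simp: e dgs_def)
  define m l where "m = i + 1" and "l = (if i = 0 then n - 1 else 0)"
  have m: "i < m" "m < j" and l: "0 \<le> l" "l < n" "l < i \<or> j < l" using o n3 by (auto simp: m_def l_def)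
  assume "seg e edge_of P"
  hence F: "seg (i, j) face_of P" by (simp add: edge_of_def e)
  have "open_segment (v i) (v j) \<inter> open_segment (v m) (v l) \<noteq> {}"
    using cross_if[of i m j l] cross_if[of l i m j] o m l by (auto simp: Int_commute open_segment_commute)
  then obtain x where x: "x \<in> open_segment (v i) (v j)" "x \<in> open_segment (v m) (v l)" by blast
  have "x \<in> seg (i, j)" using x(1) by (simp add: seg_def open_segment_def)
  moreover have "v m \<in> P" "v l \<in> P" using v_vert[of m] v_vert[of l] m l o by (auto simp: extreme_point_of_def)
  ultimately have "v m \<in> seg (i, j)" using F x(2) unfolding face_of_def by blast
  then obtain s where "v m = (1 - s) *\<^sub>R v i + s *\<^sub>R v j" unfolding seg_def fst_conv snd_conv in_segment by blast
  hence "orient (v i) (v j) (v m) = 0" using orient_affine[of "1 - s" s "v i" "v j" "v i" "v j"] by simp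
  thus False using orient_in[of i m j] o m by simp
qed

lemma diagonals_eq: "diagonals P = seg ` dgs n"
proof (intro equalityI subsetI)
  fix t assume "t \<in> diagonals P"
  then obtain p q where t: "t = closed_segment p q" "p extreme_point_of P" "q extreme_point_of P" "p \<noteq> q" "\<not> closed_segment p q edge_of P"
    by (auto simp: diagonals_def polygon_vertices_def)
  obtain i j where ij: "0 \<le> i" "i < n" "p = v i" "0 \<le> j" "j < n" "q = v j" using vertE t(2,3) by blast
  define i' j' where "i' = min i j" and "j' = max i j"
  have ts: "t = seg (i', j')"
  proof (cases "i \<le> j")
    case True thus ?thesis using t(1) ij by (simp add: seg_def i'_def j'_def)
  next
    case False thus ?thesis using t(1) ij closed_segment_commute[of "v i" "v j"] by (simp add: seg_def i'_def j'_def)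
  qed
  have "i \<noteq> j" using t(4) ij by auto
  hence o: "0 \<le> i'" "i' < j'" "j' < n" using ij by (auto simp: i'_def j'_def)
  hence "\<not> (j' = i' + 1 \<or> i' = 0 \<and> j' = n - 1)" using seg_face[OF o] t(1,5) ts by auto
  hence "(i', j') \<in> dgs n" using o by (auto simp: dgs_def)
  thus "t \<in> seg ` dgs n" using ts by blast
next
  fix t assume "t \<in> seg ` dgs n"
  then obtain i j where e: "(i, j) \<in> dgs n" "t = seg (i, j)" by auto
  hence o: "0 \<le> i" "i < j" "j < n" by (auto simp: dgs_def)
  have "v i extreme_point_of P" "v j extreme_point_of P" "v i \<noteq> v j" using v_vert v_inj[of i j] o by auto
  thus "t \<in> diagonals P" using seg_not_edge[OF e(1)] e(2) unfolding diagonals_def polygon_vertices_def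
    by (auto simp: seg_def)
qed

lemma seg_inj: "inj_on seg (dgs n)"
proof (rule inj_onI)
  fix e f assume ef: "e \<in> dgs n" "f \<in> dgs n" "seg e = seg f"
  obtain i j k l where e: "e = (i, j)" "f = (k, l)" by (cases e; cases f)
  have o: "0 \<le> i" "i < j" "j < n" "0 \<le> k" "k < l" "l < n" using ef(1,2) by (auto simp: e dgs_def)
  have "{v i, v j} = {v k, v l}" using ef(3) unfolding e seg_def fst_conv snd_conv closed_segment_eq .
  hence "v i = v k \<and> v j = v l \<or> v i = v l \<and> v j = v k" by (auto simp: doubleton_eq_iff)
  thus "e = f" using v_inj o unfolding e by (smt (verit))
qed

lemma crossed_iff:
  assumes "F \<subseteq> dgs n"
  shows "crossed_at_most l (seg ` F) \<longleftrightarrow> lcr l F"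
proof -
  have "card {t \<in> seg ` F - {seg e}. crosses (seg e) t} = card {f \<in> F. crs e f}" if e: "e \<in> F" for e
  proof -
    have "{t \<in> seg ` F - {seg e}. crosses (seg e) t} = seg ` {f \<in> F. crs e f}"
    proof (intro equalityI subsetI)
      fix t assume "t \<in> {t \<in> seg ` F - {seg e}. crosses (seg e) t}"
      then obtain f where f: "f \<in> F" "t = seg f" "seg f \<noteq> seg e" "crosses (seg e) (seg f)" by blast
      hence "crs e f" using crosses_seg[of e f] assms e by blast
      thus "t \<in> seg ` {f \<in> F. crs e f}" using f by blast
    next
      fix t assume "t \<in> seg ` {f \<in> F. crs e f}"
      then obtain f where f: "f \<in> F" "t = seg f" "crs e f" by blast
      have ne: "f \<noteq> e" using f(3) by (auto simp: crs_def)
      hence "seg f \<noteq> seg e" using seg_inj f(1) e assms by (meson inj_onD subsetD)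
      moreover have "crosses (seg e) (seg f)" using crosses_seg[of e f] assms e f ne by blast
      ultimately show "t \<in> {t \<in> seg ` F - {seg e}. crosses (seg e) t}" using f by blast
    qed
    moreover have "inj_on seg {f \<in> F. crs e f}" by (rule inj_on_subset[OF seg_inj]) (use assms in blast)
    ultimately show ?thesis by (simp add: card_image)
  qed
  thus ?thesis by (simp add: crossed_at_most_def lcr_def)
qed

lemma max_edges_eq: "max_edges l P = Max {card F | F. F \<subseteq> dgs n \<and> lcr l F}"
proof -
  have "{card F | F. F \<subseteq> diagonals P \<and> crossed_at_most l F} = {card F | F. F \<subseteq> dgs n \<and> lcr l F}"
  proof (intro equalityI subsetI)
    fix m assume "m \<in> {card F | F. F \<subseteq> diagonals P \<and> crossed_at_most l F}"
    then obtain H where H: "m = card H" "H \<subseteq> seg ` dgs n" "crossed_at_most l H" unfolding diagonals_eq by blast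
    then obtain F where F: "F \<subseteq> dgs n" "H = seg ` F" by (meson subset_imageE)
    have "card H = card F" unfolding F(2) by (rule card_image[OF inj_on_subset[OF seg_inj F(1)]])
    thus "m \<in> {card F | F. F \<subseteq> dgs n \<and> lcr l F}" using H F crossed_iff[OF F(1)] by blast
  next
    fix m assume "m \<in> {card F | F. F \<subseteq> dgs n \<and> lcr l F}"
    then obtain F where F: "m = card F" "F \<subseteq> dgs n" "lcr l F" by blast
    have "card (seg ` F) = card F" by (rule card_image[OF inj_on_subset[OF seg_inj F(2)]])
    hence "m = card (seg ` F)" using F(1) by simp
    moreover have "seg ` F \<subseteq> diagonals P" using F(2) unfolding diagonals_eq by (rule image_mono)
    moreover have "crossed_at_most l (seg ` F)" using crossed_iff[OF F(2)] F(3) by blast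
    ultimately show "m \<in> {card F | F. F \<subseteq> diagonals P \<and> crossed_at_most l F}" by blast
  qed
  thus ?thesis by (simp add: max_edges_def)
qed

lemma max_edges_value:
  assumes "\<And>F. F \<subseteq> dgs n \<Longrightarrow> lcr l F \<Longrightarrow> card F \<le> m" and "\<exists>F. F \<subseteq> dgs n \<and> lcr l F \<and> card F = m"
  shows "max_edges l P = m"
  unfolding max_edges_eq
proof (rule Max_eqI)
  have "{card F | F. F \<subseteq> dgs n \<and> lcr l F} \<subseteq> card ` Pow (dgs n)" by blast
  thus "finite {card F | F. F \<subseteq> dgs n \<and> lcr l F}" by (rule finite_subset) (simp add: finite_dgs)
qed (use assms in blast)+

end

section \<open>Closed forms of the bounds\<close>

lemma value0: "1 \<le> s \<Longrightarrow> real (s - 1) = real (s + 2) - 3"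
  by (simp add: of_nat_diff)

lemma value1:
  assumes "1 \<le> s"
  shows "real (g1 s - 1) = 3 / 2 * (real (s + 2) - 3) + delta1 (s + 2)"
proof -
  define q where "q = s div 2"
  have "s = 2 * q \<or> s = 2 * q + 1" unfolding q_def by presburger
  thus ?thesis
  proof
    assume s: "s = 2 * q"
    have "real (3 * q - 1) = 3 * real q - 1" using assms s by (simp add: of_nat_diff)
    thus ?thesis by (simp add: s g1_def delta1_def field_simps)
  next
    assume s: "s = 2 * q + 1"
    have "g1 s - 1 = 3 * q" "(s + 2) mod 2 = 1" unfolding s g1_def by (simp, presburger)
    thus ?thesis by (simp add: s delta1_def field_simps)
  qed
qed

lemma value2:
  assumes "1 \<le> s"
  shows "real (g2 s - 1) = 2 * (real (s + 2) - 3) + delta2 (s + 2)"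
proof (cases "s mod 3 = 0")
  case True
  hence "g2 s = 2 * s" "(s + 2) mod 3 = 2" unfolding g2_def by (simp, presburger)
  thus ?thesis using assms by (simp add: delta2_def of_nat_diff)
next
  case False
  hence "g2 s - 1 = 2 * s - 2" "(s + 2) mod 3 \<noteq> 2" unfolding g2_def by (simp, presburger)
  thus ?thesis using assms by (simp add: delta2_def of_nat_diff)
qed

lemma mod4_cases:
  obtains (0) q :: nat where "s = 4 * q" "s div 4 = q" "s mod 4 = 0" "(s + 2) mod 4 = 2"
    | (1) q where "s = 4 * q + 1" "s div 4 = q" "s mod 4 = 1" "(s + 2) mod 4 = 3"
    | (2) q where "s = 4 * q + 2" "s div 4 = q" "s mod 4 = 2" "(s + 2) mod 4 = 0"
    | (3) q where "s = 4 * q + 3" "s div 4 = q" "s mod 4 = 3" "(s + 2) mod 4 = 1"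
proof -
  have e: "s = 4 * (s div 4) + s mod 4" by simp
  have m: "(s + 2) mod 4 = (s mod 4 + 2) mod 4" by presburger
  from nat_mod4[of s] show ?thesis
  proof (elim disjE)
    assume r: "s mod 4 = 0" show ?thesis by (rule 0[of "s div 4"]) (use r e m in simp_all)
  next
    assume r: "s mod 4 = 1" show ?thesis by (rule 1[of "s div 4"]) (use r e m in simp_all)
  next
    assume r: "s mod 4 = 2" show ?thesis by (rule 2[of "s div 4"]) (use r e m in simp_all)
  next
    assume r: "s mod 4 = 3" show ?thesis by (rule 3[of "s div 4"]) (use r e m in simp_all)
  qed
qed

lemma value3:
  assumes "1 \<le> s"
  shows "real (g3 s - 1) = 9 / 4 * (real (s + 2) - 3) + delta3 (s + 2)"
proof (cases s rule: mod4_cases)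
  case (0 q)
  hence "g3 s = 9 * q" "1 \<le> q" using assms by (auto simp: g3_def)
  thus ?thesis using 0(1,4) by (simp add: delta3_def of_nat_diff field_simps)
next
  case (1 q)
  hence "g3 s - 1 = 9 * q" by (simp add: g3_def)
  thus ?thesis using 1(1,4) by (simp add: delta3_def field_simps)
next
  case (2 q)
  hence "g3 s - 1 = 9 * q + 2" by (simp add: g3_def)
  thus ?thesis using 2(1,4) by (simp add: delta3_def field_simps)
next
  case (3 q)
  hence "g3 s - 1 = 9 * q + 5" by (simp add: g3_def)
  thus ?thesis using 3(1,4) by (simp add: delta3_def field_simps)
qed

lemma value4:
  assumes "3 \<le> s"
  shows "real (g4 s - 1) = 5 / 2 * (real (s + 2) - 3) + delta4 (s + 2)"
proof -
  have g: "g4 s = 2 * s + 2 * (s div 4)" using assms by (simp add: g4_def)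
  show ?thesis
  proof (cases s rule: mod4_cases)
    case (0 q)
    hence "g4 s = 10 * q" "1 \<le> q" using assms g by auto
    thus ?thesis using 0(1,4) by (simp add: delta4_def of_nat_diff field_simps)
  next
    case (1 q)
    hence "g4 s - 1 = 10 * q + 1" using g by simp
    thus ?thesis using 1(1,4) by (simp add: delta4_def field_simps)
  next
    case (2 q)
    hence "g4 s - 1 = 10 * q + 3" using g by simp
    thus ?thesis using 2(1,4) by (simp add: delta4_def field_simps)
  next
    case (3 q)
    hence "g4 s - 1 = 10 * q + 5" using g by simp
    thus ?thesis using 3(1,4) by (simp add: delta4_def field_simps)
  qed
qed

theorem theorem4:
  fixes n :: nat and P :: "(real^2) set"
  assumes "n \<ge> 3" and "convex_ngon n P"
  shows "real (max_edges 0 P) = real n - 3 \<and>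
    real (max_edges 1 P) = 3/2 * (real n - 3) + delta1 n \<and>
    real (max_edges 2 P) = 2 * (real n - 3) + delta2 n \<and>
    real (max_edges 3 P) = 9/4 * (real n - 3) + delta3 n \<and>
    (n = 3 \<longrightarrow> max_edges 4 P = 0) \<and>
    (n = 4 \<longrightarrow> max_edges 4 P = 2) \<and>
    (n \<ge> 5 \<longrightarrow> real (max_edges 4 P) = 5/2 * (real n - 3) + delta4 n)"
proof -
  obtain v where v: "bij_betw v {0..<int n} (polygon_vertices P)"
    "\<And>i j k. 0 \<le> i \<Longrightarrow> i < j \<Longrightarrow> j < k \<Longrightarrow> k < int n \<Longrightarrow> 0 < orient (v i) (v j) (v k)"
    using ordered_vertices[OF assms(2,1)] by blast
  interpret ngon "int n" P v
  proof
    show "3 \<le> int n" using assms(1) by simp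
    show "polytope P" using assms(2) by (simp add: convex_ngon_def)
  qed (use v in blast)+
  define s where "s = n - 2"
  have s: "1 \<le> s" "n = s + 2" using assms(1) by (simp_all add: s_def)
  have val: "max_edges l P = g s - 1" if u: "ub l g" and a: "att l (int s + 2) (g s - 1)" for l g
  proof (rule max_edges_value)
    fix F assume F: "F \<subseteq> dgs (int n)" "lcr l F"
    have "card F + 1 \<le> g (nat (int n - 2))" using u F n3 unfolding ub_def by blast
    moreover have "nat (int n - 2) = s" using s by simp
    ultimately show "card F \<le> g s - 1" by simp
  next
    have "int s + 2 = int n" using s by simp
    thus "\<exists>F. F \<subseteq> dgs (int n) \<and> lcr l F \<and> card F = g s - 1" using a by (simp add: att_def)
  qed
  have "max_edges 0 P = s - 1" by (rule val[OF ub0 att0[OF s(1)]])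
  moreover have "max_edges 1 P = g1 s - 1" by (rule val[OF ub1 att1[OF s(1)]])
  moreover have "max_edges 2 P = g2 s - 1" by (rule val[OF ub2 att2[OF s(1)]])
  moreover have "max_edges 3 P = g3 s - 1" by (rule val[OF ub3 att3[OF s(1)]])
  moreover have "max_edges 4 P = g4 s - 1" by (rule val[OF ub4 att4[OF s(1)]])
  moreover have "n = 3 \<longrightarrow> g4 s - 1 = 0" "n = 4 \<longrightarrow> g4 s - 1 = 2" by (simp_all add: s_def g4_def)
  moreover have "n \<ge> 5 \<longrightarrow> real (g4 s - 1) = 5/2 * (real n - 3) + delta4 n" using value4[of s] s(2) by simp
  ultimately show ?thesis using value0[OF s(1)] value1[OF s(1)] value2[OF s(1)] value3[OF s(1)]
    unfolding s(2)[symmetric] by simp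
qed

end
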